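(* Let $0<p\le 1$, $C\ge 1$, and let $\mu\in\mathcal{M}^p_C$ be such that (1) $\mu$ is quasi-irreducible, and (2) $L_1(\mu)>L_2(\mu)$. Then the function $\mathcal{M}^p_C\ni\nu\mapsto L_1(\nu)$ is Hölder continuous in a small neighborhood of $\mu$ with respect to $W_p$; that is, there exist $\delta>0$, $K<\infty$ and $\theta>0$ such that $|L_1(\nu)-L_1(\nu')|\le K\,W_p(\nu,\nu')^{\theta}$ for all $\nu,\nu'\in\mathcal{M}^p_C$ with $W_p(\nu,\mu)<\delta$ and $W_p(\nu',\mu)<\delta$.
   Context: $\mathrm{Mat}_m(\mathbb{R})$ is the space of real $m\times m$ matrices with the operator norm for the Euclidean norm on $\mathbb{R}^m$. For a Borel probability measure $\mu$ on $\mathrm{Mat}_m(\mathbb{R})$ put $\bar\Theta_p(\mu)=\int\|g\|^p\,d\mu(g)$ and $\underline\Theta_p(\mu)=\sup_{\|v\|=1}\int\|gv\|^{-p}\,d\mu(g)$ (with $0^{-p}=+\infty$), and let $\mathcal{M}^p_C$ be the set of all $\mu$ with $\bar\Theta_p(\mu)\le C$ and $\underline\Theta_p(\mu)\le C$. $W_p(\mu,\nu)=\inf_\pi\iint\|g-g'\|^p\,d\pi(g,g')$, the infimum over all couplings $\pi$ of $\mu$ and $\nu$ (probability measures on the product with marginals $\mu$ and $\nu$). For $\omega=(\omega_n)_{n\ge0}\in\mathrm{Mat}_m(\mathbb{R})^{\mathbb{N}}$ write $A^n(\omega)=\omega_{n-1}\cdots\omega_1\omega_0$. The Lyapunov exponents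 are the $\mu^{\mathbb{N}}$-almost sure limits $L_1(\mu)=\lim_n\frac1n\log\|A^n(\omega)\|$ and $L_2(\mu)=\lim_n\frac1n\log s_2(A^n(\omega))\in[-\infty,\infty)$, where $s_2$ is the second largest singular value. $\mu$ is quasi-irreducible if for every proper nonzero linear subspace $E\subset\mathbb{R}^m$ such that $gE\subseteq E$ for $\mu$-almost every $g$, the cocycle induced on $E$ has first Lyapunov exponent equal to $L_1(\mu)$, i.e. $\lim_n\frac1n\log\|A^n(\omega)|_E\|=L_1(\mu)$ for $\mu^{\mathbb{N}}$-a.e. $\omega$. *)

theory Defs
  imports "HOL-Probability.Probability"
begin

text \<open>
  The type \<open>real ^ 'n ^ 'n\<close> carries the Frobenius norm in HOL-Analysis, so the operator norm has to
  be taken from \<open>onorm\<close>. The Borel sets are the same for both norms.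
\<close>

definition opnorm :: "real ^ 'n ^ 'n \<Rightarrow> real" where
  "opnorm g = onorm ((*v) g)"

definition opnorm_on :: "(real ^ 'n) set \<Rightarrow> real ^ 'n ^ 'n \<Rightarrow> real" where
  "opnorm_on E g = (SUP v\<in>{v \<in> E. norm v = 1}. norm (g *v v))"


section \<open>Moment conditions and the transport distance\<close>

definition upper_moment :: "real \<Rightarrow> (real ^ 'n ^ 'n) measure \<Rightarrow> ennreal" where
  "upper_moment p \<mu> = (\<integral>\<^sup>+ g. ennreal (opnorm g powr p) \<partial>\<mu>)"

text \<open>The case distinction is needed because \<open>0 powr (- p) = 0\<close> in HOL.\<close>

definition lower_moment :: "real \<Rightarrow> (real ^ 'n ^ 'n) measure \<Rightarrow> ennreal" where
  "lower_moment p \<mu> =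
     (SUP v\<in>{v. norm v = 1}. \<integral>\<^sup>+ g. (if g *v v = 0 then \<infinity> else ennreal (norm (g *v v) powr (- p))) \<partial>\<mu>)"

definition moment_class :: "real \<Rightarrow> real \<Rightarrow> (real ^ 'n ^ 'n) measure set" where
  "moment_class p C =
     {\<mu>. prob_space \<mu> \<and> sets \<mu> = sets borel \<and> upper_moment p \<mu> \<le> ennreal C \<and> lower_moment p \<mu> \<le> ennreal C}"

definition couplings :: "'a measure \<Rightarrow> 'b measure \<Rightarrow> ('a \<times> 'b) measure set" where
  "couplings \<mu> \<nu> =
     {\<pi>. prob_space \<pi> \<and> sets \<pi> = sets (\<mu> \<Otimes>\<^sub>M \<nu>) \<and> distr \<pi> \<mu> fst = \<mu> \<and> distr \<pi> \<nu> snd = \<nu>}"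

text \<open>No \<open>p\<close>-th root is taken; for \<open>p \<le> 1\<close> this is already a distance.\<close>

definition wasserstein :: "real \<Rightarrow> (real ^ 'n ^ 'n) measure \<Rightarrow> (real ^ 'n ^ 'n) measure \<Rightarrow> ennreal" where
  "wasserstein p \<mu> \<nu> = (INF \<pi>\<in>couplings \<mu> \<nu>. \<integral>\<^sup>+ (g, g'). ennreal (opnorm (g - g') powr p) \<partial>\<pi>)"


section \<open>Singular values\<close>

text \<open>
  The singular values of \<open>g\<close> are the square roots of the eigenvalues of \<open>transpose g ** g\<close>. The
  multiplicity of a singular value \<open>t\<close> is the dimension of the corresponding eigenspace (this matrix
  is symmetric, so geometric and algebraic multiplicities agree).
\<close>

definition singular_space :: "real ^ 'n ^ 'n \<Rightarrow> real \<Rightarrow> (real ^ 'n) set" where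
  "singular_space g t = {v. (transpose g ** g) *v v = t\<^sup>2 *\<^sub>R v}"

definition singular_values :: "real ^ 'n ^ 'n \<Rightarrow> real set" where
  "singular_values g = {t. 0 \<le> t \<and> (\<exists>v\<in>singular_space g t. v \<noteq> 0)}"

text \<open>
  The \<open>k\<close>-th largest singular value, counted with multiplicity, for \<open>k \<ge> 1\<close>: the largest \<open>t\<close> such
  that at least \<open>k\<close> singular values are \<open>\<ge> t\<close>. By convention it is \<open>0\<close> for \<open>k > m\<close>, which matters
  only for the second singular value when \<open>m = 1\<close>.
\<close>

definition singular_value :: "nat \<Rightarrow> real ^ 'n ^ 'n \<Rightarrow> real" where
  "singular_value k g =
     (if k \<le> CARD('n)
      then Max {t \<in> singular_values g. k \<le> (\<Sum>s\<in>{s \<in> singular_values g. t \<le> s}. dim (singular_space g s))}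
      else 0)"


section \<open>Lyapunov exponents\<close>

text \<open>The logarithm with \<open>log 0 = -\<infinity>\<close>; \<open>ln 0 = 0\<close> in HOL.\<close>

definition elog :: "real \<Rightarrow> ereal" where
  "elog x = (if x = 0 then - \<infinity> else ereal (ln x))"

primrec cocycle :: "nat \<Rightarrow> (nat \<Rightarrow> real ^ 'n ^ 'n) \<Rightarrow> real ^ 'n ^ 'n" where
  "cocycle 0 \<omega> = mat 1"
| "cocycle (Suc n) \<omega> = \<omega> n ** cocycle n \<omega>"

abbreviation iid :: "'a measure \<Rightarrow> (nat \<Rightarrow> 'a) measure" where
  "iid \<mu> \<equiv> (\<Pi>\<^sub>M i\<in>UNIV. \<mu>)"

definition has_growth_rate ::
    "(real ^ 'n ^ 'n) measure \<Rightarrow> (real ^ 'n ^ 'n \<Rightarrow> real) \<Rightarrow> ereal \<Rightarrow> bool" where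
  "has_growth_rate \<mu> f l \<longleftrightarrow>
     (AE \<omega> in iid \<mu>. (\<lambda>n. elog (f (cocycle n \<omega>)) / ereal (real n)) \<longlonglongrightarrow> l)"

definition lyapunov1 :: "(real ^ 'n ^ 'n) measure \<Rightarrow> ereal" where
  "lyapunov1 \<mu> = (THE l. has_growth_rate \<mu> opnorm l)"

definition lyapunov2 :: "(real ^ 'n ^ 'n) measure \<Rightarrow> ereal" where
  "lyapunov2 \<mu> = (THE l. has_growth_rate \<mu> (singular_value 2) l)"

definition quasi_irreducible :: "(real ^ 'n ^ 'n) measure \<Rightarrow> bool" where
  "quasi_irreducible \<mu> \<longleftrightarrow>
     (\<forall>E. subspace E \<and> E \<noteq> {0} \<and> E \<noteq> UNIV \<and> (AE g in \<mu>. (*v) g ` E \<subseteq> E)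
        \<longrightarrow> has_growth_rate \<mu> (opnorm_on E) (lyapunov1 \<mu>))"


section \<open>Sanity checks\<close>

lemma has_growth_rate_unique:
  assumes "prob_space \<mu>" "has_growth_rate \<mu> f l" "has_growth_rate \<mu> f l'"
  shows "l = l'"
proof -
  interpret P: product_prob_space "\<lambda>_::nat. \<mu>" UNIV
    by (simp add: product_prob_space_def product_prob_space_axioms_def product_sigma_finite_def
        assms(1) prob_space_imp_sigma_finite)
  have "AE \<omega> in iid \<mu>. l = l'"
    using assms(2,3) unfolding has_growth_rate_def
    by eventually_elim (rule LIMSEQ_unique)
  then show ?thesis
    using P.P.AE_const by simp
qed

lemma opnorm_nonneg: "0 \<le> opnorm g"
  unfolding opnorm_def by (rule onorm_pos_le) (rule matrix_vector_mul_bounded_linear)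

lemma opnorm_diff_le: "opnorm (g - h) \<le> opnorm g + opnorm h"
proof -
  have "(*v) (g - h) = (\<lambda>v. g *v v + - (h *v v))"
    by (simp add: matrix_vector_mult_diff_rdistrib fun_eq_iff)
  then have "opnorm (g - h) = onorm (\<lambda>v. g *v v + - (h *v v))"
    by (simp add: opnorm_def)
  also have "\<dots> \<le> onorm ((*v) g) + onorm (\<lambda>v. - (h *v v))"
    by (intro onorm_triangle bounded_linear_minus matrix_vector_mul_bounded_linear)
  finally show ?thesis
    by (simp add: opnorm_def onorm_neg)
qed

lemma opnorm_minus_commute: "opnorm (g - h) = opnorm (h - g)"
proof -
  have "(*v) (g - h) = (\<lambda>v. - ((h - g) *v v))"
    by (simp add: matrix_vector_mult_diff_rdistrib fun_eq_iff)
  then show ?thesis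
    by (simp add: opnorm_def onorm_neg)
qed

lemma continuous_on_opnorm: "continuous_on UNIV (opnorm :: real ^ 'n ^ 'n \<Rightarrow> real)"
proof -
  have lip: "\<bar>opnorm g - opnorm h\<bar> \<le> (\<Sum>i\<in>UNIV. \<Sum>j\<in>UNIV. \<bar>(g - h) $ i $ j\<bar>)" for g h :: "real ^ 'n ^ 'n"
  proof -
    have "opnorm (g - h) \<le> (\<Sum>i\<in>UNIV. \<Sum>j\<in>UNIV. \<bar>(g - h) $ i $ j\<bar>)"
      unfolding opnorm_def by (rule onorm_le_matrix_component_sum)
    moreover have "opnorm g \<le> opnorm (g - h) + opnorm h" "opnorm h \<le> opnorm (g - h) + opnorm g"
      using opnorm_diff_le[of "g - h" "- h"] opnorm_diff_le[of "h - g" "- g"]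
        opnorm_minus_commute[of g h] opnorm_minus_commute[of 0 h] opnorm_minus_commute[of 0 g]
      by simp_all
    ultimately show ?thesis by linarith
  qed
  have "(opnorm \<longlongrightarrow> opnorm h) (at h)" for h :: "real ^ 'n ^ 'n"
  proof -
    have "((\<lambda>g. \<Sum>i\<in>UNIV. \<Sum>j\<in>UNIV. \<bar>(g - h) $ i $ j\<bar>) \<longlongrightarrow>
        (\<Sum>i\<in>UNIV. \<Sum>j\<in>UNIV. \<bar>(h - h) $ i $ j\<bar>)) (at h)"
      by (intro tendsto_intros)
    then have "((\<lambda>g. \<Sum>i\<in>UNIV. \<Sum>j\<in>UNIV. \<bar>(g - h) $ i $ j\<bar>) \<longlongrightarrow> 0) (at h)"
      by simp
    then have "((\<lambda>g. opnorm g - opnorm h) \<longlongrightarrow> 0) (at h)"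
      by (rule Lim_null_comparison[rotated]) (use lip in \<open>auto intro!: always_eventually\<close>)
    then show ?thesis
      by (simp add: LIM_zero_iff)
  qed
  then show ?thesis
    by (simp add: continuous_on_def)
qed

lemma borel_measurable_opnorm [measurable]: "opnorm \<in> borel_measurable borel"
  by (rule borel_measurable_continuous_onI[OF continuous_on_opnorm])

text \<open>Hence passing from \<open>ennreal\<close> to \<open>real\<close> loses nothing for distances inside a moment class.\<close>

lemma wasserstein_finite:
  fixes \<mu> \<nu> :: "(real ^ 'n ^ 'n) measure"
  assumes "0 < p" "\<mu> \<in> moment_class p C" "\<nu> \<in> moment_class p C"
  shows "wasserstein p \<mu> \<nu> < \<infinity>"
proof -
  have [measurable_cong]: "sets \<mu> = sets borel" "sets \<nu> = sets borel"
    and u: "upper_moment p \<mu> \<le> ennreal C" "upper_moment p \<nu> \<le> ennreal C"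
    and P: "prob_space \<mu>" "prob_space \<nu>"
    using assms by (auto simp: moment_class_def)
  interpret M: prob_space \<mu> by fact
  interpret N: prob_space \<nu> by fact
  interpret pair_prob_space \<mu> \<nu> ..
  have snd: "distr (\<mu> \<Otimes>\<^sub>M \<nu>) \<nu> snd = \<nu>"
  proof (rule measure_eqI)
    fix A assume "A \<in> sets (distr (\<mu> \<Otimes>\<^sub>M \<nu>) \<nu> snd)"
    then have A: "A \<in> sets \<nu>" by simp
    have "snd -` A \<inter> space (\<mu> \<Otimes>\<^sub>M \<nu>) = space \<mu> \<times> A"
      using sets.sets_into_space[OF A] by (auto simp: space_pair_measure)
    then show "emeasure (distr (\<mu> \<Otimes>\<^sub>M \<nu>) \<nu> snd) A = emeasure \<nu> A"
      using A by (simp add: emeasure_distr N.emeasure_pair_measure_Times M.emeasure_space_1)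
  qed simp
  have "\<mu> \<Otimes>\<^sub>M \<nu> \<in> couplings \<mu> \<nu>"
    by (simp add: couplings_def prob_space_axioms N.distr_pair_fst snd)
  then have "wasserstein p \<mu> \<nu> \<le> (\<integral>\<^sup>+ (g, g'). ennreal (opnorm (g - g') powr p) \<partial>(\<mu> \<Otimes>\<^sub>M \<nu>))"
    unfolding wasserstein_def by (rule INF_lower)
  also have "\<dots> \<le> (\<integral>\<^sup>+ x. ennreal (2 powr p) *
      (ennreal (opnorm (fst x) powr p) + ennreal (opnorm (snd x) powr p)) \<partial>(\<mu> \<Otimes>\<^sub>M \<nu>))"
  proof (rule nn_integral_mono, clarsimp)
    fix g g' :: "real ^ 'n ^ 'n"
    have "opnorm (g - g') powr p \<le> (2 * max (opnorm g) (opnorm g')) powr p"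
      using opnorm_diff_le[of g g'] assms(1) by (intro powr_mono2) (auto simp: opnorm_nonneg)
    also have "\<dots> = 2 powr p * max (opnorm g) (opnorm g') powr p"
      by (simp add: powr_mult opnorm_nonneg le_max_iff_disj)
    also have "\<dots> \<le> 2 powr p * (opnorm g powr p + opnorm g' powr p)"
      by (intro mult_left_mono) (auto simp: max_def)
    finally have "ennreal (opnorm (g - g') powr p) \<le> ennreal (2 powr p * (opnorm g powr p + opnorm g' powr p))"
      by (rule ennreal_leI)
    also have "\<dots> = ennreal (2 powr p) * (ennreal (opnorm g powr p) + ennreal (opnorm g' powr p))"
      by (simp add: ennreal_mult)
    finally show "ennreal (opnorm (g - g') powr p) \<le>
        ennreal (2 powr p) * (ennreal (opnorm g powr p) + ennreal (opnorm g' powr p))" .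
  qed
  also have "\<dots> = ennreal (2 powr p) * ((\<integral>\<^sup>+ x. ennreal (opnorm (fst x) powr p) \<partial>(\<mu> \<Otimes>\<^sub>M \<nu>)) +
      (\<integral>\<^sup>+ x. ennreal (opnorm (snd x) powr p) \<partial>(\<mu> \<Otimes>\<^sub>M \<nu>)))"
    by (simp add: nn_integral_cmult nn_integral_add)
  also have "(\<integral>\<^sup>+ x. ennreal (opnorm (fst x) powr p) \<partial>(\<mu> \<Otimes>\<^sub>M \<nu>)) = upper_moment p (distr (\<mu> \<Otimes>\<^sub>M \<nu>) \<mu> fst)"
    unfolding upper_moment_def by (subst nn_integral_distr) auto
  also have "(\<integral>\<^sup>+ x. ennreal (opnorm (snd x) powr p) \<partial>(\<mu> \<Otimes>\<^sub>M \<nu>)) = upper_moment p (distr (\<mu> \<Otimes>\<^sub>M \<nu>) \<nu> snd)"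
    unfolding upper_moment_def by (subst nn_integral_distr) auto
  also have "ennreal (2 powr p) * (upper_moment p (distr (\<mu> \<Otimes>\<^sub>M \<nu>) \<mu> fst) +
      upper_moment p (distr (\<mu> \<Otimes>\<^sub>M \<nu>) \<nu> snd)) \<le> ennreal (2 powr p) * (ennreal C + ennreal C)"
    unfolding N.distr_pair_fst snd by (intro mult_left_mono add_mono u) auto
  also have "\<dots> < \<infinity>"
    by (simp add: ennreal_mult_less_top)
  finally show ?thesis .
qed

lemma finite_singular_values: "finite (singular_values g)"
proof -
  define w where "w t = (SOME v. v \<in> singular_space g t \<and> v \<noteq> 0)" for t
  have w: "w t \<in> singular_space g t \<and> w t \<noteq> 0" if "t \<in> singular_values g" for t
    unfolding w_def by (rule someI_ex) (use that in \<open>auto simp: singular_values_def\<close>)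
  have orth: "w s \<bullet> w t = 0" if "s \<in> singular_values g" "t \<in> singular_values g" "s \<noteq> t" for s t
  proof -
    have *: "((transpose g ** g) *v a) \<bullet> b = (g *v a) \<bullet> (g *v b)" for a b
      unfolding matrix_vector_mul_assoc[symmetric] transpose_matrix_vector by (rule dot_lmul_matrix)
    have "((transpose g ** g) *v w s) \<bullet> w t = w s \<bullet> ((transpose g ** g) *v w t)"
      using *[of "w s" "w t"] *[of "w t" "w s"] by (metis inner_commute)
    then have "s\<^sup>2 * (w s \<bullet> w t) = t\<^sup>2 * (w s \<bullet> w t)"
      using w[OF that(1)] w[OF that(2)] by (simp add: singular_space_def)
    moreover have "s\<^sup>2 \<noteq> t\<^sup>2"
      using that by (simp add: singular_values_def power2_eq_iff_nonneg)
    ultimately show ?thesis by simp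
  qed
  have "inj_on w (singular_values g)"
  proof (rule inj_onI, rule ccontr)
    fix s t assume st: "s \<in> singular_values g" "t \<in> singular_values g" "w s = w t" "s \<noteq> t"
    then show False using orth[OF st(1,2,4)] w[OF st(1)] by simp
  qed
  moreover have "finite (w ` singular_values g)"
    by (rule pairwise_orthogonal_imp_finite)
      (auto simp: pairwise_def orthogonal_def intro: orth)
  ultimately show ?thesis
    by (rule finite_imageD[rotated])
qed

end

theory Submission
  imports Defs
begin

text \<open>
  The exponent \<open>lyapunov1 \<nu>\<close> is the limit of the means of \<open>ln (opnorm (cocycle N \<omega>)) / N\<close>. To compare
  it for two measures, run both products on one probability space: draw independent pairs of matrices
  from a nearly optimal coupling of the two measures and follow a vector under either product. The
  logarithmic growth of a vector over a block of \<open>n\<close> matrices is a Hoelder function of its direction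
  and of the matrices. So the difference of the exponents is controlled by the mean of a power \<open>a\<close> of
  the angle between the two moving directions, and it suffices that this mean stays of the order of
  a power of the transport cost (\<open>chain_estimate\<close>, \<open>lyapunov_close\<close>).

  It does so because directions contract. A matrix \<open>g\<close> multiplies the sine of the angle between \<open>v\<close>
  and \<open>w\<close> by at most \<open>area_factor g * norm v * norm w / (norm (g *v v) * norm (g *v w))\<close>, where
  \<open>area_factor g\<close> is the product of the two largest singular values. If the \<open>a\<close>-th power of
  \<open>area_factor g / (norm (g *v v))\<^sup>2\<close>, for \<open>g\<close> a product of \<open>n\<close> matrices, has mean less than one uniformly in
  the unit vector \<open>v\<close>, then the mean \<open>a\<close>-th power of the angle satisfies a contracting recursion with
  an error term of the order of a power of the cost. The condition persists in a neighbourhood of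
  \<open>\<mu>\<close> (\<open>contraction_nearby\<close>), by estimates that are uniform over the moment class.

  For \<open>\<mu>\<close> itself the condition holds for small \<open>a\<close> as soon as the logarithm of that quotient has a
  negative mean (\<open>area_ratio_contracts\<close>). Its mean is about \<open>n * (L\<^sub>1 + L\<^sub>2 - 2 * L\<^sub>1)\<close>, provided that every
  unit vector grows at the rate \<open>L\<^sub>1\<close> in the mean, uniformly (\<open>uniform_growth\<close>). This is where
  quasi-irreducibility enters: for \<open>\<beta> < L\<^sub>1\<close> the vectors that almost surely grow at most like
  \<open>exp (\<beta> * n)\<close> form an invariant subspace, which must be trivial (\<open>no_slow_vector\<close>). By compactness
  the probability of slow growth is then bounded away from one, and by a zero-one argument it
  vanishes (\<open>slow_prob_zero\<close>). So every vector is fast at some time, and a covering argument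
  (\<open>covering_bound\<close>) turns this into growth of the mean.

  The same covering argument proves Kingman's subadditive ergodic theorem for the shift. It gives
  the existence of the first exponent for every measure of the moment class (\<open>furstenberg_kesten\<close>) and
  turns the gap \<open>L\<^sub>1 > L\<^sub>2\<close> into a bound on the mean logarithm of the area factor
  (\<open>expected_log_area_gap\<close>).
\<close>

section \<open>Areas of parallelograms\<close>

text \<open>
  The square root of the Gram determinant: the area of the parallelogram spanned by \<open>u\<close> and \<open>v\<close>, that is,
  the norm of their exterior product.
\<close>

definition wedge_norm :: "'a::real_inner \<Rightarrow> 'a \<Rightarrow> real" where
  "wedge_norm u v = sqrt ((u \<bullet> u) * (v \<bullet> v) - (u \<bullet> v)\<^sup>2)"

lemma wedge_norm_commute: "wedge_norm u v = wedge_norm v u"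
  by (simp add: wedge_norm_def inner_commute mult.commute)

lemma wedge_norm_nonneg: "0 \<le> wedge_norm u v"
  using Cauchy_Schwarz_ineq[of u v] by (simp add: wedge_norm_def)

lemma wedge_norm_scaleR: "wedge_norm u (c *\<^sub>R v) = \<bar>c\<bar> * wedge_norm u v"
proof -
  have "(u \<bullet> u) * (c *\<^sub>R v \<bullet> c *\<^sub>R v) - (u \<bullet> c *\<^sub>R v)\<^sup>2 = c\<^sup>2 * ((u \<bullet> u) * (v \<bullet> v) - (u \<bullet> v)\<^sup>2)"
    by (simp add: power2_eq_square algebra_simps)
  then show ?thesis by (simp add: wedge_norm_def real_sqrt_mult)
qed

lemma wedge_norm_scaleR_left: "wedge_norm (c *\<^sub>R u) v = \<bar>c\<bar> * wedge_norm u v"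
  using wedge_norm_scaleR[of v c u] by (simp add: wedge_norm_commute)

lemma wedge_norm_shear: "wedge_norm u (v + t *\<^sub>R u) = wedge_norm u v"
proof -
  have "(u \<bullet> u) * ((v + t *\<^sub>R u) \<bullet> (v + t *\<^sub>R u)) - (u \<bullet> (v + t *\<^sub>R u))\<^sup>2 =
      (u \<bullet> u) * (v \<bullet> v) - (u \<bullet> v)\<^sup>2"
    by (simp add: power2_eq_square algebra_simps inner_commute)
  then show ?thesis by (simp add: wedge_norm_def)
qed

lemma wedge_norm_orthogonal: "u \<bullet> v = 0 \<Longrightarrow> wedge_norm u v = norm u * norm v"
  by (simp add: wedge_norm_def norm_eq_sqrt_inner real_sqrt_mult)

lemma wedge_norm_le: "wedge_norm u v \<le> norm u * norm v"
proof -
  have "wedge_norm u v \<le> sqrt ((u \<bullet> u) * (v \<bullet> v))"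
    unfolding wedge_norm_def by (rule real_sqrt_le_mono) simp
  then show ?thesis by (simp add: norm_eq_sqrt_inner real_sqrt_mult)
qed

lemma wedge_norm_le_diff: "wedge_norm u v \<le> norm u * norm (v - t *\<^sub>R u)"
  using wedge_norm_shear[of u v "- t"] wedge_norm_le[of u "v - t *\<^sub>R u"] by simp

lemma orthogonal_part:
  fixes u v :: "'a::real_inner"
  obtains t w where "v = t *\<^sub>R u + w" "u \<bullet> w = 0" "wedge_norm u v = norm u * norm w" "norm w \<le> norm v"
    "\<bar>t\<bar> * norm u \<le> norm v"
proof
  define t where "t = (u \<bullet> v) / (u \<bullet> u)"
  define w where "w = v - t *\<^sub>R u"
  show v: "v = t *\<^sub>R u + w" by (simp add: w_def)
  show uw: "u \<bullet> w = 0"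
    by (cases "u = 0") (simp_all add: w_def t_def inner_diff_right)
  show "wedge_norm u v = norm u * norm w"
    using wedge_norm_shear[of u w t] wedge_norm_orthogonal[OF uw] v by (simp add: add.commute)
  have n: "(norm v)\<^sup>2 = (\<bar>t\<bar> * norm u)\<^sup>2 + (norm w)\<^sup>2"
    using uw unfolding v power2_norm_eq_inner power_mult_distrib
    by (simp add: inner_add_left inner_add_right inner_commute power2_eq_square)
  show "norm w \<le> norm v"
    by (rule power2_le_imp_le) (use n in auto)
  show "\<bar>t\<bar> * norm u \<le> norm v"
    by (rule power2_le_imp_le) (use n in auto)
qed

lemma wedge_norm_add: "wedge_norm u (v + v') \<le> wedge_norm u v + wedge_norm u v'"
proof -
  obtain t w where w: "v = t *\<^sub>R u + w" "wedge_norm u v = norm u * norm w" by (rule orthogonal_part)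
  obtain t' w' where w': "v' = t' *\<^sub>R u + w'" "wedge_norm u v' = norm u * norm w'" by (rule orthogonal_part)
  have "wedge_norm u (v + v') \<le> norm u * norm (v + v' - (t + t') *\<^sub>R u)" by (rule wedge_norm_le_diff)
  also have "v + v' - (t + t') *\<^sub>R u = w + w'" unfolding w(1) w'(1) by (simp add: algebra_simps)
  also have "norm u * norm (w + w') \<le> norm u * (norm w + norm w')"
    by (intro mult_left_mono norm_triangle_ineq) simp
  finally show ?thesis using w w' by (simp add: algebra_simps)
qed

text \<open>
  The triangle inequality for \<open>sin_dist\<close> with the denominators cleared. Split \<open>w\<close> along and across \<open>v\<close>:
  the part along \<open>v\<close> contributes a multiple of the area of \<open>u\<close> and \<open>v\<close>, the part across at most \<open>norm u\<close>
  times its length.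
\<close>

lemma wedge_norm_triangle: "norm v * wedge_norm u w \<le> norm w * wedge_norm u v + norm u * wedge_norm v w"
proof -
  obtain t z where z: "w = t *\<^sub>R v + z" "wedge_norm v w = norm v * norm z" "\<bar>t\<bar> * norm v \<le> norm w"
    by (rule orthogonal_part)
  have "wedge_norm u w \<le> \<bar>t\<bar> * wedge_norm u v + norm u * norm z"
    using wedge_norm_add[of u "t *\<^sub>R v" z] wedge_norm_le[of u z] unfolding z(1) wedge_norm_scaleR by linarith
  then have "norm v * wedge_norm u w \<le> norm v * (\<bar>t\<bar> * wedge_norm u v + norm u * norm z)"
    by (rule mult_left_mono) simp
  also have "\<dots> = (\<bar>t\<bar> * norm v) * wedge_norm u v + norm u * wedge_norm v w"
    using z(2) by (simp add: algebra_simps)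
  also have "\<dots> \<le> norm w * wedge_norm u v + norm u * wedge_norm v w"
    using z(3) wedge_norm_nonneg[of u v] by (intro add_right_mono mult_right_mono)
  finally show ?thesis .
qed

text \<open>
  The sine of the angle between the lines spanned by \<open>u\<close> and \<open>v\<close>. It is a metric on the projective
  space that can be evaluated on any nonzero representatives.
\<close>

definition sin_dist :: "'a::real_inner \<Rightarrow> 'a \<Rightarrow> real" where
  "sin_dist u v = wedge_norm u v / (norm u * norm v)"

lemma sin_dist_nonneg: "0 \<le> sin_dist u v"
  by (simp add: sin_dist_def wedge_norm_nonneg)

lemma sin_dist_le_1: "sin_dist u v \<le> 1"
  using wedge_norm_le[of u v] by (cases "norm u * norm v = 0") (auto simp: sin_dist_def field_simps)

lemma sin_dist_scaleR: "c > 0 \<Longrightarrow> d > 0 \<Longrightarrow> sin_dist (c *\<^sub>R u) (d *\<^sub>R v) = sin_dist u v"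
  by (simp add: sin_dist_def wedge_norm_scaleR wedge_norm_scaleR_left)

lemma sin_dist_triangle:
  assumes "v \<noteq> 0" shows "sin_dist u w \<le> sin_dist u v + sin_dist v w"
proof (cases "u = 0 \<or> w = 0")
  case True
  then show ?thesis using sin_dist_nonneg[of u v] sin_dist_nonneg[of v w] by (auto simp: sin_dist_def)
next
  case False
  with assms wedge_norm_triangle[of v u w] show ?thesis
    by (simp add: sin_dist_def field_simps)
qed

lemma sin_dist_le_diff: "v \<noteq> 0 \<Longrightarrow> sin_dist u v \<le> norm (u - v) / norm v"
  using wedge_norm_le_diff[of u v 1]
  by (cases "u = 0") (simp_all add: sin_dist_def field_simps norm_minus_commute)

text \<open>
  With the sign \<open>e\<close> of the inner product one has \<open>(norm (u - e *\<^sub>R v))\<^sup>2 = 2 - 2 * \<bar>u \<bullet> v\<bar>\<close>, which is at most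
  four times \<open>1 - (u \<bullet> v)\<^sup>2\<close>.
\<close>

lemma norm_diff_le_sin_dist:
  fixes u v :: "'a::real_inner"
  assumes "norm u = 1" "norm v = 1"
  obtains e :: real where "\<bar>e\<bar> = 1" "norm (u - e *\<^sub>R v) \<le> 2 * sin_dist u v"
proof
  define e :: real where "e = (if 0 \<le> u \<bullet> v then 1 else - 1)"
  show e: "\<bar>e\<bar> = 1" by (simp add: e_def)
  have uv: "u \<bullet> u = 1" "v \<bullet> v = 1" using assms by (simp_all add: dot_square_norm)
  have le: "\<bar>u \<bullet> v\<bar> \<le> 1" using Cauchy_Schwarz_ineq2[of u v] assms by simp
  have "(norm (u - e *\<^sub>R v))\<^sup>2 = 2 - 2 * \<bar>u \<bullet> v\<bar>"
    using uv unfolding power2_norm_eq_inner e_def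
    by (simp add: inner_diff_left inner_diff_right inner_commute)
  also have "\<dots> \<le> 4 * (1 - (u \<bullet> v)\<^sup>2)"
  proof -
    have "(u \<bullet> v)\<^sup>2 = \<bar>u \<bullet> v\<bar> * \<bar>u \<bullet> v\<bar>" by (simp add: power2_eq_square flip: abs_mult)
    also have "\<dots> \<le> \<bar>u \<bullet> v\<bar> * 1" using le by (intro mult_left_mono) auto
    finally have "(u \<bullet> v)\<^sup>2 \<le> \<bar>u \<bullet> v\<bar>" by simp
    moreover have "2 - 2 * t \<le> 4 * (1 - q)" if "q \<le> t" "t \<le> 1" for q t :: real using that by argo
    ultimately show ?thesis using le by blast
  qed
  also have "\<dots> = (2 * sin_dist u v)\<^sup>2"
    using uv assms wedge_norm_nonneg[of u v] Cauchy_Schwarz_ineq[of u v]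
    by (simp add: sin_dist_def wedge_norm_def)
  finally show "norm (u - e *\<^sub>R v) \<le> 2 * sin_dist u v"
    by (rule power2_le_imp_le) (simp add: sin_dist_nonneg)
qed


section \<open>Operator norm, area factor and singular values\<close>

lemma norm_matrix_vector_le: "norm (g *v v) \<le> opnorm g * norm v"
  unfolding opnorm_def by (rule onorm) (rule matrix_vector_mul_bounded_linear)

lemma opnorm_le: "(\<And>v. norm v = 1 \<Longrightarrow> norm (g *v v) \<le> b) \<Longrightarrow> 0 \<le> b \<Longrightarrow> opnorm g \<le> b"
  unfolding opnorm_def
proof (rule onorm_le)
  fix v assume b: "\<And>v. norm v = 1 \<Longrightarrow> norm (g *v v) \<le> b" "0 \<le> b"
  show "norm (g *v v) \<le> b * norm v"
  proof (cases "v = 0")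
    case False
    then have "norm (g *v ((1 / norm v) *\<^sub>R v)) \<le> b" by (intro b) simp
    then show ?thesis using False by (simp add: matrix_vector_mult_scaleR field_simps)
  qed simp
qed

lemma opnorm_mult: "opnorm ((g :: real^'n^'n) ** h) \<le> opnorm g * opnorm h"
proof (rule opnorm_le)
  fix v :: "real^'n" assume "norm v = 1"
  then show "norm (g ** h *v v) \<le> opnorm g * opnorm h"
    using norm_matrix_vector_le[of g "h *v v"] norm_matrix_vector_le[of h v]
      mult_left_mono[OF norm_matrix_vector_le[of h v] opnorm_nonneg[of g]]
    by (simp add: matrix_vector_mul_assoc[symmetric])
qed (simp add: opnorm_nonneg)

lemma opnorm_add: "opnorm (g + h) \<le> opnorm g + opnorm h"
  using opnorm_diff_le[of g "- h"] opnorm_minus_commute[of 0 h] by simp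

lemma opnorm_zero [simp]: "opnorm (0 :: real^'n^'n) = 0"
  using opnorm_le[of "0 :: real^'n^'n" 0] opnorm_nonneg[of "0 :: real^'n^'n"] by simp

lemma opnorm_le_sum_axis: "opnorm (g :: real^'n^'n) \<le> (\<Sum>i\<in>UNIV. norm (g *v axis i 1))"
proof (rule opnorm_le)
  fix v :: "real^'n" assume v: "norm v = 1"
  have "g *v v = (\<Sum>i\<in>UNIV. v $ i *s column i g)" by (rule matrix_mult_sum)
  also have "norm \<dots> \<le> (\<Sum>i\<in>UNIV. \<bar>v $ i\<bar> * norm (column i g))"
    by (rule sum_norm_le) (simp add: scalar_mult_eq_scaleR)
  also have "\<dots> \<le> (\<Sum>i\<in>UNIV. 1 * norm (column i g))"
    using component_le_norm_cart[of v] v by (intro sum_mono mult_right_mono) auto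
  finally show "norm (g *v v) \<le> (\<Sum>i\<in>UNIV. norm (g *v axis i 1))"
    by (simp add: matrix_vector_mult_basis)
qed (simp add: sum_nonneg)

lemma opnorm_mat_1: "opnorm (mat 1 :: real^'n^'n) = 1"
  unfolding opnorm_def matrix_vector_mul_lid by (rule onorm_id)

text \<open>
  The norm of the action of \<open>g\<close> on exterior products of two vectors. As a supremum it is visibly
  submultiplicative; by \<open>area_factor_eq\<close> it is the product of the two largest singular values.
\<close>

definition area_factor :: "real^'n^'n \<Rightarrow> real" where
  "area_factor g = (SUP (v, w) \<in> {v. norm v = 1} \<times> {w. norm w = 1}. wedge_norm (g *v v) (g *v w))"

lemma wedge_norm_unit_le:
  assumes "norm v = 1" "norm w = 1"
  shows "wedge_norm (g *v v) (g *v w) \<le> opnorm g * opnorm g"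
  using wedge_norm_le[of "g *v v" "g *v w"]
    mult_mono[OF norm_matrix_vector_le[of g v] norm_matrix_vector_le[of g w]] assms opnorm_nonneg[of g] by simp

lemma area_factor_upper:
  assumes "norm v = 1" "norm w = 1"
  shows "wedge_norm (g *v v) (g *v w) \<le> area_factor g"
proof -
  have "bdd_above ((\<lambda>(v, w). wedge_norm (g *v v) (g *v w)) ` ({v. norm v = 1} \<times> {w. norm w = 1}))"
    by (rule bdd_aboveI2[of _ _ "opnorm g * opnorm g"]) (auto intro: wedge_norm_unit_le)
  from cSUP_upper[OF _ this, of "(v, w)"] assms show ?thesis by (simp add: area_factor_def)
qed

lemma area_factor_least:
  fixes g :: "real^'n^'n"
  assumes "\<And>v w. norm v = 1 \<Longrightarrow> norm w = 1 \<Longrightarrow> wedge_norm (g *v v) (g *v w) \<le> b"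
  shows "area_factor g \<le> b"
proof -
  have "axis undefined 1 \<in> {v :: real^'n. norm v = 1}" by simp
  then have ne: "{v :: real^'n. norm v = 1} \<times> {w :: real^'n. norm w = 1} \<noteq> {}" by blast
  show ?thesis unfolding area_factor_def
    by (rule cSUP_least[OF ne]) (use assms in auto)
qed

lemma area_factor_nonneg: "0 \<le> area_factor (g :: real^'n^'n)"
  using area_factor_upper[of "axis undefined 1" "axis undefined 1" g]
    wedge_norm_nonneg[of "g *v axis undefined 1" "g *v axis undefined 1"] by simp

lemma area_factor_le_opnorm: "area_factor g \<le> opnorm g * opnorm g"
  by (rule area_factor_least) (rule wedge_norm_unit_le)

text \<open>
  A shear changes neither area and makes the spanning vectors orthogonal, after which they can be
  normalised separately.
\<close>

lemma wedge_norm_image_le: "wedge_norm (g *v v) (g *v w) \<le> area_factor g * wedge_norm v w"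
proof -
  obtain t z where z: "w = t *\<^sub>R v + z" "wedge_norm v w = norm v * norm z" by (rule orthogonal_part)
  have eq: "wedge_norm (g *v v) (g *v w) = wedge_norm (g *v v) (g *v z)"
    using wedge_norm_shear[of "g *v v" "g *v z" t] unfolding z(1)
    by (simp add: matrix_vector_right_distrib matrix_vector_mult_scaleR add.commute)
  show ?thesis
  proof (cases "v = 0 \<or> z = 0")
    case True
    then have "wedge_norm (g *v v) (g *v z) = 0" by (auto simp: wedge_norm_def)
    then show ?thesis using eq area_factor_nonneg[of g] wedge_norm_nonneg[of v w] by simp
  next
    case False
    have "wedge_norm (g *v ((1 / norm v) *\<^sub>R v)) (g *v ((1 / norm z) *\<^sub>R z)) \<le> area_factor g"
      using False by (intro area_factor_upper) auto
    then show ?thesis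
      using False unfolding eq z(2)
      by (simp add: matrix_vector_mult_scaleR wedge_norm_scaleR wedge_norm_scaleR_left field_simps)
  qed
qed

lemma area_factor_mult: "area_factor ((g :: real^'n^'n) ** h) \<le> area_factor g * area_factor h"
proof (rule area_factor_least)
  fix v w :: "real^'n" assume vw: "norm v = 1" "norm w = 1"
  have "wedge_norm (g ** h *v v) (g ** h *v w) \<le> area_factor g * wedge_norm (h *v v) (h *v w)"
    unfolding matrix_vector_mul_assoc[symmetric] by (rule wedge_norm_image_le)
  also have "\<dots> \<le> area_factor g * area_factor h"
    using vw by (intro mult_left_mono area_factor_upper area_factor_nonneg)
  finally show "wedge_norm (g ** h *v v) (g ** h *v w) \<le> area_factor g * area_factor h" .
qed

lemma area_factor_mat_1: "area_factor (mat 1 :: real^'n^'n) \<le> 1"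
  using area_factor_le_opnorm[of "mat 1"] by (simp add: opnorm_mat_1)

text \<open>
  Replace \<open>g\<close> by \<open>h\<close> in one of the two spanning vectors at a time.
\<close>

lemma area_factor_diff:
  "area_factor (g :: real^'n^'n) \<le> area_factor h + opnorm (g - h) * (opnorm g + opnorm h)"
proof (rule area_factor_least)
  fix v w :: "real^'n" assume vw: "norm v = 1" "norm w = 1"
  have 1: "wedge_norm (g *v v) (g *v w) \<le> wedge_norm (g *v v) (h *v w) + wedge_norm (g *v v) ((g - h) *v w)"
    using wedge_norm_add[of "g *v v" "h *v w" "(g - h) *v w"] by (simp add: matrix_vector_mult_diff_rdistrib)
  have 2: "wedge_norm (g *v v) (h *v w) \<le> wedge_norm (h *v v) (h *v w) + wedge_norm ((g - h) *v v) (h *v w)"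
    using wedge_norm_add[of "h *v w" "h *v v" "(g - h) *v v"]
    by (simp add: matrix_vector_mult_diff_rdistrib wedge_norm_commute[of "h *v w"])
  have 3: "wedge_norm (g *v v) ((g - h) *v w) \<le> opnorm g * opnorm (g - h)"
    using wedge_norm_le[of "g *v v" "(g - h) *v w"] vw opnorm_nonneg[of g]
      mult_mono[OF norm_matrix_vector_le[of g v] norm_matrix_vector_le[of "g - h" w]] by simp
  have 4: "wedge_norm ((g - h) *v v) (h *v w) \<le> opnorm (g - h) * opnorm h"
    using wedge_norm_le[of "(g - h) *v v" "h *v w"] vw opnorm_nonneg[of "g - h"]
      mult_mono[OF norm_matrix_vector_le[of "g - h" v] norm_matrix_vector_le[of h w]] by simp
  from 1 2 3 4 area_factor_upper[OF vw, of h]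
  show "wedge_norm (g *v v) (g *v w) \<le> area_factor h + opnorm (g - h) * (opnorm g + opnorm h)"
    by (simp add: algebra_simps)
qed

lemma continuous_on_area_factor: "continuous_on UNIV (area_factor :: real^'n^'n \<Rightarrow> real)"
proof -
  have op: "(opnorm \<longlongrightarrow> opnorm h) (at h)" for h :: "real^'n^'n"
    using continuous_on_opnorm[where 'n='n] by (simp add: continuous_on_def)
  have "(area_factor \<longlongrightarrow> area_factor h) (at h)" for h :: "real^'n^'n"
  proof -
    have d: "((\<lambda>g. opnorm (g - h)) \<longlongrightarrow> opnorm (h - h)) (at h)"
    proof -
      have "continuous_on UNIV (\<lambda>g. opnorm (g - h))"
        by (rule continuous_on_compose2[OF continuous_on_opnorm]) (auto intro!: continuous_intros)
      from this[unfolded continuous_on_def, rule_format, of h] show ?thesis by simp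
    qed
    have "((\<lambda>g. opnorm (g - h) * (opnorm g + opnorm h)) \<longlongrightarrow> opnorm (h - h) * (opnorm h + opnorm h)) (at h)"
      by (intro tendsto_intros d op)
    then have "((\<lambda>g. opnorm (g - h) * (opnorm g + opnorm h)) \<longlongrightarrow> 0) (at h)"
      by (simp add: opnorm_zero)
    moreover have "norm (area_factor g - area_factor h) \<le> opnorm (g - h) * (opnorm g + opnorm h)" for g
      using area_factor_diff[of g h] area_factor_diff[of h g] opnorm_minus_commute[of g h]
      by (simp add: abs_le_iff algebra_simps)
    ultimately have "((\<lambda>g. area_factor g - area_factor h) \<longlongrightarrow> 0) (at h)"
      by (intro Lim_null_comparison[of "\<lambda>g. area_factor g - area_factor h"]) (auto intro: always_eventually)
    then show ?thesis by (simp add: LIM_zero_iff)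
  qed
  then show ?thesis by (simp add: continuous_on_def)
qed

lemma borel_measurable_area_factor [measurable]: "area_factor \<in> borel_measurable borel"
  by (rule borel_measurable_continuous_onI[OF continuous_on_area_factor])

lemma inner_transpose_mult: "((transpose (g :: real^'n^'n) ** g) *v a) \<bullet> b = (g *v a) \<bullet> (g *v (b :: real^'n))"
  unfolding matrix_vector_mul_assoc[symmetric] transpose_matrix_vector by (rule dot_lmul_matrix)


text \<open>
  A maximiser \<open>u\<close> of \<open>norm (g *v u)\<close> over the unit vectors of a subspace is critical, so \<open>g\<close> maps
  directions of the subspace orthogonal to \<open>u\<close> to directions orthogonal to \<open>g *v u\<close>.
\<close>

lemma maximal_stretch_orthogonal:
  fixes g :: "real^'n^'n"
  assumes E: "subspace E" "u \<in> E" "w \<in> E" and u: "norm u = 1"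
    and max: "\<And>v. v \<in> E \<Longrightarrow> norm (g *v v) \<le> norm (g *v u) * norm v"
    and ortho: "u \<bullet> w = 0"
  shows "(g *v u) \<bullet> (g *v w) = 0"
proof (rule ccontr)
  define c where "c = (g *v u) \<bullet> (g *v w)"
  define b where "b = (norm (g *v u))\<^sup>2 * (norm w)\<^sup>2"
  assume "(g *v u) \<bullet> (g *v w) \<noteq> 0"
  then have c: "c \<noteq> 0" by (simp add: c_def)
  have le: "2 * s * c \<le> s\<^sup>2 * b" for s
  proof -
    have "(norm (g *v (u + s *\<^sub>R w)))\<^sup>2 \<le> (norm (g *v u) * norm (u + s *\<^sub>R w))\<^sup>2"
      using E by (intro power_mono max) (auto intro: subspace_add subspace_scale)
    moreover have "(norm (g *v (u + s *\<^sub>R w)))\<^sup>2 = (norm (g *v u))\<^sup>2 + 2 * s * c + s\<^sup>2 * (norm (g *v w))\<^sup>2"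
      unfolding power2_norm_eq_inner c_def matrix_vector_right_distrib matrix_vector_mult_scaleR
      by (simp add: inner_add_left inner_add_right inner_commute power2_eq_square)
    moreover have "(norm (u + s *\<^sub>R w))\<^sup>2 = 1 + s\<^sup>2 * (norm w)\<^sup>2"
      using ortho u unfolding power2_norm_eq_inner norm_eq_1
      by (simp add: inner_add_left inner_add_right inner_commute power2_eq_square)
    ultimately have "2 * s * c + s\<^sup>2 * (norm (g *v w))\<^sup>2 \<le> s\<^sup>2 * b"
      by (simp add: power_mult_distrib b_def algebra_simps)
    then show ?thesis
      using zero_le_power2[of "s * norm (g *v w)"] unfolding power_mult_distrib by linarith
  qed
  have b0: "0 \<le> b" by (simp add: b_def)
  have "2 * (c / (b + 1)) * c \<le> (c / (b + 1))\<^sup>2 * b" by (rule le)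
  also have "\<dots> \<le> (c / (b + 1))\<^sup>2 * (b + 1)" by (intro mult_left_mono) auto
  also have "\<dots> = (c / (b + 1)) * c" using b0 by (simp add: power2_eq_square)
  finally have "(c / (b + 1)) * c \<le> 0" by simp
  moreover have "0 < (c / (b + 1)) * c" using b0 c by (simp add: zero_less_mult_iff flip: power2_eq_square)
  ultimately show False by simp
qed

lemma maximal_stretch_exists:
  fixes g :: "real^'n^'n"
  assumes E: "subspace E" "E \<noteq> {0}"
  obtains u where "u \<in> E" "norm u = 1" "\<And>v. v \<in> E \<Longrightarrow> norm (g *v v) \<le> norm (g *v u) * norm v"
proof -
  let ?K = "E \<inter> sphere 0 1"
  from E obtain x where x: "x \<in> E" "x \<noteq> 0" using subspace_0 by blast
  have "(1 / norm x) *\<^sub>R x \<in> ?K" using x E by (auto intro: subspace_scale)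
  then have "?K \<noteq> {}" by blast
  moreover have "compact ?K" using closed_subspace[OF E(1)] by (intro closed_Int_compact) auto
  moreover have "continuous_on ?K (\<lambda>v. norm (g *v v))"
    by (intro continuous_intros linear_continuous_on matrix_vector_mul_bounded_linear)
  ultimately obtain u where u: "u \<in> ?K" "\<And>v. v \<in> ?K \<Longrightarrow> norm (g *v v) \<le> norm (g *v u)"
    using continuous_attains_sup[of ?K "\<lambda>v. norm (g *v v)"] by blast
  show thesis
  proof (rule that)
    fix v assume v: "v \<in> E"
    show "norm (g *v v) \<le> norm (g *v u) * norm v"
    proof (cases "v = 0")
      case False
      then have "norm (g *v ((1 / norm v) *\<^sub>R v)) \<le> norm (g *v u)"
        using v E by (intro u) (auto intro: subspace_scale)
      then show ?thesis using False by (simp add: matrix_vector_mult_scaleR field_simps)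
    qed simp
  qed (use u in auto)
qed

lemma area_factor_eq_0_dim1:
  assumes "CARD('n) = 1" shows "area_factor (g :: real^'n^'n) = 0"
proof (rule antisym[OF area_factor_least area_factor_nonneg])
  fix v w :: "real^'n"
  obtain i :: 'n where i: "(UNIV :: 'n set) = {i}" using assms card_1_singletonE by blast
  show "wedge_norm (g *v v) (g *v w) \<le> 0"
    by (simp add: wedge_norm_def inner_vec_def i power2_eq_square algebra_simps)
qed

lemma singular_value_one_dim:
  assumes "CARD('n) = 1" shows "singular_value 2 (g :: real^'n^'n) = 0"
  using assms by (simp add: singular_value_def)

lemma singular_spaceI:
  fixes g :: "real^'n^'n"
  assumes "\<And>b. (g *v u) \<bullet> (g *v b) = t\<^sup>2 * (u \<bullet> b)"
  shows "u \<in> singular_space g t"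
proof -
  have "((transpose g ** g) *v u - t\<^sup>2 *\<^sub>R u) \<bullet> b = 0" for b
    using assms[of b] by (simp add: inner_diff_left inner_transpose_mult)
  then have "(transpose g ** g) *v u - t\<^sup>2 *\<^sub>R u = 0" by (metis inner_eq_zero_iff)
  then show ?thesis by (simp add: singular_space_def)
qed

lemma singular_spaceD:
  fixes g :: "real^'n^'n"
  assumes "u \<in> singular_space g t"
  shows "(g *v u) \<bullet> (g *v b) = t\<^sup>2 * (u \<bullet> b)"
  using assms inner_transpose_mult[of g u b] by (simp add: singular_space_def)

lemma subspace_singular_space: "subspace (singular_space (g :: real^'n^'n) t)"
  by (auto simp: subspace_def singular_space_def matrix_vector_right_distrib matrix_vector_mult_scaleR scaleR_add_right)

lemma norm_singular_space:
  fixes g :: "real^'n^'n"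
  assumes "u \<in> singular_space g t" "0 \<le> t"
  shows "norm (g *v u) = t * norm u"
  using singular_spaceD[OF assms(1), of u] assms(2)
  by (simp add: norm_eq_sqrt_inner real_sqrt_mult)

text \<open>
  Let \<open>u\<close> be a unit vector that \<open>g\<close> stretches most and \<open>w\<close> one that it stretches most among those
  orthogonal to \<open>u\<close>. Both are eigenvectors of \<open>transpose g ** g\<close>. An eigenvector for any eigenvalue
  other than the largest is orthogonal to \<open>u\<close> and hence stretched no more than \<open>w\<close>, so counting
  multiplicities shows that the second singular value is \<open>norm (g *v w)\<close>. The largest area is that of the
  image of the square spanned by \<open>u\<close> and \<open>w\<close>.
\<close>

lemma area_factor_eq:
  fixes g :: "real^'n^'n"
  shows "area_factor g = opnorm g * singular_value 2 g"
proof (cases "CARD('n) = 1")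
  case True then show ?thesis by (simp add: area_factor_eq_0_dim1 singular_value_one_dim)
next
  case False
  then have card2: "2 \<le> CARD('n)" using zero_less_card_finite[where 'a='n] by linarith
  have "(UNIV :: (real^'n) set) \<noteq> {0}" using UNIV_not_singleton by blast
  then obtain u where u: "norm u = 1" "\<And>v. norm (g *v v) \<le> norm (g *v u) * norm v"
    using maximal_stretch_exists[of "UNIV :: (real^'n) set" g] by auto
  define t1 where "t1 = norm (g *v u)"
  let ?E = "{v. u \<bullet> v = 0}"
  have sE: "subspace ?E" by (rule subspace_hyperplane)
  have "dim ?E = CARD('n) - 1" using u(1) by (subst dim_hyperplane) auto
  then have "?E \<noteq> {0}" using card2 by (intro notI) simp
  then obtain w where w: "u \<bullet> w = 0" "norm w = 1" "\<And>v. u \<bullet> v = 0 \<Longrightarrow> norm (g *v v) \<le> norm (g *v w) * norm v"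
    using maximal_stretch_exists[OF sE, of g] by auto
  define t2 where "t2 = norm (g *v w)"
  have t: "0 \<le> t1" "0 \<le> t2" "t2 \<le> t1" using u(2)[of w] w(2) by (auto simp: t1_def t2_def)
  have opn: "opnorm g = t1"
  proof (rule antisym)
    show "opnorm g \<le> t1"
    proof (rule opnorm_le)
      fix v :: "real^'n" assume "norm v = 1"
      then show "norm (g *v v) \<le> t1" using u(2)[of v] by (simp add: t1_def)
    qed (rule t)
    show "t1 \<le> opnorm g" using norm_matrix_vector_le[of g u] u(1) by (simp add: t1_def)
  qed
  have gu: "(g *v u) \<bullet> (g *v v) = 0" if "u \<bullet> v = 0" for v
    by (rule maximal_stretch_orthogonal[of UNIV]) (use u that in auto)
  have gw: "(g *v w) \<bullet> (g *v v) = 0" if "u \<bullet> v = 0" "w \<bullet> v = 0" for v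
    by (rule maximal_stretch_orthogonal[OF sE]) (use w that in auto)
  have dec_u: "\<exists>a v'. v = a *\<^sub>R u + v' \<and> u \<bullet> v' = 0 \<and> a = u \<bullet> v" for v
    using u(1) by (intro exI[of _ "u \<bullet> v"] exI[of _ "v - (u \<bullet> v) *\<^sub>R u"]) (auto simp: inner_diff_right dot_square_norm)
  have dec_w: "\<exists>a v'. v = a *\<^sub>R w + v' \<and> w \<bullet> v' = 0 \<and> u \<bullet> v' = u \<bullet> v \<and> a = w \<bullet> v" for v
    using w(1,2) by (intro exI[of _ "w \<bullet> v"] exI[of _ "v - (w \<bullet> v) *\<^sub>R w"]) (auto simp: inner_diff_right dot_square_norm)
  have uS: "u \<in> singular_space g t1"
  proof (rule singular_spaceI)
    fix b
    obtain a v' where b: "b = a *\<^sub>R u + v'" "u \<bullet> v' = 0" and a: "u \<bullet> b = a" using dec_u by metis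
    show "(g *v u) \<bullet> (g *v b) = t1\<^sup>2 * (u \<bullet> b)"
      using gu[OF b(2)] b(2) u(1) unfolding a b(1) by (simp add: matrix_vector_right_distrib matrix_vector_mult_scaleR inner_add_right
          t1_def power2_norm_eq_inner norm_eq_1)
  qed
  have wS: "w \<in> singular_space g t2"
  proof (rule singular_spaceI)
    fix b
    obtain a v' where b: "b = a *\<^sub>R u + v'" "u \<bullet> v' = 0" using dec_u by blast
    obtain a' z where v': "v' = a' *\<^sub>R w + z" "w \<bullet> z = 0" "u \<bullet> z = 0" using dec_w[of v'] b(2) by auto
    have "(g *v w) \<bullet> (g *v u) = 0" using gu[OF w(1)] by (simp add: inner_commute)
    then have "(g *v w) \<bullet> (g *v b) = a' * t2\<^sup>2"
      using gw[OF v'(3,2)] unfolding b(1) v'(1)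
      by (simp add: matrix_vector_right_distrib matrix_vector_mult_scaleR inner_add_right t2_def power2_norm_eq_inner)
    moreover have "w \<bullet> b = a'"
      using v'(2) w(1,2) unfolding b(1) v'(1)
      by (simp add: inner_add_right inner_commute[of w u] dot_square_norm)
    ultimately show "(g *v w) \<bullet> (g *v b) = t2\<^sup>2 * (w \<bullet> b)" by simp
  qed
  have nz: "u \<noteq> 0" "w \<noteq> 0" using u w by auto
  have t_sv: "t1 \<in> singular_values g" "t2 \<in> singular_values g"
    using uS wS nz t by (auto simp: singular_values_def)
  have dim_pos: "1 \<le> dim (singular_space g s)" if s: "s \<in> singular_values g" for s
  proof -
    obtain v where v: "v \<in> singular_space g s" "v \<noteq> 0" using s by (auto simp: singular_values_def)
    have "dim {v} \<le> dim (singular_space g s)" using v by (intro dim_subset) auto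
    then show ?thesis using v by simp
  qed
  let ?cnt = "\<lambda>t. \<Sum>s\<in>{s \<in> singular_values g. t \<le> s}. dim (singular_space g s)"
  have fin: "finite {s \<in> singular_values g. t \<le> s}" for t using finite_singular_values[of g] by simp
  have cnt2: "2 \<le> ?cnt t2"
  proof (cases "t1 = t2")
    case False
    have "(\<Sum>s\<in>{t1, t2}. dim (singular_space g s)) \<le> ?cnt t2"
      using t t_sv fin by (intro sum_mono2) auto
    then show ?thesis using False dim_pos[OF t_sv(1)] dim_pos[OF t_sv(2)] by simp
  next
    case True
    have "independent {u, w}"
    proof (rule pairwise_orthogonal_independent)
      show "pairwise orthogonal {u, w}" using w(1) by (auto simp: pairwise_def orthogonal_def inner_commute)
    qed (use nz in auto)
    moreover have "u \<noteq> w" using w(1) nz by auto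
    moreover have "{u, w} \<subseteq> singular_space g t2" using uS wS True by auto
    ultimately have "2 \<le> dim (singular_space g t2)"
      using independent_card_le_dim[of "{u, w}" "singular_space g t2"] by simp
    also have "\<dots> = (\<Sum>s\<in>{t2}. dim (singular_space g s))" by simp
    also have "\<dots> \<le> ?cnt t2" using t_sv fin by (intro sum_mono2) auto
    finally show ?thesis .
  qed
  have upper: "s \<le> t2" if s: "s \<in> singular_values g" "2 \<le> ?cnt s" for s
  proof (rule ccontr)
    assume "\<not> s \<le> t2"
    then have s2: "t2 < s" by simp
    have only: "r = t1" if r: "r \<in> singular_values g" "t2 < r" for r
    proof (rule ccontr)
      assume ne: "r \<noteq> t1"
      obtain v where v: "v \<in> singular_space g r" "v \<noteq> 0" and r0: "0 \<le> r"
        using r by (auto simp: singular_values_def)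
      have "r\<^sup>2 * (v \<bullet> u) = t1\<^sup>2 * (v \<bullet> u)"
        using singular_spaceD[OF v(1), of u] singular_spaceD[OF uS, of v] by (auto simp: inner_commute)
      moreover have "r\<^sup>2 \<noteq> t1\<^sup>2" using ne r0 t by (simp add: power2_eq_iff_nonneg)
      ultimately have "u \<bullet> v = 0" by (simp add: inner_commute)
      then have "norm (g *v v) \<le> t2 * norm v" using w(3) by (simp add: t2_def)
      then show False using norm_singular_space[OF v(1) r0] v(2) r(2) by simp
    qed
    have "s = t1" by (rule only[OF s(1) s2])
    have "?cnt s \<le> (\<Sum>s\<in>{t1}. dim (singular_space g s))"
      using only s2 by (intro sum_mono2) auto
    also have "\<dots> = dim (singular_space g t1)" by simp
    also have "\<dots> \<le> dim {u}"
    proof -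
      have "singular_space g t1 \<subseteq> span {u}"
      proof
        fix v assume v: "v \<in> singular_space g t1"
        obtain a v' where v': "v = a *\<^sub>R u + v'" "u \<bullet> v' = 0" using dec_u by blast
        have "v' = v - a *\<^sub>R u" using v' by simp
        then have "v' \<in> singular_space g t1"
          using v uS subspace_singular_space[of g t1] by (auto intro: subspace_diff subspace_scale)
        then have "t1 * norm v' \<le> t2 * norm v'"
          using norm_singular_space[of v' g t1] t w(3)[OF v'(2)] by (simp add: t2_def)
        then have "v' = 0" using s2 \<open>s = t1\<close> by (auto simp: mult_le_cancel_right)
        then show "v \<in> span {u}" using v' by (simp add: span_base span_scale)
      qed
      then have "dim (singular_space g t1) \<le> dim (span {u})" by (rule dim_subset)
      then show ?thesis by simp
    qed
    also have "\<dots> \<le> 1" using nz by simp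
    finally show False using s(2) by simp
  qed
  have "singular_value 2 g = Max {t \<in> singular_values g. 2 \<le> ?cnt t}"
    using card2 by (simp add: singular_value_def)
  also have "\<dots> = t2"
    using cnt2 t_sv upper finite_singular_values[of g] by (intro Max_eqI) auto
  finally have sv: "singular_value 2 g = t2" .
  have "t1 * t2 = wedge_norm (g *v u) (g *v w)"
    using wedge_norm_orthogonal[OF gu[OF w(1)]] by (simp add: t1_def t2_def)
  then have ge: "t1 * t2 \<le> area_factor g" using area_factor_upper[OF u(1) w(2), of g] by simp
  have "area_factor g \<le> t1 * t2"
  proof (rule area_factor_least)
    fix x y :: "real^'n" assume xy: "norm x = 1" "norm y = 1"
    \<comment> \<open>The plane of \<open>x\<close> and \<open>y\<close> contains a vector orthogonal to \<open>u\<close>, and replacing one of the two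
      spanning vectors by it only shears the parallelogram.\<close>
    have key: "wedge_norm (g *v a) (g *v b) \<le> t1 * t2 * wedge_norm a b" if "u \<bullet> b = 0" for a b
    proof -
      obtain s z where z: "a = s *\<^sub>R b + z" "wedge_norm b a = norm b * norm z" by (rule orthogonal_part)
      have "wedge_norm (g *v b) (g *v a) = wedge_norm (g *v b) (g *v z)"
        using wedge_norm_shear[of "g *v b" "g *v z" s] unfolding z(1)
        by (simp add: matrix_vector_right_distrib matrix_vector_mult_scaleR add.commute)
      also have "\<dots> \<le> norm (g *v b) * norm (g *v z)" by (rule wedge_norm_le)
      also have "\<dots> \<le> (t2 * norm b) * (t1 * norm z)"
        using t w(3)[OF that] u(2)[of z] by (intro mult_mono) (auto simp: t1_def t2_def)
      also have "\<dots> = t1 * t2 * wedge_norm b a" using z(2) by (simp add: mult_ac)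
      finally show ?thesis by (simp add: wedge_norm_commute)
    qed
    have "wedge_norm (g *v x) (g *v y) \<le> t1 * t2 * wedge_norm x y"
    proof (cases "u \<bullet> x = 0")
      case True then show ?thesis using key[of x y] by (simp add: wedge_norm_commute)
    next
      case False
      define s where "s = - (u \<bullet> y) / (u \<bullet> x)"
      have "u \<bullet> (y + s *\<^sub>R x) = 0" using False by (simp add: s_def inner_add_right inner_diff_right)
      then have "wedge_norm (g *v x) (g *v (y + s *\<^sub>R x)) \<le> t1 * t2 * wedge_norm x (y + s *\<^sub>R x)" by (rule key)
      then show ?thesis
        by (simp add: matrix_vector_right_distrib matrix_vector_mult_scaleR wedge_norm_shear)
    qed
    also have "\<dots> \<le> t1 * t2 * 1"
      using wedge_norm_le[of x y] xy t by (intro mult_left_mono) auto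
    finally show "wedge_norm (g *v x) (g *v y) \<le> t1 * t2" by simp
  qed
  then show ?thesis using ge opn sv by simp
qed


section \<open>Subadditive processes over an ergodic transformation\<close>

text \<open>
  The covering argument of Katznelson and Weiss. Move through the times \<open>0, \<dots>, n\<close>: at a good time, one
  from which a stretch of length at most \<open>N\<close> contributes nothing positive, jump over that stretch;
  otherwise make a single step and pay \<open>b\<close>.
\<close>

lemma covering_bound:
  fixes a :: "nat \<Rightarrow> nat \<Rightarrow> real"
  assumes sub: "\<And>k l l'. a k (l + l') \<le> a k l + a (k + l) l'" and zero: "\<And>k. a k 0 \<le> 0"
    and step: "\<And>k. a k 1 \<le> b k" and nonneg: "\<And>k. 0 \<le> b k"
  shows "a 0 n \<le> (\<Sum>i<n. if \<exists>l\<in>{1..N}. a i l \<le> 0 then 0 else b i) + (\<Sum>i\<in>{n - N..<n}. b i)"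
proof -
  \<comment> \<open>Times within \<open>N\<close> of the end count as bad, since a jump could overshoot.\<close>
  define w where "w i = (if i + N \<le> n \<and> (\<exists>l\<in>{1..N}. a i l \<le> 0) then 0 else b i)" for i
  have w0: "0 \<le> w i" for i by (simp add: w_def nonneg)
  have "k \<le> n \<Longrightarrow> a k (n - k) \<le> sum w {k..<n}" for k
  proof (induction "n - k" arbitrary: k rule: less_induct)
    case less
    show ?case
    proof (cases "k = n")
      case True then show ?thesis using zero by simp
    next
      case kn: False
      obtain l where l: "1 \<le> l" "k + l \<le> n" "a k l \<le> w k"
      proof (cases "k + N \<le> n \<and> (\<exists>l\<in>{1..N}. a k l \<le> 0)")
        case True
        then obtain l where "l \<in> {1..N}" "a k l \<le> 0" by blast
        with True show thesis by (intro that[of l]) (auto simp: w_def)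
      next
        case False
        then show thesis using kn less.prems step[of k] by (intro that[of 1]) (auto simp: w_def)
      qed
      have "a k (n - k) = a k (l + (n - (k + l)))" using l by simp
      also have "\<dots> \<le> a k l + a (k + l) (n - (k + l))" by (rule sub)
      also have "\<dots> \<le> w k + sum w {k + l..<n}"
        using l less.prems kn by (intro add_mono less.hyps) auto
      also have "\<dots> = sum w (insert k {k + l..<n})" using l by simp
      also have "\<dots> \<le> sum w {k..<n}" using l kn less.prems w0 by (intro sum_mono2) auto
      finally show ?thesis .
    qed
  qed
  from this[of 0] have "a 0 n \<le> sum w {..<n}" by (simp add: lessThan_atLeast0)
  also have "\<dots> \<le> (\<Sum>i<n. (if \<exists>l\<in>{1..N}. a i l \<le> 0 then 0 else b i) + (if n < i + N then b i else 0))"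
    by (intro sum_mono) (auto simp: w_def nonneg)
  also have "\<dots> = (\<Sum>i<n. if \<exists>l\<in>{1..N}. a i l \<le> 0 then 0 else b i) + (\<Sum>i<n. if n < i + N then b i else 0)"
    by (rule sum.distrib)
  also have "(\<Sum>i<n. if n < i + N then b i else 0) = (\<Sum>i\<in>{i\<in>{..<n}. n < i + N}. b i)"
    by (subst sum.inter_filter) auto
  also have "\<dots> \<le> (\<Sum>i\<in>{n - N..<n}. b i)" using nonneg by (intro sum_mono2) auto
  finally show ?thesis by simp
qed

lemma eventually_le_linear:
  fixes a b d :: real assumes "a < b" shows "\<forall>\<^sub>F n in sequentially. d + a * real n \<le> b * real n"
proof -
  obtain N where N: "d / (b - a) \<le> real N" using real_arch_simple by blast
  have "d + a * real n \<le> b * real n" if "N \<le> n" for n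
  proof -
    have "d \<le> (b - a) * real N" using N assms by (simp add: field_simps)
    also have "\<dots> \<le> (b - a) * real n" using assms that by (intro mult_left_mono) auto
    finally show ?thesis by (simp add: algebra_simps)
  qed
  then show ?thesis unfolding eventually_sequentially by blast
qed

text \<open>
  It suffices to ask for one inclusion in the invariance of \<open>A\<close>: since \<open>T\<close> preserves the measure, \<open>A\<close> then
  agrees with its preimage up to a null set.
\<close>

locale ergodic_map = prob_space M for M :: "'a measure" +
  fixes T :: "'a \<Rightarrow> 'a"
  assumes T_measurable [measurable]: "T \<in> measurable M M" and distr_T: "distr M M T = M"
    and zero_one: "A \<in> sets M \<Longrightarrow> AE x in M. x \<in> A \<longrightarrow> T x \<in> A \<Longrightarrow> prob A = 0 \<or> prob A = 1"
begin

lemma T_pow_measurable [measurable]: "T ^^ k \<in> measurable M M"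
  by (induction k) (auto simp: id_def)

lemma distr_T_pow: "distr M M (T ^^ k) = M"
proof (induction k)
  case (Suc k)
  have "distr M M (T ^^ Suc k) = distr (distr M M (T ^^ k)) M T"
    by (subst distr_distr) (auto simp: comp_def)
  then show ?case using Suc distr_T by (simp only:)
qed (simp add: id_def distr_id2)

lemma AE_T_pow: "AE x in M. P x \<Longrightarrow> AE x in M. P ((T ^^ k) x)"
  by (rule AE_distrD[of "T ^^ k" M M P, OF T_pow_measurable]) (simp only: distr_T_pow)

lemma AE_T_pow_all: "AE x in M. P x \<Longrightarrow> AE x in M. \<forall>k. P ((T ^^ k) x)"
  using AE_T_pow[of P] by (simp add: AE_all_countable)

lemma integral_T_pow:
  fixes f :: "'a \<Rightarrow> real"
  assumes [measurable]: "f \<in> borel_measurable M" shows "(\<integral>x. f ((T ^^ k) x) \<partial>M) = (\<integral>x. f x \<partial>M)"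
  using integral_distr[of "T ^^ k" M M f] by (simp add: distr_T_pow)

lemma integrable_T_pow:
  fixes f :: "'a \<Rightarrow> real"
  assumes "integrable M f" shows "integrable M (\<lambda>x. f ((T ^^ k) x))"
proof -
  have [measurable]: "f \<in> borel_measurable M" using assms by auto
  show ?thesis using integrable_distr_eq[of "T ^^ k" M M f] assms by (simp add: distr_T_pow)
qed

definition subadditive_process :: "(nat \<Rightarrow> 'a \<Rightarrow> real) \<Rightarrow> bool" where
  "subadditive_process X \<longleftrightarrow> (\<forall>n. integrable M (X n)) \<and> (\<forall>x. X 0 x = 0) \<and>
     (AE x in M. \<forall>m n. X (m + n) x \<le> X m x + X n ((T ^^ m) x))"

text \<open>
  If almost every orbit sees \<open>X n x \<le> c * n\<close> at some time, then a long orbit is covered by such stretches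
  except for times from which one has to wait longer than \<open>N\<close>. The mean cost of these bad times tends to
  zero as \<open>N\<close> grows.
\<close>

lemma expectation_le_of_stopping:
  assumes X: "subadditive_process X" and stop: "AE x in M. \<exists>n\<ge>1. X n x \<le> c * real n" and "0 < e"
  shows "\<exists>n\<ge>1. (\<integral>x. X n x \<partial>M) \<le> (c + e) * real n"
proof -
  have int: "integrable M (X n)" for n using X by (simp add: subadditive_process_def)
  then have [measurable]: "X n \<in> borel_measurable M" for n by auto
  define b where "b x = \<bar>X 1 x\<bar> + \<bar>c\<bar>" for x
  have b: "integrable M b" unfolding b_def by (intro Bochner_Integration.integrable_add integrable_abs int) auto
  have b0: "0 \<le> b x" for x by (simp add: b_def)
  have [measurable]: "b \<in> borel_measurable M" using b by auto
  define u where "u N x = (if \<exists>l\<in>{1..N}. X l x \<le> c * real l then 0 else b x)" for N x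
  have [measurable]: "u N \<in> borel_measurable M" for N unfolding u_def by measurable
  have u: "integrable M (u N)" for N
    by (rule Bochner_Integration.integrable_bound[OF b]) (auto simp: u_def b0)
  have "(\<lambda>N. \<integral>x. u N x \<partial>M) \<longlonglongrightarrow> (\<integral>x. 0 \<partial>M)"
  proof (rule integral_dominated_convergence[where w=b])
    show "AE x in M. (\<lambda>N. u N x) \<longlonglongrightarrow> 0"
      using stop
    proof eventually_elim
      case (elim x)
      then obtain n where "1 \<le> n" "X n x \<le> c * real n" by blast
      then have "u N x = 0" if "n \<le> N" for N using that by (auto simp: u_def)
      then show ?case
        by (intro tendsto_eventually) (auto simp: eventually_sequentially)
    qed
  qed (auto simp: b u_def b0)
  then have "\<forall>\<^sub>F N in sequentially. (\<integral>x. u N x \<partial>M) < e / 2"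
    using \<open>0 < e\<close> by (intro order_tendstoD(2)) auto
  then obtain N where N: "(\<integral>x. u N x \<partial>M) < e / 2" by (auto simp: eventually_sequentially)
  have key: "(\<integral>x. X n x \<partial>M) \<le> c * real n + (real n * (\<integral>x. u N x \<partial>M) + real N * (\<integral>x. b x \<partial>M))" for n
  proof -
    have "AE x in M. X n x \<le> c * real n + ((\<Sum>i<n. u N ((T ^^ i) x)) + (\<Sum>i\<in>{n - N..<n}. b ((T ^^ i) x)))"
    proof -
      have "AE x in M. \<forall>m n. X (m + n) x \<le> X m x + X n ((T ^^ m) x)"
        using X by (simp add: subadditive_process_def)
      then have "AE x in M. \<forall>k m n. X (m + n) ((T ^^ k) x) \<le> X m ((T ^^ k) x) + X n ((T ^^ m) ((T ^^ k) x))"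
        by (rule AE_T_pow_all)
      then show ?thesis
      proof eventually_elim
        case (elim x)
        have T_add: "(T ^^ m) ((T ^^ k) x) = (T ^^ (k + m)) x" for k m
          by (metis add.commute comp_apply funpow_add)
        let ?a = "\<lambda>k l. X l ((T ^^ k) x) - c * real l"
        have "?a 0 n \<le> (\<Sum>i<n. if \<exists>l\<in>{1..N}. ?a i l \<le> 0 then 0 else b ((T ^^ i) x)) + (\<Sum>i\<in>{n - N..<n}. b ((T ^^ i) x))"
        proof (rule covering_bound)
          fix k l l'
          show "?a k (l + l') \<le> ?a k l + ?a (k + l) l'"
            using elim[rule_format, of l l' k] by (simp add: T_add algebra_simps)
        qed (use X in \<open>auto simp: subadditive_process_def b_def\<close>)
        then show ?case by (simp add: u_def)
      qed
    qed
    moreover have i1: "integrable M (\<lambda>x. \<Sum>i<n. u N ((T ^^ i) x))" "integrable M (\<lambda>x. \<Sum>i\<in>{n - N..<n}. b ((T ^^ i) x))"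
      using integrable_T_pow[OF u] integrable_T_pow[OF b] by simp_all
    ultimately have "(\<integral>x. X n x \<partial>M) \<le> (\<integral>x. c * real n + ((\<Sum>i<n. u N ((T ^^ i) x)) + (\<Sum>i\<in>{n - N..<n}. b ((T ^^ i) x))) \<partial>M)"
      by (intro integral_mono_AE int Bochner_Integration.integrable_add) auto
    also have "\<dots> = c * real n + ((\<Sum>i<n. \<integral>x. u N ((T ^^ i) x) \<partial>M) + (\<Sum>i\<in>{n - N..<n}. \<integral>x. b ((T ^^ i) x) \<partial>M))"
      using i1 by (simp add: Bochner_Integration.integral_sum integrable_T_pow[OF u] integrable_T_pow[OF b] prob_space)
    also have "\<dots> = c * real n + (real n * (\<integral>x. u N x \<partial>M) + real (card {n - N..<n}) * (\<integral>x. b x \<partial>M))"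
      by (simp add: integral_T_pow)
    also have "\<dots> \<le> c * real n + (real n * (\<integral>x. u N x \<partial>M) + real N * (\<integral>x. b x \<partial>M))"
      by (intro add_left_mono mult_right_mono integral_nonneg) (auto simp: b0)
    finally show ?thesis .
  qed
  have "\<forall>\<^sub>F n in sequentially. real N * (\<integral>x. b x \<partial>M) + (c + e / 2) * real n \<le> (c + e) * real n"
    using \<open>0 < e\<close> by (intro eventually_le_linear) simp
  then have "\<forall>\<^sub>F n in sequentially. 1 \<le> n \<and> real N * (\<integral>x. b x \<partial>M) + (c + e / 2) * real n \<le> (c + e) * real n"
    by (intro eventually_conj eventually_ge_at_top)
  then obtain n where n: "1 \<le> n" "real N * (\<integral>x. b x \<partial>M) + (c + e / 2) * real n \<le> (c + e) * real n"
    by (auto simp: eventually_sequentially)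
  have "real n * (\<integral>x. u N x \<partial>M) \<le> real n * (e / 2)" using N by (intro mult_left_mono) auto
  moreover have "(c + e / 2) * real n = c * real n + real n * (e / 2)" by (simp add: algebra_simps)
  ultimately have "(\<integral>x. X n x \<partial>M) \<le> (c + e) * real n" using key[of n] n(2) by linarith
  with n(1) show ?thesis by blast
qed

text \<open>
  The set where the lower limit of \<open>X n x / n\<close> is at least a level \<open>c1\<close> between \<open>c\<close> and \<open>\<gamma>\<close> is invariant, hence
  null or full. If it were null, almost every orbit would fall below \<open>c1 * n\<close> at some time and the
  means could not stay above \<open>\<gamma> * n\<close>.
\<close>

lemma subadditive_lower:
  assumes X: "subadditive_process X" and lower: "\<And>n. 1 \<le> n \<Longrightarrow> \<gamma> * real n \<le> (\<integral>x. X n x \<partial>M)" and "c < \<gamma>"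
  shows "AE x in M. \<forall>\<^sub>F n in sequentially. c * real n \<le> X n x"
proof -
  have int: "integrable M (X n)" for n using X by (simp add: subadditive_process_def)
  then have [measurable]: "X n \<in> borel_measurable M" for n by auto
  define c1 where "c1 = (c + \<gamma>) / 2"
  have c1: "c < c1" "c1 < \<gamma>" using \<open>c < \<gamma>\<close> by (auto simp: c1_def)
  define A where "A = {x \<in> space M. \<forall>j. \<forall>\<^sub>F n in sequentially. (c1 - 1 / real (Suc j)) * real n \<le> X n x}"
  have A [measurable]: "A \<in> sets M" unfolding A_def eventually_sequentially by measurable
  have "AE x in M. \<forall>m n. X (m + n) x \<le> X m x + X n ((T ^^ m) x)"
    using X by (simp add: subadditive_process_def)
  then have "AE x in M. x \<in> A \<longrightarrow> T x \<in> A"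
    using AE_space
  proof eventually_elim
    case (elim x)
    show ?case
    proof
      assume x: "x \<in> A"
      have "\<forall>\<^sub>F n in sequentially. (c1 - 1 / real (Suc j)) * real n \<le> X n (T x)" for j
      proof -
        define d d' where d: "d = c1 - 1 / real (Suc (Suc j))" and d': "d' = c1 - 1 / real (Suc j)"
        have "\<forall>\<^sub>F n in sequentially. d * real n \<le> X n x" using x unfolding A_def d by blast
        then have "\<forall>\<^sub>F n in sequentially. d * real (Suc n) \<le> X (Suc n) x"
          by (subst eventually_sequentially_Suc)
        moreover have "\<forall>\<^sub>F n in sequentially. (X 1 x - d) + d' * real n \<le> d * real n"
          by (rule eventually_le_linear) (simp add: d d' field_simps)
        ultimately show ?thesis unfolding d'[symmetric]
        proof eventually_elim
          case (elim n)
          have "X (Suc n) x \<le> X 1 x + X n (T x)"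
            using \<open>\<forall>m n. X (m + n) x \<le> X m x + X n ((T ^^ m) x)\<close>[rule_format, of 1 n] by simp
          moreover have "d * real (Suc n) = d * real n + d" by (simp add: algebra_simps)
          ultimately show ?case using elim by linarith
        qed
      qed
      then show "T x \<in> A" using elim(2) measurable_space[OF T_measurable] by (auto simp: A_def)
    qed
  qed
  then have "prob A = 0 \<or> prob A = 1" by (rule zero_one[OF A])
  moreover have "prob A \<noteq> 0"
  proof
    assume "prob A = 0"
    then have "AE x in M. x \<notin> A" using A by (simp add: prob_eq_0)
    then have "AE x in M. \<exists>n\<ge>1. X n x \<le> c1 * real n"
      using AE_space
    proof eventually_elim
      case (elim x)
      then obtain j where "\<not> (\<forall>\<^sub>F n in sequentially. (c1 - 1 / real (Suc j)) * real n \<le> X n x)"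
        by (auto simp: A_def)
      then obtain n where n: "1 \<le> n" "X n x < (c1 - 1 / real (Suc j)) * real n"
        unfolding eventually_sequentially by (meson linorder_not_le)
      have "(c1 - 1 / real (Suc j)) * real n \<le> c1 * real n" by (intro mult_right_mono) auto
      then show ?case using n by (intro exI[of _ n] conjI) linarith+
    qed
    then obtain n where n: "1 \<le> n" "(\<integral>x. X n x \<partial>M) \<le> (c1 + (\<gamma> - c1) / 2) * real n"
      using expectation_le_of_stopping[OF X, of c1 "(\<gamma> - c1) / 2"] c1 by auto
    have "c1 + (\<gamma> - c1) / 2 < \<gamma>" using c1 by (simp add: field_simps)
    then have "(c1 + (\<gamma> - c1) / 2) * real n < \<gamma> * real n" using n(1) by (intro mult_strict_right_mono) auto
    then show False using lower[OF n(1)] n(2) by simp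
  qed
  ultimately have "AE x in M. x \<in> A" using A by (simp add: prob_eq_1)
  then show ?thesis
  proof eventually_elim
    case (elim x)
    obtain j where j: "1 / real (Suc j) < c1 - c" using c1 reals_Archimedean[of "c1 - c"] by (auto simp: field_simps)
    have "\<forall>\<^sub>F n in sequentially. (c1 - 1 / real (Suc j)) * real n \<le> X n x" using elim by (simp add: A_def)
    then show ?case
    proof eventually_elim
      case (elim n)
      have "c * real n \<le> (c1 - 1 / real (Suc j)) * real n" using j by (intro mult_right_mono) auto
      then show ?case using elim by simp
    qed
  qed
qed

lemma expectation_multiple_le:
  assumes X: "subadditive_process X"
  shows "(\<integral>x. X (j * m) x \<partial>M) \<le> real j * (\<integral>x. X m x \<partial>M)"
proof (induction j)
  case 0 then show ?case using X by (simp add: subadditive_process_def)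
next
  case (Suc j)
  have int: "integrable M (X n)" for n using X by (simp add: subadditive_process_def)
  have meas: "X m \<in> borel_measurable M" using int by auto
  have "(\<integral>x. X (Suc j * m) x \<partial>M) \<le> (\<integral>x. X (j * m) x + X m ((T ^^ (j * m)) x) \<partial>M)"
  proof (rule integral_mono_AE)
    have "AE x in M. \<forall>m n. X (m + n) x \<le> X m x + X n ((T ^^ m) x)"
      using X by (simp add: subadditive_process_def)
    then show "AE x in M. X (Suc j * m) x \<le> X (j * m) x + X m ((T ^^ (j * m)) x)"
    proof eventually_elim
      case (elim x)
      from elim[rule_format, of "j * m" m] show ?case by (simp add: add.commute)
    qed
  qed (intro Bochner_Integration.integrable_add int integrable_T_pow[OF int])+
  also have "\<dots> = (\<integral>x. X (j * m) x \<partial>M) + (\<integral>x. X m x \<partial>M)"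
    by (subst Bochner_Integration.integral_add) (auto simp: int integrable_T_pow[OF int] integral_T_pow[OF meas])
  also have "\<dots> \<le> real (Suc j) * (\<integral>x. X m x \<partial>M)" using Suc by (simp add: algebra_simps)
  finally show ?case .
qed

lemma additive_process:
  fixes f :: "'a \<Rightarrow> real"
  assumes f: "integrable M f"
  shows "subadditive_process (\<lambda>n x. \<Sum>k<n. f ((T ^^ k) x))" "(\<integral>x. (\<Sum>k<n. f ((T ^^ k) x)) \<partial>M) = real n * (\<integral>x. f x \<partial>M)"
proof -
  have *: "(\<Sum>k<m + n. f ((T ^^ k) x)) = (\<Sum>k<m. f ((T ^^ k) x)) + (\<Sum>k<n. f ((T ^^ k) ((T ^^ m) x)))" for m n x
  proof (induction n)
    case (Suc n) then show ?case by (simp add: funpow_add funpow_swap1 add.commute[of m n])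
  qed simp
  show "subadditive_process (\<lambda>n x. \<Sum>k<n. f ((T ^^ k) x))"
    unfolding subadditive_process_def * by (auto intro!: Bochner_Integration.integrable_sum integrable_T_pow f)
  have [measurable]: "f \<in> borel_measurable M" using f by auto
  show "(\<integral>x. (\<Sum>k<n. f ((T ^^ k) x)) \<partial>M) = real n * (\<integral>x. f x \<partial>M)"
    by (subst Bochner_Integration.integral_sum) (auto intro: integrable_T_pow f simp: integral_T_pow)
qed

text \<open>
  Sums along orbits and their negatives are both subadditive, so the lower bound for subadditive
  processes already contains the law of large numbers.
\<close>

lemma birkhoff_lower:
  fixes f :: "'a \<Rightarrow> real"
  assumes f: "integrable M f" and "c < (\<integral>x. f x \<partial>M)"
  shows "AE x in M. \<forall>\<^sub>F n in sequentially. c * real n \<le> (\<Sum>k<n. f ((T ^^ k) x))"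
  using additive_process[OF f] assms(2) by (intro subadditive_lower) (auto simp: mult.commute)

lemma birkhoff_upper:
  fixes f :: "'a \<Rightarrow> real"
  assumes f: "integrable M f" and c: "(\<integral>x. f x \<partial>M) < c"
  shows "AE x in M. \<forall>\<^sub>F n in sequentially. (\<Sum>k<n. f ((T ^^ k) x)) \<le> c * real n"
  using birkhoff_lower[of "\<lambda>x. - f x" "- c"] assms by (simp add: sum_negf)

text \<open>
  The summand is the difference of two consecutive orbit sums, which are both within \<open>d * n / 4\<close> of \<open>n\<close> times
  the mean.
\<close>

lemma sublinear_along_orbit:
  fixes f :: "'a \<Rightarrow> real"
  assumes f: "integrable M f" and d: "0 < d"
  shows "AE x in M. \<forall>\<^sub>F n in sequentially. f ((T ^^ n) x) \<le> d * real n"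
proof -
  let ?e = "\<integral>x. f x \<partial>M"
  have "AE x in M. \<forall>\<^sub>F n in sequentially. (?e - d / 4) * real n \<le> (\<Sum>k<n. f ((T ^^ k) x))"
    using d by (intro birkhoff_lower f) simp
  moreover have "AE x in M. \<forall>\<^sub>F n in sequentially. (\<Sum>k<n. f ((T ^^ k) x)) \<le> (?e + d / 4) * real n"
    using d by (intro birkhoff_upper f) simp
  ultimately show ?thesis
  proof eventually_elim
    case (elim x)
    from elim(2) have "\<forall>\<^sub>F n in sequentially. (\<Sum>k<Suc n. f ((T ^^ k) x)) \<le> (?e + d / 4) * real (Suc n)"
      by (subst eventually_sequentially_Suc)
    moreover have "\<forall>\<^sub>F n in sequentially. (?e + d / 4) + (d / 2) * real n \<le> d * real n"
      using d by (intro eventually_le_linear) simp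
    ultimately show ?case using elim(1)
    proof eventually_elim
      case (elim n)
      have "f ((T ^^ n) x) \<le> (?e + d / 4) * real (Suc n) - (?e - d / 4) * real n" using elim(1,3) by simp
      also have "\<dots> = (?e + d / 4) + (d / 2) * real n" by (simp add: field_simps)
      finally show ?case using elim(2) by simp
    qed
  qed
qed

end

text \<open>
  The upper bound for subadditive processes cuts time into blocks of a fixed length \<open>m\<close> and uses the law
  of large numbers for \<open>T ^^ m\<close>.
\<close>

locale totally_ergodic_map = ergodic_map +
  assumes ergodic_pow: "1 \<le> m \<Longrightarrow> ergodic_map M (T ^^ m)"
begin

text \<open>
  By subadditivity \<open>X n\<close> is at most a sum of values of \<open>X m\<close> along \<open>T ^^ m\<close> plus a remainder of fewer than \<open>m\<close>
  steps. The law of large numbers controls the sum, and the remainder is sublinear.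
\<close>

lemma subadditive_upper:
  assumes X: "subadditive_process X" and m: "1 \<le> m" and c: "(\<integral>x. X m x \<partial>M) < c * real m"
  shows "AE x in M. \<forall>\<^sub>F n in sequentially. X n x \<le> c * real n"
proof -
  interpret Tm: ergodic_map M "T ^^ m" by (rule ergodic_pow[OF m])
  have int: "integrable M (X n)" for n using X by (simp add: subadditive_process_def)
  define c1 where "c1 = (c + (\<integral>x. X m x \<partial>M) / real m) / 2"
  define d where "d = (c - c1) / 2"
  have m0: "0 < real m" using m by simp
  have *: "(\<integral>x. X m x \<partial>M) / real m < c" using c m0 by (simp add: field_simps)
  then have c1: "(\<integral>x. X m x \<partial>M) < c1 * real m" "c1 < c"
    using m0 by (auto simp: c1_def field_simps)
  have d: "0 < d" "c1 + d < c" using c1 by (auto simp: d_def field_simps)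
  define g where "g x = (\<Sum>r<m. \<bar>X r x\<bar>)" for x
  have g: "integrable M g" unfolding g_def by (intro Bochner_Integration.integrable_sum integrable_abs int)
  have TT: "((T ^^ m) ^^ j) x = (T ^^ (m * j)) x" for j x
    by (simp add: funpow_mult)
  have "AE x in M. \<forall>m n. X (m + n) x \<le> X m x + X n ((T ^^ m) x)"
    using X by (simp add: subadditive_process_def)
  moreover have "AE x in M. \<forall>\<^sub>F j in sequentially. (\<Sum>k<j. X m (((T ^^ m) ^^ k) x)) \<le> (c1 * real m) * real j"
    by (rule Tm.birkhoff_upper[OF int c1(1)])
  moreover have "AE x in M. \<forall>\<^sub>F j in sequentially. g (((T ^^ m) ^^ j) x) \<le> (d * real m) * real j"
    using d m0 by (intro Tm.sublinear_along_orbit g) simp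
  ultimately show ?thesis
  proof eventually_elim
    case (elim x)
    have sumX: "X (m * j) x \<le> (\<Sum>k<j. X m (((T ^^ m) ^^ k) x))" for j
    proof (induction j)
      case 0 then show ?case using X by (simp add: subadditive_process_def)
    next
      case (Suc j)
      then show ?case using elim(1)[rule_format, of "m * j" m] by (simp add: TT add.commute)
    qed
    from elim(2,3) have "\<forall>\<^sub>F j in sequentially. \<forall>r<m. X (m * j + r) x \<le> (c1 + d) * real (m * j)"
    proof eventually_elim
      case (elim j)
      show ?case
      proof (intro allI impI)
        fix r assume r: "r < m"
        have "X r ((T ^^ (m * j)) x) \<le> \<bar>X r ((T ^^ (m * j)) x)\<bar>" by simp
        also have "\<dots> \<le> g ((T ^^ (m * j)) x)" unfolding g_def using r by (intro member_le_sum) auto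
        finally have "X r ((T ^^ (m * j)) x) \<le> g ((T ^^ (m * j)) x)" .
        moreover have "X (m * j + r) x \<le> X (m * j) x + X r ((T ^^ (m * j)) x)"
          using \<open>\<forall>m n. X (m + n) x \<le> X m x + X n ((T ^^ m) x)\<close> by blast
        ultimately show "X (m * j + r) x \<le> (c1 + d) * real (m * j)"
          using sumX[of j] elim by (simp add: TT algebra_simps)
      qed
    qed
    then obtain J where J: "\<And>j r. J \<le> j \<Longrightarrow> r < m \<Longrightarrow> X (m * j + r) x \<le> (c1 + d) * real (m * j)"
      unfolding eventually_sequentially by blast
    have "\<forall>\<^sub>F n in sequentially. \<bar>c1 + d\<bar> * real m + (c1 + d) * real n \<le> c * real n"
      using d by (intro eventually_le_linear)
    moreover have "\<forall>\<^sub>F n in sequentially. m * J \<le> n" by (rule eventually_ge_at_top)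
    ultimately show ?case
    proof eventually_elim
      case (elim n)
      define j r where "j = n div m" "r = n mod m"
      have n: "n = m * j + r" "r < m" using m by (auto simp: j_r_def)
      have "J \<le> j" using elim(2) m unfolding j_r_def by (metis div_le_mono div_mult_self1_is_m less_le_trans less_one not_less zero_less_iff_neq_zero)
      then have "X n x \<le> (c1 + d) * real (m * j)" unfolding n(1) using n(2) by (rule J)
      also have "\<dots> = (c1 + d) * real n - (c1 + d) * real r" by (simp add: n(1) algebra_simps)
      also have "\<dots> \<le> (c1 + d) * real n + \<bar>c1 + d\<bar> * real m"
      proof -
        have "- ((c1 + d) * real r) \<le> \<bar>c1 + d\<bar> * real r"
          by (metis abs_ge_minus_self abs_mult abs_of_nat)
        also have "\<dots> \<le> \<bar>c1 + d\<bar> * real m" using n(2) by (intro mult_left_mono) auto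
        finally show ?thesis by simp
      qed
      finally show ?case using elim(1) by simp
    qed
  qed
qed

text \<open>
  The limit is the infimum of \<open>(\<integral>x. X n x \<partial>M) / n\<close>: the first conjunct makes \<open>\<gamma>\<close> a lower bound of these
  quotients, the second the greatest one.
\<close>

theorem kingman:
  assumes X: "subadditive_process X" and bdd: "\<And>n. 1 \<le> n \<Longrightarrow> K * real n \<le> (\<integral>x. X n x \<partial>M)"
  shows "\<exists>\<gamma>. (\<forall>n\<ge>1. \<gamma> * real n \<le> (\<integral>x. X n x \<partial>M)) \<and>
    (\<forall>e>0. \<exists>n\<ge>1. (\<integral>x. X n x \<partial>M) < (\<gamma> + e) * real n) \<and>
    (AE x in M. (\<lambda>n. X n x / real n) \<longlonglongrightarrow> \<gamma>)"
proof -
  let ?E = "\<lambda>n. (\<integral>x. X n x \<partial>M)"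
  define \<gamma> where "\<gamma> = (INF n\<in>{1..}. ?E n / real n)"
  have bb: "bdd_below ((\<lambda>n. ?E n / real n) ` {1..})"
    by (rule bdd_belowI2[of _ K]) (use bdd in \<open>auto simp: field_simps\<close>)
  have 1: "\<gamma> * real n \<le> ?E n" if "1 \<le> n" for n
  proof -
    have "\<gamma> \<le> ?E n / real n" unfolding \<gamma>_def using that by (intro cINF_lower[OF bb]) simp
    then show ?thesis using that by (simp add: field_simps)
  qed
  have 2: "\<exists>n\<ge>1. ?E n < (\<gamma> + e) * real n" if e: "0 < e" for e
  proof -
    have "(INF n\<in>{1..}. ?E n / real n) < \<gamma> + e" using e by (simp add: \<gamma>_def)
    then obtain n where "n \<in> {1..}" "?E n / real n < \<gamma> + e"
      using cINF_less_iff[OF _ bb, of "\<gamma> + e"] by (metis atLeast_iff empty_iff order_refl)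
    then show ?thesis by (intro exI[of _ n]) (auto simp: field_simps)
  qed
  have "AE x in M. \<forall>j. \<forall>\<^sub>F n in sequentially. (\<gamma> - 1 / real (Suc j)) * real n \<le> X n x"
    unfolding AE_all_countable by (intro allI subadditive_lower[OF X 1]) auto
  moreover have "AE x in M. \<forall>j. \<forall>\<^sub>F n in sequentially. X n x \<le> (\<gamma> + 1 / real (Suc j)) * real n"
  proof (subst AE_all_countable, rule allI)
    fix j :: nat
    obtain n where "1 \<le> n" "?E n < (\<gamma> + 1 / real (Suc j)) * real n" using 2[of "1 / real (Suc j)"] by auto
    then show "AE x in M. \<forall>\<^sub>F n in sequentially. X n x \<le> (\<gamma> + 1 / real (Suc j)) * real n"
      by (rule subadditive_upper[OF X])
  qed
  ultimately have "AE x in M. (\<lambda>n. X n x / real n) \<longlonglongrightarrow> \<gamma>"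
  proof eventually_elim
    case (elim x)
    show ?case
    proof (rule tendstoI)
      fix e :: real assume "0 < e"
      then obtain j where j: "1 / real (Suc j) < e" using reals_Archimedean[of e] by (auto simp: field_simps)
      have "\<forall>\<^sub>F n in sequentially. 1 \<le> n" by (rule eventually_ge_at_top)
      then show "\<forall>\<^sub>F n in sequentially. dist (X n x / real n) \<gamma> < e"
        using elim(1)[rule_format, of j] elim(2)[rule_format, of j]
      proof eventually_elim
        case (elim n)
        then have "\<bar>X n x / real n - \<gamma>\<bar> \<le> 1 / real (Suc j)"
          unfolding abs_le_iff by (auto simp: divide_simps) (simp_all add: algebra_simps)
        then show ?case using j by (simp add: dist_real_def)
      qed
    qed
  qed
  with 1 2 show ?thesis by blast
qed

end


section \<open>The shift on independent sequences\<close>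

definition shift :: "(nat \<Rightarrow> 'a) \<Rightarrow> nat \<Rightarrow> 'a" where
  "shift \<omega> i = \<omega> (Suc i)"

lemma shift_pow: "(shift ^^ n) \<omega> i = \<omega> (n + i)"
  by (induction n arbitrary: i) (auto simp: shift_def)

lemma shift_pow_comb_seq: "(shift ^^ n) (comb_seq n \<omega> \<omega>') = \<omega>'"
  by (rule ext) (simp add: shift_pow comb_seq_def)

context sequence_space
begin

lemma shift_measurable [measurable]: "shift \<in> measurable S S"
  by (rule measurable_PiM_single') (auto simp: shift_def space_PiM PiE_iff extensional_def intro!: measurable_component_singleton)

lemma shift_pow_measurable [measurable]: "shift ^^ n \<in> measurable S S"
  by (induction n) (auto simp: id_def)

lemma distr_shift_pow: "distr S S (shift ^^ n) = S"
  using distr_PiM_reindex[of UNIV "\<lambda>_. M" "\<lambda>i. n + i" "UNIV :: nat set"]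
  by (simp add: M.prob_space_axioms inj_on_def shift_pow[abs_def] restrict_UNIV)

lemma nn_integral_split:
  assumes [measurable]: "f \<in> borel_measurable S"
  shows "(\<integral>\<^sup>+\<omega>. f \<omega> \<partial>S) = (\<integral>\<^sup>+\<omega>. \<integral>\<^sup>+\<omega>'. f (comb_seq n \<omega> \<omega>') \<partial>S \<partial>S)"
proof -
  have "(\<integral>\<^sup>+\<omega>. f \<omega> \<partial>S) = (\<integral>\<^sup>+x. f (comb_seq n (fst x) (snd x)) \<partial>(S \<Otimes>\<^sub>M S))"
    by (subst PiM_comb_seq[of n, symmetric], subst nn_integral_distr) (auto simp: case_prod_beta')
  also have "\<dots> = (\<integral>\<^sup>+\<omega>. \<integral>\<^sup>+\<omega>'. f (comb_seq n \<omega> \<omega>') \<partial>S \<partial>S)"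
    by (subst P.nn_integral_fst[symmetric]) auto
  finally show ?thesis .
qed

lemma AE_split:
  assumes [measurable]: "Measurable.pred S Q"
  shows "(AE \<omega> in S. Q \<omega>) \<longleftrightarrow> (AE \<omega> in S. AE \<omega>' in S. Q (comb_seq n \<omega> \<omega>'))"
proof -
  interpret SS: pair_sigma_finite S S ..
  have "(AE \<omega> in S. Q \<omega>) \<longleftrightarrow> (AE \<omega> in distr (S \<Otimes>\<^sub>M S) S (\<lambda>(\<omega>, \<omega>'). comb_seq n \<omega> \<omega>'). Q \<omega>)"
    unfolding PiM_comb_seq ..
  also have "\<dots> \<longleftrightarrow> (AE x in S \<Otimes>\<^sub>M S. Q (comb_seq n (fst x) (snd x)))"
    by (subst AE_distr_iff) (auto simp: case_prod_beta')
  also have "\<dots> \<longleftrightarrow> (AE \<omega> in S. AE \<omega>' in S. Q (comb_seq n \<omega> \<omega>'))"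
    by (subst SS.AE_pair_iff[symmetric]) auto
  finally show ?thesis .
qed

lemma nn_integral_coordinate:
  assumes [measurable]: "f \<in> borel_measurable M"
  shows "(\<integral>\<^sup>+\<omega>. f (\<omega> i) \<partial>S) = (\<integral>\<^sup>+x. f x \<partial>M)"
  using nn_integral_distr[of "\<lambda>\<omega>. \<omega> i" S M f] PiM_component[of i] by simp

definition cylinder :: "nat \<Rightarrow> (nat \<Rightarrow> 'a) set \<Rightarrow> bool" where
  "cylinder K C \<longleftrightarrow> C \<in> sets S \<and>
     (\<forall>\<omega>\<in>space S. \<forall>\<omega>'\<in>space S. (\<forall>i<K. \<omega> i = \<omega>' i) \<longrightarrow> \<omega> \<in> C \<longrightarrow> \<omega>' \<in> C)"

lemma cylinder_mono: "cylinder K C \<Longrightarrow> K \<le> K' \<Longrightarrow> cylinder K' C"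
  unfolding cylinder_def by (meson less_le_trans)

lemma cylinder_Un: "cylinder K C \<Longrightarrow> cylinder K C' \<Longrightarrow> cylinder K (C \<union> C')"
  unfolding cylinder_def by blast

lemma cylinder_Diff: "cylinder K C \<Longrightarrow> cylinder K (space S - C)"
  unfolding cylinder_def by (metis Diff_iff sets.compl_sets)

lemma comb_seq_space: "\<omega> \<in> space S \<Longrightarrow> \<omega>' \<in> space S \<Longrightarrow> comb_seq n \<omega> \<omega>' \<in> space S"
  by (auto simp: space_PiM PiE_iff comb_seq_def)

lemma cylinder_comb_seq:
  assumes "cylinder K C" "\<omega> \<in> space S" "\<omega>' \<in> space S" "K \<le> n"
  shows "comb_seq n \<omega> \<omega>' \<in> C \<longleftrightarrow> \<omega> \<in> C"
proof -
  have "\<forall>i<K. comb_seq n \<omega> \<omega>' i = \<omega> i" using assms(4) by (simp add: comb_seq_less)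
  moreover from this have "\<forall>i<K. \<omega> i = comb_seq n \<omega> \<omega>' i" by simp
  ultimately show ?thesis
    using assms comb_seq_space[OF assms(2,3), of n] unfolding cylinder_def by blast
qed

definition approximable :: "(nat \<Rightarrow> 'a) set \<Rightarrow> bool" where
  "approximable A \<longleftrightarrow> A \<in> sets S \<and>
     (\<forall>e>0. \<exists>K C. cylinder K C \<and> P.prob (A - C) < e \<and> P.prob (C - A) < e)"

lemma approximableD:
  assumes "approximable A" "0 < e"
  obtains K C where "cylinder K C" "C \<in> sets S" "P.prob (A - C) < e" "P.prob (C - A) < e"
  using assms unfolding approximable_def cylinder_def by metis

lemma approximable_Un:
  assumes A: "approximable A" and B: "approximable B" shows "approximable (A \<union> B)"
  unfolding approximable_def
proof (intro conjI allI impI)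
  show "A \<union> B \<in> sets S" using A B by (auto simp: approximable_def)
  fix e :: real assume e: "0 < e"
  obtain K C where C: "cylinder K C" "C \<in> sets S" "P.prob (A - C) < e / 2" "P.prob (C - A) < e / 2"
    using approximableD[OF A, of "e / 2"] e by auto
  obtain L D where D: "cylinder L D" "D \<in> sets S" "P.prob (B - D) < e / 2" "P.prob (D - B) < e / 2"
    using approximableD[OF B, of "e / 2"] e by auto
  have AB: "A \<in> sets S" "B \<in> sets S" using A B by (auto simp: approximable_def)
  have "P.prob ((A \<union> B) - (C \<union> D)) \<le> P.prob ((A - C) \<union> (B - D))"
    using AB C D by (intro P.finite_measure_mono) auto
  also have "\<dots> \<le> P.prob (A - C) + P.prob (B - D)" using AB C D by (intro measure_Un_le) auto
  finally have 1: "P.prob ((A \<union> B) - (C \<union> D)) < e" using C D by simp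
  have "P.prob ((C \<union> D) - (A \<union> B)) \<le> P.prob ((C - A) \<union> (D - B))"
    using AB C D by (intro P.finite_measure_mono) auto
  also have "\<dots> \<le> P.prob (C - A) + P.prob (D - B)" using AB C D by (intro measure_Un_le) auto
  finally have 2: "P.prob ((C \<union> D) - (A \<union> B)) < e" using C D by simp
  have "cylinder (max K L) (C \<union> D)"
    using C D by (intro cylinder_Un) (auto intro: cylinder_mono)
  with 1 2 show "\<exists>K C. cylinder K C \<and> P.prob (A \<union> B - C) < e \<and> P.prob (C - (A \<union> B)) < e" by blast
qed

text \<open>
  The events that are approximable by cylinders form a \<open>\<sigma>\<close>-algebra, and it contains the events that
  depend on a single coordinate.
\<close>

lemma approximable_sets: "A \<in> sets S \<Longrightarrow> approximable A"
  unfolding sets_PiM_single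
proof (induction rule: sigma_sets.induct)
  case (Basic A)
  then obtain i B where B: "B \<in> sets M" "A = {f \<in> \<Pi>\<^sub>E i\<in>UNIV. space M. f i \<in> B}" by auto
  have [measurable]: "A \<in> sets S"
    using B by (auto simp: space_PiM[symmetric] intro!: sets_Collect_single')
  have "cylinder (Suc i) A" using \<open>A \<in> sets S\<close> unfolding cylinder_def by (auto simp: B space_PiM)
  then show ?case by (auto simp: approximable_def intro!: exI[of _ "Suc i"] exI[of _ A])
next
  case Empty
  have "cylinder 0 {}" by (simp add: cylinder_def)
  then show ?case by (auto simp: approximable_def intro!: exI[of _ 0] exI[of _ "{}"])
next
  case (Compl A)
  show ?case unfolding approximable_def
  proof (intro conjI allI impI)
    have AS: "A \<in> sets S" using Compl.IH by (simp add: approximable_def)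
    show "(\<Pi>\<^sub>E i\<in>UNIV. space M) - A \<in> sets S" using AS by (auto simp: space_PiM[symmetric])
    fix e :: real assume e: "0 < e"
    obtain K C where C: "cylinder K C" "C \<in> sets S" "P.prob (A - C) < e" "P.prob (C - A) < e"
      using approximableD[OF Compl.IH e] .
    have "((\<Pi>\<^sub>E i\<in>UNIV. space M) - A) - (space S - C) = C - A" "(space S - C) - ((\<Pi>\<^sub>E i\<in>UNIV. space M) - A) = A - C"
      using sets.sets_into_space[OF AS] sets.sets_into_space[OF C(2)] by (auto simp: space_PiM)
    then show "\<exists>K C. cylinder K C \<and> P.prob ((\<Pi>\<^sub>E i\<in>UNIV. space M) - A - C) < e
        \<and> P.prob (C - ((\<Pi>\<^sub>E i\<in>UNIV. space M) - A)) < e"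
      using C cylinder_Diff[OF C(1)] by metis
  qed
next
  case (Union A)
  have AS [measurable]: "A i \<in> sets S" for i using Union.IH by (simp add: approximable_def)
  define U where "U n = (\<Union>i<n. A i)" for n
  have U: "approximable (U n)" for n
  proof (induction n)
    case 0
    have "cylinder 0 {}" by (simp add: cylinder_def)
    then show ?case by (auto simp: U_def approximable_def intro!: exI[of _ 0] exI[of _ "{}"])
  next
    case (Suc n)
    have "U (Suc n) = U n \<union> A n" by (auto simp: U_def less_Suc_eq)
    then show ?case using approximable_Un[OF Suc Union.IH] by simp
  qed
  have US [measurable]: "U n \<in> sets S" for n unfolding U_def by auto
  show ?case unfolding approximable_def
  proof (intro conjI allI impI)
    show "\<Union> (range A) \<in> sets S" by auto
    fix e :: real assume e: "0 < e"
    have "(\<lambda>n. P.prob (U n)) \<longlonglongrightarrow> P.prob (\<Union>n. U n)"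
      by (intro P.finite_Lim_measure_incseq) (auto simp: incseq_def U_def intro: less_le_trans)
    moreover have "(\<Union>n. U n) = \<Union> (range A)" by (auto simp: U_def)
    ultimately have "\<forall>\<^sub>F n in sequentially. P.prob (\<Union> (range A)) - e / 2 < P.prob (U n)"
      using e by (intro order_tendstoD(1)) auto
    then obtain n where n: "P.prob (\<Union> (range A)) - e / 2 < P.prob (U n)" by (auto simp: eventually_sequentially)
    have Usub: "U n \<subseteq> \<Union> (range A)" by (auto simp: U_def)
    have "P.prob (\<Union> (range A) - U n) = P.prob (\<Union> (range A)) - P.prob (U n)"
      using Usub by (intro P.finite_measure_Diff) auto
    then have n: "P.prob (\<Union> (range A) - U n) < e / 2" using n by simp
    obtain K C where C: "cylinder K C" "C \<in> sets S" "P.prob (U n - C) < e / 2" "P.prob (C - U n) < e / 2"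
      using approximableD[OF U, of "e / 2"] e by auto
    have "P.prob (\<Union> (range A) - C) \<le> P.prob ((\<Union> (range A) - U n) \<union> (U n - C))"
      using C by (intro P.finite_measure_mono) auto
    also have "\<dots> \<le> P.prob (\<Union> (range A) - U n) + P.prob (U n - C)" using C by (intro measure_Un_le) auto
    finally have 1: "P.prob (\<Union> (range A) - C) < e" using n C by simp
    have "P.prob (C - \<Union> (range A)) \<le> P.prob (C - U n)"
      using C Usub by (intro P.finite_measure_mono) auto
    then have "P.prob (C - \<Union> (range A)) < e" using C e by simp
    with 1 C show "\<exists>K C. cylinder K C \<and> P.prob (\<Union> (range A) - C) < e \<and> P.prob (C - \<Union> (range A)) < e" by blast
  qed
qed

text \<open>
  Apply the hypothesis to a cylinder \<open>C\<close> close to \<open>A\<close> itself: both \<open>A \<inter> C\<close> and \<open>C\<close> are then close to \<open>A\<close>. Conditional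
  bounds on \<open>A\<close> given finitely many coordinates thus yield zero-one laws: \<open>A\<close> is null if \<open>q < 1\<close>.
\<close>

lemma prob_le_of_cylinders:
  assumes A: "A \<in> sets S" and q: "0 \<le> q"
    and le: "\<And>K C. cylinder K C \<Longrightarrow> P.prob (A \<inter> C) \<le> q * P.prob C"
  shows "P.prob A \<le> q * P.prob A"
proof (rule field_le_epsilon)
  fix e :: real assume e: "0 < e"
  obtain K C where C: "cylinder K C" "C \<in> sets S" "P.prob (A - C) < e / (q + 1)" "P.prob (C - A) < e / (q + 1)"
    using approximableD[OF approximable_sets[OF A], of "e / (q + 1)"] e q by auto
  have "P.prob A \<le> P.prob ((A \<inter> C) \<union> (A - C))" using A C by (intro P.finite_measure_mono) auto
  also have "\<dots> \<le> P.prob (A \<inter> C) + P.prob (A - C)" using A C by (intro measure_Un_le) auto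
  also have "\<dots> \<le> q * P.prob C + e / (q + 1)" using le[OF C(1)] C by simp
  also have "P.prob C \<le> P.prob (A \<union> (C - A))" using A C by (intro P.finite_measure_mono) auto
  also have "\<dots> \<le> P.prob A + P.prob (C - A)" using A C by (intro measure_Un_le) auto
  also have "\<dots> \<le> P.prob A + e / (q + 1)" using C by simp
  finally have "P.prob A \<le> q * (P.prob A + e / (q + 1)) + e / (q + 1)" using q by (auto simp: mult_left_mono)
  also have "\<dots> = q * P.prob A + (q + 1) * (e / (q + 1))"
  proof -
    have "q * (a + r) + r = q * a + (q + 1) * r" for a r by (simp add: algebra_simps)
    then show ?thesis .
  qed
  also have "(q + 1) * (e / (q + 1)) = e" using q by simp
  finally show "P.prob A \<le> q * P.prob A + e" .
qed

lemma prob_shift_vimage_Int_cylinder: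
  assumes A [measurable]: "A \<in> sets S" and C: "cylinder K C" and "K \<le> n"
  shows "P.prob ({\<omega> \<in> space S. (shift ^^ n) \<omega> \<in> A} \<inter> C) = P.prob A * P.prob C"
proof -
  have C' [measurable]: "C \<in> sets S" using C by (simp add: cylinder_def)
  let ?B = "{\<omega> \<in> space S. (shift ^^ n) \<omega> \<in> A} \<inter> C"
  have "emeasure S ?B = (\<integral>\<^sup>+\<omega>. indicator ?B \<omega> \<partial>S)" by simp
  also have "\<dots> = (\<integral>\<^sup>+\<omega>. \<integral>\<^sup>+\<omega>'. indicator ?B (comb_seq n \<omega> \<omega>') \<partial>S \<partial>S)"
    by (rule nn_integral_split) auto
  also have "\<dots> = (\<integral>\<^sup>+\<omega>. \<integral>\<^sup>+\<omega>'. indicator C \<omega> * indicator A \<omega>' \<partial>S \<partial>S)"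
    using C assms(3) by (intro nn_integral_cong)
      (auto simp: indicator_def shift_pow_comb_seq cylinder_comb_seq comb_seq_space)
  also have "\<dots> = emeasure S C * emeasure S A"
    by (simp add: nn_integral_cmult nn_integral_multc)
  finally show ?thesis
    by (simp add: P.emeasure_eq_measure measure_nonneg flip: ennreal_mult)
qed

text \<open>
  An invariant event \<open>A\<close> is contained, up to a null set, in its preimage under a large power of the shift, which is
  independent of a given cylinder. So \<open>prob_le_of_cylinders\<close> applies with \<open>q\<close> the probability of \<open>A\<close> and
  gives \<open>P A \<le> (P A)\<^sup>2\<close>.
\<close>

lemma ergodic_shift_pow:
  assumes "1 \<le> m" shows "ergodic_map S (shift ^^ m)"
proof
  let ?T = "shift ^^ m"
  show "?T \<in> measurable S S" by measurable
  show "distr S S ?T = S" by (rule distr_shift_pow)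
  fix A assume A [measurable]: "A \<in> sets S" and inv: "AE \<omega> in S. \<omega> \<in> A \<longrightarrow> ?T \<omega> \<in> A"
  have inv_pow: "AE \<omega> in S. \<omega> \<in> A \<longrightarrow> (shift ^^ (m * k)) \<omega> \<in> A" for k
  proof (induction k)
    case (Suc k)
    have "AE \<omega> in distr S S (shift ^^ (m * k)). \<omega> \<in> A \<longrightarrow> ?T \<omega> \<in> A" unfolding distr_shift_pow by (rule inv)
    then have "AE \<omega> in S. (shift ^^ (m * k)) \<omega> \<in> A \<longrightarrow> ?T ((shift ^^ (m * k)) \<omega>) \<in> A"
      by (rule AE_distrD[OF shift_pow_measurable])
    moreover have eq: "(shift ^^ (m * Suc k)) \<omega> = ?T ((shift ^^ (m * k)) \<omega>)" for \<omega> :: "nat \<Rightarrow> 'a"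
      by (simp add: funpow_add)
    ultimately show ?case unfolding eq using Suc by eventually_elim blast
  qed simp
  have "P.prob A \<le> P.prob A * P.prob A"
  proof (rule prob_le_of_cylinders)
    fix K C assume C: "cylinder K C"
    then have C' [measurable]: "C \<in> sets S" by (simp add: cylinder_def)
    have "P.prob (A \<inter> C) \<le> P.prob ({\<omega> \<in> space S. (shift ^^ (m * K)) \<omega> \<in> A} \<inter> C)"
      using inv_pow[of K] by (intro P.finite_measure_mono_AE) auto
    also have "\<dots> = P.prob A * P.prob C"
      by (rule prob_shift_vimage_Int_cylinder[OF A C]) (use assms in simp)
    finally show "P.prob (A \<inter> C) \<le> P.prob A * P.prob C" .
  qed auto
  then have "P.prob A * (1 - P.prob A) \<le> 0" by (simp add: algebra_simps)
  then show "P.prob A = 0 \<or> P.prob A = 1"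
    using P.prob_le_1[of A] measure_nonneg[of S A] by (auto simp: mult_le_0_iff)
qed

lemma totally_ergodic_shift: "totally_ergodic_map S shift"
  using ergodic_shift_pow[of 1] ergodic_shift_pow
  by (simp add: totally_ergodic_map_def totally_ergodic_map_axioms_def)

end

sublocale sequence_space \<subseteq> E: totally_ergodic_map "\<Pi>\<^sub>M i\<in>UNIV. M" shift
  by (rule totally_ergodic_shift)


section \<open>Random matrix products\<close>

lemma borel_measurable_matrix_mult [measurable (raw)]:
  fixes f g :: "'a \<Rightarrow> real^'n^'n"
  assumes "f \<in> borel_measurable N" "g \<in> borel_measurable N"
  shows "(\<lambda>x. f x ** g x) \<in> borel_measurable N"
proof (rule borel_measurable_continuous_Pair[OF assms])
  show "continuous_on UNIV (\<lambda>x :: (real^'n^'n) \<times> (real^'n^'n). fst x ** snd x)"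
    unfolding matrix_matrix_mult_def by (intro continuous_intros)
qed

lemma borel_measurable_matrix_vector_mult [measurable (raw)]:
  fixes f :: "'a \<Rightarrow> real^'n^'n"
  assumes "f \<in> borel_measurable N" "g \<in> borel_measurable N"
  shows "(\<lambda>x. f x *v g x) \<in> borel_measurable N"
proof (rule borel_measurable_continuous_Pair[OF assms])
  show "continuous_on UNIV (\<lambda>x :: (real^'n^'n) \<times> (real^'n). fst x *v snd x)"
    unfolding matrix_vector_mult_def by (intro continuous_intros)
qed

lemma cocycle_add: "cocycle (m + n) \<omega> = cocycle n ((shift ^^ m) \<omega>) ** cocycle m \<omega>"
proof (induction n)
  case (Suc n)
  then show ?case by (simp add: shift_pow matrix_mul_assoc)
qed simp

lemma cocycle_cong: "(\<And>i. i < n \<Longrightarrow> \<omega> i = \<omega>' i) \<Longrightarrow> cocycle n \<omega> = cocycle n \<omega>'"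
  by (induction n) auto

lemma cocycle_comb_seq: "cocycle n (comb_seq n \<omega> \<omega>') = cocycle n \<omega>"
  by (rule cocycle_cong) (simp add: comb_seq_less)

lemma abs_ln_le:
  fixes x p :: real assumes "0 < x" "0 < p"
  shows "\<bar>ln x\<bar> \<le> (x powr p + x powr (- p)) / p"
proof -
  have "p * ln x \<le> x powr p" "p * (- ln x) \<le> x powr (- p)"
    using ln_le_minus_one[of "x powr p"] ln_le_minus_one[of "x powr (- p)"] assms by (auto simp: ln_powr)
  then have "\<bar>p * ln x\<bar> \<le> x powr p + x powr (- p)"
    using powr_ge_zero[of x p] powr_ge_zero[of x "- p"] by linarith
  then show ?thesis using assms by (simp add: abs_mult field_simps)
qed

lemma powr_le_add_1: "0 \<le> x \<Longrightarrow> 0 \<le> a \<Longrightarrow> a \<le> b \<Longrightarrow> x powr a \<le> 1 + x powr (b :: real)"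
  by (cases "x \<le> 1") (use powr_mono[of a b x] powr_le1[of a x] in \<open>auto intro: add_increasing add_increasing2\<close>)

lemma nn_integral_finite_integrable:
  fixes f g :: "'a \<Rightarrow> real"
  assumes f: "f \<in> borel_measurable N" and bound: "AE x in N. \<bar>f x\<bar> \<le> g x" and fin: "(\<integral>\<^sup>+x. ennreal (g x) \<partial>N) < \<infinity>"
  shows "integrable N f"
proof (rule integrableI_bounded[OF f])
  have "(\<integral>\<^sup>+x. ennreal (norm (f x)) \<partial>N) \<le> (\<integral>\<^sup>+x. ennreal (g x) \<partial>N)"
    by (rule nn_integral_mono_AE) (use bound in \<open>auto intro: ennreal_leI\<close>)
  then show "(\<integral>\<^sup>+x. ennreal (norm (f x)) \<partial>N) < \<infinity>" using fin by (rule le_less_trans)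
qed

lemma integral_le_of_nn_integral:
  fixes f g :: "'a \<Rightarrow> real"
  assumes bound: "AE x in N. \<bar>f x\<bar> \<le> g x"
    and int: "(\<integral>\<^sup>+x. ennreal (g x) \<partial>N) \<le> ennreal c" and c: "0 \<le> c"
  shows "\<bar>\<integral>x. f x \<partial>N\<bar> \<le> c"
proof (cases "integrable N f")
  case True
  have "ennreal \<bar>\<integral>x. f x \<partial>N\<bar> \<le> (\<integral>\<^sup>+x. ennreal \<bar>f x\<bar> \<partial>N)"
    using integral_norm_bound_ennreal[OF True] by simp
  also have "\<dots> \<le> (\<integral>\<^sup>+x. ennreal (g x) \<partial>N)"
    by (rule nn_integral_mono_AE) (use bound in \<open>auto intro: ennreal_leI\<close>)
  also have "\<dots> \<le> ennreal c" by (rule int)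
  finally show ?thesis using c by simp
next
  case False then show ?thesis using c by (simp add: not_integrable_integral_eq)
qed

locale matrix_walk = sequence_space M for M :: "(real^'n^'n) measure" +
  assumes sets_M [measurable_cong]: "sets M = sets borel"
begin

lemma space_M: "space M = UNIV"
  using sets_eq_imp_space_eq[OF sets_M] by simp

lemma space_S: "space S = UNIV"
  by (simp add: space_PiM space_M)

lemma coordinate_measurable: "(\<lambda>\<omega>. \<omega> i) \<in> borel_measurable S"
proof -
  have "(\<lambda>\<omega>. \<omega> i) \<in> measurable S M" by (rule measurable_component_singleton) simp
  then show ?thesis by (simp cong: measurable_cong_sets add: sets_M measurable_cong_sets[OF refl sets_M])
qed

lemma cocycle_measurable [measurable]: "cocycle n \<in> borel_measurable S"
proof (induction n)
  case (Suc n)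
  then show ?case using coordinate_measurable[of n] by simp
qed simp

lemma nn_integral_cocycle_split:
  assumes [measurable]: "case_prod f \<in> borel_measurable (borel \<Otimes>\<^sub>M borel)"
  shows "(\<integral>\<^sup>+\<omega>. f (cocycle m \<omega>) (cocycle n ((shift ^^ m) \<omega>)) \<partial>S) = (\<integral>\<^sup>+\<omega>. \<integral>\<^sup>+\<omega>'. f (cocycle m \<omega>) (cocycle n \<omega>') \<partial>S \<partial>S)"
proof -
  have "(\<lambda>\<omega>. case_prod f (cocycle m \<omega>, cocycle n ((shift ^^ m) \<omega>))) \<in> borel_measurable S" by measurable
  then have "(\<integral>\<^sup>+\<omega>. f (cocycle m \<omega>) (cocycle n ((shift ^^ m) \<omega>)) \<partial>S) =
      (\<integral>\<^sup>+\<omega>. \<integral>\<^sup>+\<omega>'. f (cocycle m (comb_seq m \<omega> \<omega>')) (cocycle n ((shift ^^ m) (comb_seq m \<omega> \<omega>'))) \<partial>S \<partial>S)"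
    using nn_integral_split[of "\<lambda>\<omega>. f (cocycle m \<omega>) (cocycle n ((shift ^^ m) \<omega>))" m] by simp
  then show ?thesis by (simp add: cocycle_comb_seq shift_pow_comb_seq)
qed

lemma nn_integral_cocycle_1:
  assumes [measurable]: "f \<in> borel_measurable borel"
  shows "(\<integral>\<^sup>+\<omega>. f (cocycle (Suc 0) \<omega>) \<partial>S) = (\<integral>\<^sup>+g. f g \<partial>M)"
proof -
  have "f \<in> borel_measurable M" by measurable
  from nn_integral_coordinate[OF this, of 0] show ?thesis by simp
qed

end

text \<open>
  The moment conditions in a form suited to integration. That \<open>g *v v\<close> does not vanish is a separate
  condition because \<open>0 powr (- p) = 0\<close> in HOL.
\<close>

locale moment_walk = matrix_walk M for M :: "(real^'n^'n) measure" +
  fixes p C :: real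
  assumes p: "0 < p" "p \<le> 1" and C: "1 \<le> C"
    and upper: "(\<integral>\<^sup>+g. ennreal (opnorm g powr p) \<partial>M) \<le> ennreal C"
    and lower_AE: "norm v = 1 \<Longrightarrow> AE g in M. g *v v \<noteq> 0"
    and lower: "norm v = 1 \<Longrightarrow> (\<integral>\<^sup>+g. ennreal (norm (g *v v) powr (- p)) \<partial>M) \<le> ennreal C"

lemma moment_walkI:
  fixes \<mu> :: "(real^'n^'n) measure"
  assumes "0 < p" "p \<le> 1" "1 \<le> C" "\<mu> \<in> moment_class p C"
  shows "moment_walk \<mu> p C"
proof -
  have \<mu>: "prob_space \<mu>" and s [measurable_cong]: "sets \<mu> = sets borel" and u: "upper_moment p \<mu> \<le> ennreal C"
    and l: "lower_moment p \<mu> \<le> ennreal C" using assms(4) by (auto simp: moment_class_def)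
  interpret prob_space \<mu> by fact
  have lower: "(\<integral>\<^sup>+ g. (if g *v v = 0 then \<infinity> else ennreal (norm (g *v v) powr (- p))) \<partial>\<mu>) \<le> ennreal C"
    if "norm v = 1" for v
    using l that unfolding lower_moment_def by (simp add: SUP_le_iff)
  show ?thesis
  proof (unfold_locales)
    fix v :: "real^'n" assume v: "norm v = 1"
    have "AE g in \<mu>. (if g *v v = 0 then \<infinity> else ennreal (norm (g *v v) powr (- p))) \<noteq> \<infinity>"
    proof (rule nn_integral_PInf_AE)
      show "(\<integral>\<^sup>+ g. (if g *v v = 0 then \<infinity> else ennreal (norm (g *v v) powr (- p))) \<partial>\<mu>) \<noteq> \<infinity>"
        using lower[OF v] by (auto simp: top_unique)
    qed measurable
    then show "AE g in \<mu>. g *v v \<noteq> 0" by (rule AE_mp) (auto intro!: AE_I2)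
    have "(\<integral>\<^sup>+ g. ennreal (norm (g *v v) powr (- p)) \<partial>\<mu>) \<le>
        (\<integral>\<^sup>+ g. (if g *v v = 0 then \<infinity> else ennreal (norm (g *v v) powr (- p))) \<partial>\<mu>)"
      by (intro nn_integral_mono) auto
    then show "(\<integral>\<^sup>+ g. ennreal (norm (g *v v) powr (- p)) \<partial>\<mu>) \<le> ennreal C" using lower[OF v] by simp
  qed (use assms s u in \<open>auto simp: upper_moment_def\<close>)
qed

context moment_walk
begin

lemma lower_AE': "v \<noteq> 0 \<Longrightarrow> AE g in M. g *v v \<noteq> 0"
  using lower_AE[of "(1 / norm v) *\<^sub>R v"] by (simp add: matrix_vector_mult_scaleR)

lemma lower':
  assumes "v \<noteq> 0"
  shows "(\<integral>\<^sup>+g. ennreal (norm (g *v v) powr (- p)) \<partial>M) \<le> ennreal (C * norm v powr (- p))"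
proof -
  let ?u = "(1 / norm v) *\<^sub>R v"
  have "(\<integral>\<^sup>+g. ennreal (norm (g *v v) powr (- p)) \<partial>M) =
      (\<integral>\<^sup>+g. ennreal (norm v powr (- p)) * ennreal (norm (g *v ?u) powr (- p)) \<partial>M)"
    using assms by (intro nn_integral_cong)
      (simp add: matrix_vector_mult_scaleR powr_mult powr_divide flip: ennreal_mult)
  also have "\<dots> = ennreal (norm v powr (- p)) * (\<integral>\<^sup>+g. ennreal (norm (g *v ?u) powr (- p)) \<partial>M)"
    by (rule nn_integral_cmult) measurable
  also have "\<dots> \<le> ennreal (norm v powr (- p)) * ennreal C"
    using assms by (intro mult_left_mono lower) auto
  finally show ?thesis using C by (simp add: mult.commute flip: ennreal_mult)
qed

lemma AE_cocycle_nonzero: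
  assumes "v \<noteq> 0" shows "AE \<omega> in S. cocycle n \<omega> *v v \<noteq> 0"
proof (induction n)
  case (Suc n)
  have "AE \<omega> in S. AE \<omega>' in S. cocycle (Suc n) (comb_seq n \<omega> \<omega>') *v v \<noteq> 0"
    using Suc
  proof eventually_elim
    case (elim \<omega>)
    have "AE g in M. g *v (cocycle n \<omega> *v v) \<noteq> 0" by (rule lower_AE'[OF elim])
    then have "AE \<omega>' in S. \<omega>' 0 *v (cocycle n \<omega> *v v) \<noteq> 0" by (intro AE_component) auto
    then show ?case
      by eventually_elim (simp add: cocycle_comb_seq comb_seq_def matrix_vector_mul_assoc)
  qed
  then show ?case by (subst AE_split[of _ n]) auto
qed (use assms in simp)

lemma AE_cocycle_nonzero_all: "v \<noteq> 0 \<Longrightarrow> AE \<omega> in S. \<forall>n. cocycle n \<omega> *v v \<noteq> 0"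
  using AE_cocycle_nonzero[of v] by (simp add: AE_all_countable)

lemma moment_upper: "(\<integral>\<^sup>+\<omega>. ennreal (opnorm (cocycle n \<omega>) powr p) \<partial>S) \<le> ennreal (C ^ n)"
proof (induction n)
  case 0 then show ?case by (simp add: opnorm_mat_1 P.emeasure_space_1)
next
  case (Suc n)
  have "(\<integral>\<^sup>+\<omega>. ennreal (opnorm (cocycle (Suc n) \<omega>) powr p) \<partial>S) \<le>
      (\<integral>\<^sup>+\<omega>. ennreal (opnorm (cocycle n \<omega>) powr p) * ennreal (opnorm (cocycle (Suc 0) ((shift ^^ n) \<omega>)) powr p) \<partial>S)"
  proof (intro nn_integral_mono)
    fix \<omega>
    have "opnorm (cocycle (Suc n) \<omega>) powr p \<le> (opnorm (\<omega> n) * opnorm (cocycle n \<omega>)) powr p"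
      using p by (intro powr_mono2) (auto simp: opnorm_mult opnorm_nonneg)
    then show "ennreal (opnorm (cocycle (Suc n) \<omega>) powr p) \<le>
        ennreal (opnorm (cocycle n \<omega>) powr p) * ennreal (opnorm (cocycle (Suc 0) ((shift ^^ n) \<omega>)) powr p)"
      by (simp add: shift_pow powr_mult opnorm_nonneg ennreal_leI mult.commute flip: ennreal_mult)
  qed
  also have "\<dots> = (\<integral>\<^sup>+\<omega>. ennreal (opnorm (cocycle n \<omega>) powr p) * (\<integral>\<^sup>+\<omega>'. ennreal (opnorm (cocycle (Suc 0) \<omega>') powr p) \<partial>S) \<partial>S)"
    by (subst nn_integral_cocycle_split) (auto simp: nn_integral_cmult)
  also have "\<dots> \<le> (\<integral>\<^sup>+\<omega>. ennreal (opnorm (cocycle n \<omega>) powr p) * ennreal C \<partial>S)"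
    using upper nn_integral_cocycle_1[of "\<lambda>g. ennreal (opnorm g powr p)"]
    by (intro nn_integral_mono mult_left_mono) auto
  also have "\<dots> \<le> ennreal (C ^ n) * ennreal C"
    using Suc by (subst nn_integral_multc) (auto intro: mult_right_mono)
  finally show ?case using C by (simp add: mult.commute flip: ennreal_mult)
qed

lemma moment_lower:
  assumes "v \<noteq> 0"
  shows "(\<integral>\<^sup>+\<omega>. ennreal (norm (cocycle n \<omega> *v v) powr (- p)) \<partial>S) \<le> ennreal (C ^ n * norm v powr (- p))"
proof (induction n)
  case 0 then show ?case by (simp add: P.emeasure_space_1)
next
  case (Suc n)
  have "(\<integral>\<^sup>+\<omega>. ennreal (norm (cocycle (Suc n) \<omega> *v v) powr (- p)) \<partial>S) =
      (\<integral>\<^sup>+\<omega>. ennreal (norm (cocycle (Suc 0) ((shift ^^ n) \<omega>) *v (cocycle n \<omega> *v v)) powr (- p)) \<partial>S)"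
    by (simp add: shift_pow matrix_vector_mul_assoc)
  also have "\<dots> = (\<integral>\<^sup>+\<omega>. \<integral>\<^sup>+\<omega>'. ennreal (norm (cocycle (Suc 0) \<omega>' *v (cocycle n \<omega> *v v)) powr (- p)) \<partial>S \<partial>S)"
    by (rule nn_integral_cocycle_split) measurable
  also have "\<dots> \<le> (\<integral>\<^sup>+\<omega>. ennreal C * ennreal (norm (cocycle n \<omega> *v v) powr (- p)) \<partial>S)"
  proof (rule nn_integral_mono_AE, use AE_cocycle_nonzero[OF assms, of n] in eventually_elim)
    case (elim \<omega>)
    show ?case
      using lower'[OF elim] nn_integral_cocycle_1[of "\<lambda>g. ennreal (norm (g *v (cocycle n \<omega> *v v)) powr (- p))"] C
      by (simp flip: ennreal_mult)
  qed
  also have "\<dots> = ennreal C * (\<integral>\<^sup>+\<omega>. ennreal (norm (cocycle n \<omega> *v v) powr (- p)) \<partial>S)"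
    by (rule nn_integral_cmult) measurable
  also have "\<dots> \<le> ennreal C * ennreal (C ^ n * norm v powr (- p))"
    by (intro mult_left_mono Suc) simp
  finally show ?case using C by (simp add: mult.assoc flip: ennreal_mult)
qed

lemma AE_opnorm_pos: "AE \<omega> in S. \<forall>n. 0 < opnorm (cocycle n \<omega>)"
proof -
  have "AE \<omega> in S. \<forall>n. cocycle n \<omega> *v axis undefined 1 \<noteq> 0"
    by (rule AE_cocycle_nonzero_all) (simp add: axis_eq_0_iff)
  then show ?thesis
  proof eventually_elim
    case (elim \<omega>)
    show ?case
    proof
      fix n
      have "0 < norm (cocycle n \<omega> *v axis undefined 1)" using elim by simp
      also have "\<dots> \<le> opnorm (cocycle n \<omega>)"
        using norm_matrix_vector_le[of "cocycle n \<omega>" "axis undefined 1"] by simp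
      finally show "0 < opnorm (cocycle n \<omega>)" .
    qed
  qed
qed

lemma integrable_ln_norm:
  assumes "norm v = 1" shows "integrable S (\<lambda>\<omega>. ln (norm (cocycle n \<omega> *v v)))"
proof (rule nn_integral_finite_integrable)
  have v: "v \<noteq> 0" using assms by auto
  let ?g = "\<lambda>\<omega>. (opnorm (cocycle n \<omega>) powr p + norm (cocycle n \<omega> *v v) powr (- p)) / p"
  show "AE \<omega> in S. \<bar>ln (norm (cocycle n \<omega> *v v))\<bar> \<le> ?g \<omega>"
    using AE_cocycle_nonzero[OF v, of n]
  proof eventually_elim
    case (elim \<omega>)
    have "\<bar>ln (norm (cocycle n \<omega> *v v))\<bar> \<le> (norm (cocycle n \<omega> *v v) powr p + norm (cocycle n \<omega> *v v) powr (- p)) / p"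
      using elim p by (intro abs_ln_le) auto
    also have "\<dots> \<le> ?g \<omega>"
      using norm_matrix_vector_le[of "cocycle n \<omega>" v] assms p by (intro divide_right_mono add_right_mono powr_mono2) auto
    finally show ?case .
  qed
  have "(\<integral>\<^sup>+\<omega>. ennreal (?g \<omega>) \<partial>S) = (\<integral>\<^sup>+\<omega>. ennreal (1 / p) * (ennreal (opnorm (cocycle n \<omega>) powr p) + ennreal (norm (cocycle n \<omega> *v v) powr (- p))) \<partial>S)"
    using p by (intro nn_integral_cong) (simp flip: ennreal_plus ennreal_mult)
  also have "\<dots> = ennreal (1 / p) * ((\<integral>\<^sup>+\<omega>. ennreal (opnorm (cocycle n \<omega>) powr p) \<partial>S) + (\<integral>\<^sup>+\<omega>. ennreal (norm (cocycle n \<omega> *v v) powr (- p)) \<partial>S))"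
    by (simp add: nn_integral_cmult nn_integral_add)
  also have "\<dots> < \<infinity>"
    using le_less_trans[OF moment_upper[of n] ennreal_less_top] le_less_trans[OF moment_lower[OF v, of n] ennreal_less_top]
    by (simp add: ennreal_mult_less_top)
  finally show "(\<integral>\<^sup>+\<omega>. ennreal (?g \<omega>) \<partial>S) < \<infinity>" .
qed measurable

end


section \<open>Existence of the Lyapunov exponents\<close>

lemma elog_div_tendsto:
  assumes pos: "\<forall>\<^sub>F n in sequentially. 0 < x n" and lim: "(\<lambda>n. ln (x n) / real n) \<longlonglongrightarrow> l"
  shows "(\<lambda>n. elog (x n) / ereal (real n)) \<longlonglongrightarrow> ereal l"
proof (rule Lim_transform_eventually)
  show "(\<lambda>n. ereal (ln (x n) / real n)) \<longlonglongrightarrow> ereal l" using lim by simp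
  show "\<forall>\<^sub>F n in sequentially. ereal (ln (x n) / real n) = elog (x n) / ereal (real n)"
    using pos eventually_gt_at_top[of 0] by eventually_elim (simp add: elog_def)
qed

lemma lyapunov1_eq: "prob_space \<mu> \<Longrightarrow> has_growth_rate \<mu> opnorm l \<Longrightarrow> lyapunov1 \<mu> = l"
  unfolding lyapunov1_def by (rule the_equality) (auto intro: has_growth_rate_unique)

lemma lyapunov2_eq: "prob_space \<mu> \<Longrightarrow> has_growth_rate \<mu> (singular_value 2) l \<Longrightarrow> lyapunov2 \<mu> = l"
  unfolding lyapunov2_def by (rule the_equality) (auto intro: has_growth_rate_unique)

context moment_walk
begin

lemma integrable_of_moments:
  assumes f: "f \<in> borel_measurable S" and v: "v \<noteq> 0" and ab: "0 \<le> a" "0 \<le> b" "0 \<le> d"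
    and le: "AE \<omega> in S. \<bar>f \<omega>\<bar> \<le> a * opnorm (cocycle n \<omega>) powr p + b * norm (cocycle n \<omega> *v v) powr (- p) + d"
  shows "integrable S f"
proof (rule nn_integral_finite_integrable[OF f le])
  let ?U = "\<lambda>\<omega>. opnorm (cocycle n \<omega>) powr p" and ?L = "\<lambda>\<omega>. norm (cocycle n \<omega> *v v) powr (- p)"
  have "(\<integral>\<^sup>+\<omega>. ennreal (a * ?U \<omega> + b * ?L \<omega> + d) \<partial>S) =
      (\<integral>\<^sup>+\<omega>. ennreal a * ennreal (?U \<omega>) + ennreal b * ennreal (?L \<omega>) + ennreal d \<partial>S)"
    using ab by (intro nn_integral_cong) (simp flip: ennreal_plus ennreal_mult)
  also have "\<dots> = ennreal a * (\<integral>\<^sup>+\<omega>. ennreal (?U \<omega>) \<partial>S) + ennreal b * (\<integral>\<^sup>+\<omega>. ennreal (?L \<omega>) \<partial>S) + ennreal d"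
    by (simp add: nn_integral_cmult nn_integral_add P.emeasure_space_1)
  also have "\<dots> < \<infinity>"
    using le_less_trans[OF moment_upper[of n] ennreal_less_top] le_less_trans[OF moment_lower[OF v, of n] ennreal_less_top]
    by (simp add: ennreal_mult_less_top)
  finally show "(\<integral>\<^sup>+\<omega>. ennreal (a * ?U \<omega> + b * ?L \<omega> + d) \<partial>S) < \<infinity>" .
qed

abbreviation (input) e0 :: "real^'n" where "e0 \<equiv> axis undefined 1"

lemma e0_nonzero: "e0 \<noteq> 0" by (simp add: axis_eq_0_iff)

lemma norm_e0_le: "norm (g *v e0) \<le> opnorm g"
  using norm_matrix_vector_le[of g e0] by simp

lemma integrable_ln_opnorm: "integrable S (\<lambda>\<omega>. ln (opnorm (cocycle n \<omega>)))"
proof (rule integrable_of_moments[of _ e0 "1 / p" "1 / p" 0])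
  show "AE \<omega> in S. \<bar>ln (opnorm (cocycle n \<omega>))\<bar> \<le>
      1 / p * opnorm (cocycle n \<omega>) powr p + 1 / p * norm (cocycle n \<omega> *v e0) powr (- p) + 0"
    using AE_cocycle_nonzero[OF e0_nonzero, of n]
  proof eventually_elim
    case (elim \<omega>)
    then have pos: "0 < norm (cocycle n \<omega> *v e0)" by simp
    then have "0 < opnorm (cocycle n \<omega>)" using norm_e0_le[of "cocycle n \<omega>"] by linarith
    then have "\<bar>ln (opnorm (cocycle n \<omega>))\<bar> \<le> (opnorm (cocycle n \<omega>) powr p + opnorm (cocycle n \<omega>) powr (- p)) / p"
      using p by (intro abs_ln_le)
    also have "\<dots> \<le> (opnorm (cocycle n \<omega>) powr p + norm (cocycle n \<omega> *v e0) powr (- p)) / p"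
      using p pos norm_e0_le by (intro divide_right_mono add_left_mono powr_mono2') auto
    finally show ?case by (simp add: add_divide_distrib)
  qed
qed (use p e0_nonzero in auto)

lemma subadditive_ln_opnorm: "E.subadditive_process (\<lambda>n \<omega>. ln (opnorm (cocycle n \<omega>)))"
  unfolding E.subadditive_process_def
proof (intro conjI allI)
  have "AE \<omega> in S. \<forall>k n. 0 < opnorm (cocycle n ((shift ^^ k) \<omega>))" by (rule E.AE_T_pow_all[OF AE_opnorm_pos])
  with AE_opnorm_pos show "AE \<omega> in S. \<forall>m n. ln (opnorm (cocycle (m + n) \<omega>)) \<le>
      ln (opnorm (cocycle m \<omega>)) + ln (opnorm (cocycle n ((shift ^^ m) \<omega>)))"
  proof eventually_elim
    case (elim \<omega>)
    show ?case
    proof (intro allI)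
      fix m n
      have "ln (opnorm (cocycle (m + n) \<omega>)) \<le> ln (opnorm (cocycle m \<omega>) * opnorm (cocycle n ((shift ^^ m) \<omega>)))"
      proof (subst ln_le_cancel_iff)
        show "0 < opnorm (cocycle (m + n) \<omega>)" using elim(1) by blast
        show "0 < opnorm (cocycle m \<omega>) * opnorm (cocycle n ((shift ^^ m) \<omega>))"
          using elim by (intro mult_pos_pos) blast+
        show "opnorm (cocycle (m + n) \<omega>) \<le> opnorm (cocycle m \<omega>) * opnorm (cocycle n ((shift ^^ m) \<omega>))"
          unfolding cocycle_add[of m n] by (subst mult.commute) (rule opnorm_mult)
      qed
      also have "\<dots> = ln (opnorm (cocycle m \<omega>)) + ln (opnorm (cocycle n ((shift ^^ m) \<omega>)))"
        using elim by (intro ln_mult_pos) blast+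
      finally show "ln (opnorm (cocycle (m + n) \<omega>)) \<le> ln (opnorm (cocycle m \<omega>)) + ln (opnorm (cocycle n ((shift ^^ m) \<omega>)))" .
    qed
  qed
qed (auto simp: integrable_ln_opnorm opnorm_mat_1)

lemma integral_moment_lower_le:
  assumes "v \<noteq> 0"
  shows "integrable S (\<lambda>\<omega>. norm (cocycle n \<omega> *v v) powr (- p))"
    "(\<integral>\<omega>. norm (cocycle n \<omega> *v v) powr (- p) \<partial>S) \<le> C ^ n * norm v powr (- p)"
proof -
  show "integrable S (\<lambda>\<omega>. norm (cocycle n \<omega> *v v) powr (- p))"
    by (rule integrable_of_moments[OF _ assms, of _ 0 1 0]) auto
  have "\<bar>\<integral>\<omega>. norm (cocycle n \<omega> *v v) powr (- p) \<partial>S\<bar> \<le> C ^ n * norm v powr (- p)"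
    by (rule integral_le_of_nn_integral[OF _ moment_lower[OF assms]]) (use C in auto)
  then show "(\<integral>\<omega>. norm (cocycle n \<omega> *v v) powr (- p) \<partial>S) \<le> C ^ n * norm v powr (- p)" by simp
qed

text \<open>
  Jensen's inequality for the logarithm, in the form of the tangent \<open>ln y \<le> y / c - 1 + ln c\<close> at \<open>c = C ^ n\<close>,
  applied to a negative power \<open>y\<close> of the norm of the image of a fixed unit vector.
\<close>

lemma expectation_ln_opnorm_bound: "- (ln C / p) * real n \<le> (\<integral>\<omega>. ln (opnorm (cocycle n \<omega>)) \<partial>S)"
proof -
  let ?L = "\<lambda>\<omega>. norm (cocycle n \<omega> *v e0) powr (- p)"
  have Cn: "0 < C ^ n" using C by simp
  have "- (ln C / p) * real n \<le> (\<integral>\<omega>. - (1 / p) * (?L \<omega> / C ^ n - 1 + ln (C ^ n)) \<partial>S)"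
  proof -
    have "(\<integral>\<omega>. ?L \<omega> / C ^ n - 1 + ln (C ^ n) \<partial>S) = (\<integral>\<omega>. ?L \<omega> \<partial>S) / C ^ n - 1 + ln (C ^ n)"
      using integral_moment_lower_le(1)[OF e0_nonzero, of n] by (simp add: P.prob_space)
    also have "\<dots> \<le> ln (C ^ n)"
      using integral_moment_lower_le(2)[OF e0_nonzero, of n] Cn by (simp add: field_simps)
    also have "\<dots> = real n * ln C" using C by (simp add: ln_realpow)
    finally show ?thesis using p by (simp add: field_simps)
  qed
  also have "\<dots> \<le> (\<integral>\<omega>. ln (opnorm (cocycle n \<omega>)) \<partial>S)"
  proof (rule integral_mono_AE)
    show "AE \<omega> in S. - (1 / p) * (?L \<omega> / C ^ n - 1 + ln (C ^ n)) \<le> ln (opnorm (cocycle n \<omega>))"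
      using AE_cocycle_nonzero[OF e0_nonzero, of n]
    proof eventually_elim
      case (elim \<omega>)
      then have pos: "0 < norm (cocycle n \<omega> *v e0)" by simp
      have "ln (?L \<omega> / C ^ n) \<le> ?L \<omega> / C ^ n - 1" using pos Cn by (intro ln_le_minus_one) auto
      moreover have "ln (?L \<omega> / C ^ n) = - p * ln (norm (cocycle n \<omega> *v e0)) - ln (C ^ n)"
        using pos Cn ln_divide_pos[of "?L \<omega>" "C ^ n"] by (simp add: ln_powr)
      ultimately have "- p * ln (norm (cocycle n \<omega> *v e0)) \<le> ?L \<omega> / C ^ n - 1 + ln (C ^ n)" by linarith
      then have "- (1 / p) * (?L \<omega> / C ^ n - 1 + ln (C ^ n)) \<le> ln (norm (cocycle n \<omega> *v e0))"
        using p by (simp add: field_simps)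
      also have "\<dots> \<le> ln (opnorm (cocycle n \<omega>))"
        by (rule ln_mono[OF norm_e0_le pos])
      finally show ?case .
    qed
  qed (use integral_moment_lower_le(1)[OF e0_nonzero, of n] in \<open>auto simp: integrable_ln_opnorm\<close>)
  finally show ?thesis .
qed

lemma prob_space_M: "prob_space M"
  by (rule M.prob_space_axioms)

text \<open>
  Kingman's theorem for \<open>ln (opnorm (cocycle n \<omega>))\<close>. The last two conjuncts identify the exponent as the infimum
  of the normalised means.
\<close>

theorem furstenberg_kesten:
  shows "\<exists>L. lyapunov1 M = ereal L \<and> has_growth_rate M opnorm (ereal L) \<and>
    (AE \<omega> in S. (\<lambda>n. ln (opnorm (cocycle n \<omega>)) / real n) \<longlonglongrightarrow> L) \<and>
    (\<forall>n. L * real n \<le> (\<integral>\<omega>. ln (opnorm (cocycle n \<omega>)) \<partial>S)) \<and>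
    (\<forall>e>0. \<exists>n\<ge>1. (\<integral>\<omega>. ln (opnorm (cocycle n \<omega>)) \<partial>S) < (L + e) * real n)"
proof -
  obtain L where L: "\<And>n. 1 \<le> n \<Longrightarrow> L * real n \<le> (\<integral>\<omega>. ln (opnorm (cocycle n \<omega>)) \<partial>S)"
    "\<And>e. 0 < e \<Longrightarrow> \<exists>n\<ge>1. (\<integral>\<omega>. ln (opnorm (cocycle n \<omega>)) \<partial>S) < (L + e) * real n"
    "AE \<omega> in S. (\<lambda>n. ln (opnorm (cocycle n \<omega>)) / real n) \<longlonglongrightarrow> L"
    using E.kingman[OF subadditive_ln_opnorm expectation_ln_opnorm_bound] by blast
  have g: "has_growth_rate M opnorm (ereal L)"
    unfolding has_growth_rate_def using L(3) AE_opnorm_pos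
  proof eventually_elim
    case (elim \<omega>)
    then show ?case by (intro elog_div_tendsto) auto
  qed
  have "L * real n \<le> (\<integral>\<omega>. ln (opnorm (cocycle n \<omega>)) \<partial>S)" for n
    using L(1)[of n] by (cases "n = 0") (auto simp: opnorm_mat_1)
  with g L(2,3) show ?thesis using lyapunov1_eq[OF prob_space_M g] by blast
qed

text \<open>
  Cutting the area factor off at \<open>exp (- K * n)\<close> keeps the logarithm subadditive and makes it integrable
  even if the products degenerate, as they do when the second exponent is \<open>- \<infinity>\<close>.
\<close>

definition log_area :: "real \<Rightarrow> nat \<Rightarrow> (nat \<Rightarrow> real^'n^'n) \<Rightarrow> real" where
  "log_area K n \<omega> = ln (max (area_factor (cocycle n \<omega>)) (exp (- K * real n)))"

lemma log_area_measurable [measurable]: "log_area K n \<in> borel_measurable S"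
  unfolding log_area_def[abs_def] by measurable

lemma log_area_ge: "- K * real n \<le> log_area K n \<omega>"
proof -
  have "ln (exp (- K * real n)) \<le> log_area K n \<omega>"
    unfolding log_area_def by (subst ln_le_cancel_iff) (auto simp: less_max_iff_disj)
  then show ?thesis by simp
qed

lemma log_area_le:
  assumes "0 \<le> K" shows "log_area K n \<omega> \<le> 2 / p * opnorm (cocycle n \<omega>) powr p"
proof (cases "opnorm (cocycle n \<omega>) \<le> 1")
  case True
  have "opnorm (cocycle n \<omega>) * opnorm (cocycle n \<omega>) \<le> 1 * 1" by (intro mult_mono True) (auto simp: opnorm_nonneg)
  then have "area_factor (cocycle n \<omega>) \<le> 1" using area_factor_le_opnorm[of "cocycle n \<omega>"] by linarith
  then have "log_area K n \<omega> \<le> ln 1"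
    unfolding log_area_def using assms by (subst ln_le_cancel_iff) (auto simp: less_max_iff_disj)
  moreover have "0 \<le> 2 / p * opnorm (cocycle n \<omega>) powr p" using p by simp
  ultimately show ?thesis by simp
next
  case False
  let ?b = "opnorm (cocycle n \<omega>)"
  have b: "1 < ?b" using False by simp
  have "1 * 1 \<le> ?b * ?b" using b by (intro mult_mono) auto
  moreover have "exp (- K * real n) \<le> 1" using assms by simp
  ultimately have "max (area_factor (cocycle n \<omega>)) (exp (- K * real n)) \<le> ?b * ?b"
    using area_factor_le_opnorm[of "cocycle n \<omega>"] by (intro max.boundedI) linarith+
  then have "log_area K n \<omega> \<le> ln (?b * ?b)"
    unfolding log_area_def using b by (subst ln_le_cancel_iff) (auto simp: less_max_iff_disj)
  also have "\<dots> = 2 * ln ?b" using b by (simp add: ln_mult_pos)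
  also have "\<dots> \<le> 2 / p * ?b powr p"
    using ln_le_minus_one[of "?b powr p"] b p by (simp add: ln_powr field_simps)
  finally show ?thesis .
qed

lemma integrable_log_area:
  assumes "0 \<le> K" shows "integrable S (log_area K n)"
proof (rule integrable_of_moments[of _ e0 "2 / p" 0 "K * real n" n])
  show "AE \<omega> in S. \<bar>log_area K n \<omega>\<bar> \<le> 2 / p * opnorm (cocycle n \<omega>) powr p +
      0 * norm (cocycle n \<omega> *v e0) powr (- p) + K * real n"
  proof (rule AE_I2)
    fix \<omega> :: "nat \<Rightarrow> real^'n^'n"
    have "0 \<le> 2 / p * opnorm (cocycle n \<omega>) powr p" "0 \<le> K * real n" using p assms by auto
    with log_area_ge[of K n \<omega>] log_area_le[OF assms, of n \<omega>]
    show "\<bar>log_area K n \<omega>\<bar> \<le> 2 / p * opnorm (cocycle n \<omega>) powr p +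
        0 * norm (cocycle n \<omega> *v e0) powr (- p) + K * real n" by simp
  qed
qed (use p assms e0_nonzero in auto)

lemma subadditive_log_area:
  assumes K: "0 \<le> K" shows "E.subadditive_process (log_area K)"
  unfolding E.subadditive_process_def
proof (intro conjI allI AE_I2)
  fix \<omega> :: "nat \<Rightarrow> real^'n^'n" and m n
  let ?a = "area_factor (cocycle m \<omega>)" and ?b = "area_factor (cocycle n ((shift ^^ m) \<omega>))"
  let ?x = "max ?a (exp (- K * real m))" and ?y = "max ?b (exp (- K * real n))"
  have pos: "0 < ?x" "0 < ?y" by (auto simp: less_max_iff_disj)
  have "area_factor (cocycle (m + n) \<omega>) \<le> ?b * ?a"
    unfolding cocycle_add by (rule area_factor_mult)
  also have "\<dots> \<le> ?y * ?x" using area_factor_nonneg pos by (intro mult_mono) (auto intro: less_imp_le)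
  finally have 1: "area_factor (cocycle (m + n) \<omega>) \<le> ?x * ?y" by (simp add: mult.commute)
  have "exp (- K * real (m + n)) = exp (- K * real m) * exp (- K * real n)"
    by (simp add: algebra_simps flip: exp_add)
  also have "\<dots> \<le> ?x * ?y" using pos by (intro mult_mono) auto
  finally have "max (area_factor (cocycle (m + n) \<omega>)) (exp (- K * real (m + n))) \<le> ?x * ?y"
    using 1 by simp
  then have "log_area K (m + n) \<omega> \<le> ln (?x * ?y)"
    unfolding log_area_def using pos by (subst ln_le_cancel_iff) (auto simp: less_max_iff_disj)
  also have "\<dots> = log_area K m \<omega> + log_area K n ((shift ^^ m) \<omega>)"
    using pos unfolding log_area_def by (simp add: ln_mult_pos)
  finally show "log_area K (m + n) \<omega> \<le> log_area K m \<omega> + log_area K n ((shift ^^ m) \<omega>)" .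
next
  fix \<omega> show "log_area K 0 \<omega> = 0"
    using area_factor_mat_1 by (simp add: log_area_def max_def)
qed (rule integrable_log_area[OF K])

text \<open>
  Let \<open>\<gamma>\<close> be the growth rate of the truncated logarithm of the area. If \<open>\<gamma> \<ge> 2 * L\<close>, the truncation at
  \<open>- K < 2 * L\<close> is eventually inactive, so the second singular value, the quotient of area factor and norm,
  has the growth rate \<open>\<gamma> - L \<ge> L\<close>. This contradicts the gap.
\<close>

lemma expected_log_area_gap:
  assumes L1: "lyapunov1 M = ereal L" and gap: "lyapunov2 M < lyapunov1 M"
    and lim: "AE \<omega> in S. (\<lambda>n. ln (opnorm (cocycle n \<omega>)) / real n) \<longlonglongrightarrow> L"
  obtains K e m where "0 \<le> K" "0 < e" "1 \<le> m" "(\<integral>\<omega>. log_area K m \<omega> \<partial>S) < (2 * L - e) * real m"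
proof -
  \<comment> \<open>Any nonnegative \<open>K\<close> with \<open>- K < 2 * L\<close> will do.\<close>
  define K where "K = \<bar>2 * L\<bar> + 1"
  have K: "0 \<le> K" "- K < 2 * L" by (auto simp: K_def)
  have lb: "- K * real n \<le> (\<integral>\<omega>. log_area K n \<omega> \<partial>S)" for n
  proof -
    have "(\<integral>\<omega>. - K * real n \<partial>S) \<le> (\<integral>\<omega>. log_area K n \<omega> \<partial>S)"
      by (intro integral_mono integrable_log_area K log_area_ge) simp
    then show ?thesis by (simp add: P.prob_space)
  qed
  obtain \<gamma> where \<gamma>: "\<And>e. 0 < e \<Longrightarrow> \<exists>n\<ge>1. (\<integral>\<omega>. log_area K n \<omega> \<partial>S) < (\<gamma> + e) * real n"
    "AE \<omega> in S. (\<lambda>n. log_area K n \<omega> / real n) \<longlonglongrightarrow> \<gamma>"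
    using E.kingman[OF subadditive_log_area[OF K(1)] lb] by blast
  show thesis
  proof (cases "\<gamma> < 2 * L")
    case True
    obtain m where m: "1 \<le> m" "(\<integral>\<omega>. log_area K m \<omega> \<partial>S) < (\<gamma> + (2 * L - \<gamma>) / 2) * real m"
      using \<gamma>(1)[of "(2 * L - \<gamma>) / 2"] True by auto
    have "\<gamma> + (2 * L - \<gamma>) / 2 = 2 * L - (2 * L - \<gamma>) / 2" by (simp add: field_simps)
    with m(2) have "(\<integral>\<omega>. log_area K m \<omega> \<partial>S) < (2 * L - (2 * L - \<gamma>) / 2) * real m" by (simp only:)
    then show thesis using m(1) True K(1) by (intro that[of K "(2 * L - \<gamma>) / 2" m]) auto
  next
    case False
    have "has_growth_rate M (singular_value 2) (ereal (\<gamma> - L))"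
      unfolding has_growth_rate_def using \<gamma>(2) lim AE_opnorm_pos
    proof eventually_elim
      case (elim \<omega>)
      let ?s = "\<lambda>n. singular_value 2 (cocycle n \<omega>)"
      have "\<forall>\<^sub>F n in sequentially. - K < log_area K n \<omega> / real n"
        using False K by (intro order_tendstoD(1)[OF elim(1)]) auto
      with eventually_gt_at_top[of 0]
      have ev: "\<forall>\<^sub>F n in sequentially. 0 < ?s n \<and> log_area K n \<omega> = ln (?s n) + ln (opnorm (cocycle n \<omega>))"
      proof eventually_elim
        case (elim n)
        then have "- K * real n < log_area K n \<omega>" by (simp add: field_simps)
        then have "\<not> area_factor (cocycle n \<omega>) \<le> exp (- K * real n)"
          unfolding log_area_def by (auto simp: max_def)
        then have gt: "exp (- K * real n) < area_factor (cocycle n \<omega>)" by simp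
        moreover have "0 < exp (- K * real n)" by simp
        ultimately have apos: "0 < area_factor (cocycle n \<omega>)" by linarith
        have op: "0 < opnorm (cocycle n \<omega>)" using \<open>\<forall>n. 0 < opnorm (cocycle n \<omega>)\<close> by blast
        have spos: "0 < ?s n" using apos op by (simp add: area_factor_eq zero_less_mult_iff)
        have "log_area K n \<omega> = ln (opnorm (cocycle n \<omega>) * ?s n)"
          using gt by (simp add: log_area_def area_factor_eq max_def)
        then show ?case using op spos by (simp add: ln_mult_pos)
      qed
      show ?case
      proof (rule elog_div_tendsto)
        show "\<forall>\<^sub>F n in sequentially. 0 < ?s n" using ev by eventually_elim simp
        show "(\<lambda>n. ln (?s n) / real n) \<longlonglongrightarrow> \<gamma> - L"
        proof (rule Lim_transform_eventually)
          show "(\<lambda>n. log_area K n \<omega> / real n - ln (opnorm (cocycle n \<omega>)) / real n) \<longlonglongrightarrow> \<gamma> - L"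
            by (intro tendsto_diff elim)
          show "\<forall>\<^sub>F n in sequentially. log_area K n \<omega> / real n - ln (opnorm (cocycle n \<omega>)) / real n = ln (?s n) / real n"
            using ev by eventually_elim (simp add: diff_divide_distrib[symmetric])
        qed
      qed
    qed
    then have "lyapunov2 M = ereal (\<gamma> - L)" by (rule lyapunov2_eq[OF prob_space_M])
    then show thesis using gap L1 False by simp
  qed
qed

end


section \<open>Uniform growth of vectors\<close>

text \<open>
  Fatou's lemma for events. It is applied along convergent sequences of vectors, where events that
  occur infinitely often are inherited by the limit vector.
\<close>

lemma (in prob_space) prob_infinitely_often_ge:
  assumes A [measurable]: "\<And>i :: nat. A i \<in> events" and c: "\<And>i. N \<le> i \<Longrightarrow> c \<le> prob (A i)"
  shows "c \<le> prob {x \<in> space M. \<forall>m. \<exists>i\<ge>m. x \<in> A i}"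
proof -
  define U where "U m = (\<Union>i\<in>{m..}. A i)" for m
  have [measurable]: "U m \<in> events" for m unfolding U_def by auto
  have "decseq U" unfolding decseq_def U_def by (intro allI impI UN_mono) auto
  then have "(\<lambda>m. prob (U m)) \<longlonglongrightarrow> prob (\<Inter>m. U m)"
    by (intro finite_Lim_measure_decseq) auto
  moreover have "\<forall>\<^sub>F m in sequentially. c \<le> prob (U m)"
    unfolding eventually_sequentially
  proof (intro exI[of _ N] allI impI)
    fix m assume "N \<le> m"
    then have "c \<le> prob (A m)" by (rule c)
    also have "\<dots> \<le> prob (U m)" by (intro finite_measure_mono) (auto simp: U_def)
    finally show "c \<le> prob (U m)" .
  qed
  ultimately have "c \<le> prob (\<Inter>m. U m)"
    by (rule tendsto_lowerbound) simp
  also have "(\<Inter>m. U m) = {x \<in> space M. \<forall>m. \<exists>i\<ge>m. x \<in> A i}"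
    using sets.sets_into_space[OF A] by (fastforce simp: U_def)
  finally show ?thesis .
qed

lemma ennreal_affine: "0 \<le> a \<Longrightarrow> 0 \<le> b \<Longrightarrow> 0 \<le> y \<Longrightarrow> ennreal (a + b * y) = ennreal a + ennreal b * ennreal y"
  by (simp add: ennreal_mult)

lemma growth_rate_le:
  assumes "prob_space \<mu>" and g: "has_growth_rate \<mu> f (ereal L)" and f0: "\<And>g. 0 \<le> f g"
    and bound: "AE \<omega> in iid \<mu>. \<exists>K. \<forall>n. f (cocycle n \<omega>) \<le> K * exp (\<beta> * real n)"
  shows "L \<le> \<beta>"
proof -
  interpret P: prob_space "iid \<mu>" by (rule prob_space_PiM) (rule assms(1))
  have "AE \<omega> in iid \<mu>. L \<le> \<beta>"
    using bound g[unfolded has_growth_rate_def]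
  proof eventually_elim
    case (elim \<omega>)
    then obtain K' where K': "\<And>n. f (cocycle n \<omega>) \<le> K' * exp (\<beta> * real n)" by blast
    define K where "K = max K' 1"
    have K: "0 < K" "f (cocycle n \<omega>) \<le> K * exp (\<beta> * real n)" for n
    proof -
      have "K' * exp (\<beta> * real n) \<le> K * exp (\<beta> * real n)" by (rule mult_right_mono) (simp_all add: K_def)
      then show "f (cocycle n \<omega>) \<le> K * exp (\<beta> * real n)" using K'[of n] by linarith
    qed (simp add: K_def)
    have "(\<lambda>n. ln K / real n + \<beta>) \<longlonglongrightarrow> 0 + \<beta>"
      by (intro tendsto_add tendsto_const lim_const_over_n)
    then have lim: "(\<lambda>n. ereal (ln K / real n + \<beta>)) \<longlonglongrightarrow> ereal \<beta>" by simp
    have "\<forall>\<^sub>F n in sequentially. elog (f (cocycle n \<omega>)) / ereal (real n) \<le> ereal (ln K / real n + \<beta>)"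
      using eventually_gt_at_top[of 0]
    proof eventually_elim
      case (elim n)
      show ?case
      proof (cases "f (cocycle n \<omega>) = 0")
        case True then show ?thesis using elim by (simp add: elog_def)
      next
        case False
        then have "0 < f (cocycle n \<omega>)" using f0[of "cocycle n \<omega>"] by simp
        then have "ln (f (cocycle n \<omega>)) \<le> ln (K * exp (\<beta> * real n))" by (rule ln_mono[OF K(2)])
        also have "\<dots> = ln K + \<beta> * real n" using K(1) by (simp add: ln_mult_pos)
        finally show ?thesis using False elim by (simp add: elog_def field_simps)
      qed
    qed
    then have "ereal L \<le> ereal \<beta>" by (intro tendsto_le[OF _ lim elim(2)]) auto
    then show ?case by simp
  qed
  then show ?thesis by simp
qed

text \<open>
  Vectors whose orbit is bounded by a multiple of \<open>exp (\<beta> * n)\<close> form a subspace. The constant \<open>K\<close> is taken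
  natural so that membership is visibly a countable union of events.
\<close>

definition slow_vectors :: "real \<Rightarrow> (nat \<Rightarrow> real^'n^'n) \<Rightarrow> (real^'n) set" where
  "slow_vectors \<beta> \<omega> = {v. \<exists>K::nat. \<forall>n. norm (cocycle n \<omega> *v v) \<le> real K * exp (\<beta> * real n)}"

lemma slow_vectorsI:
  assumes "\<And>n. norm (cocycle n \<omega> *v v) \<le> K * exp (\<beta> * real n)"
  shows "v \<in> slow_vectors \<beta> \<omega>"
proof -
  obtain k :: nat where "K \<le> real k" using real_arch_simple by blast
  then have "norm (cocycle n \<omega> *v v) \<le> real k * exp (\<beta> * real n)" for n
    using assms[of n] by (meson exp_ge_zero mult_right_mono order_trans)
  then show ?thesis by (auto simp: slow_vectors_def)
qed

lemma slow_vectorsE: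
  assumes "v \<in> slow_vectors \<beta> \<omega>"
  obtains K where "0 \<le> K" "\<And>n. norm (cocycle n \<omega> *v v) \<le> K * exp (\<beta> * real n)"
proof -
  obtain K :: nat where "\<And>n. norm (cocycle n \<omega> *v v) \<le> real K * exp (\<beta> * real n)"
    using assms by (auto simp: slow_vectors_def)
  then show thesis by (intro that[of "real K"]) auto
qed

lemma subspace_slow_vectors: "subspace (slow_vectors \<beta> \<omega>)"
proof (rule subspaceI)
  show "0 \<in> slow_vectors \<beta> \<omega>" by (rule slow_vectorsI[of _ _ 0]) simp
next
  fix v w assume "v \<in> slow_vectors \<beta> \<omega>" "w \<in> slow_vectors \<beta> \<omega>"
  then obtain K K' where "\<And>n. norm (cocycle n \<omega> *v v) \<le> K * exp (\<beta> * real n)"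
    "\<And>n. norm (cocycle n \<omega> *v w) \<le> K' * exp (\<beta> * real n)" by (metis slow_vectorsE)
  then have "norm (cocycle n \<omega> *v (v + w)) \<le> (K + K') * exp (\<beta> * real n)" for n
    unfolding matrix_vector_right_distrib distrib_right by (intro norm_triangle_mono)
  then show "v + w \<in> slow_vectors \<beta> \<omega>" by (rule slow_vectorsI)
next
  fix c v assume "v \<in> slow_vectors \<beta> \<omega>"
  then obtain K where "\<And>n. norm (cocycle n \<omega> *v v) \<le> K * exp (\<beta> * real n)" by (metis slow_vectorsE)
  then have "norm (cocycle n \<omega> *v (c *\<^sub>R v)) \<le> (\<bar>c\<bar> * K) * exp (\<beta> * real n)" for n
    by (simp add: matrix_vector_mult_scaleR mult.assoc mult_left_mono)
  then show "c *\<^sub>R v \<in> slow_vectors \<beta> \<omega>" by (rule slow_vectorsI)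
qed

text \<open>
  Finitely many initial matrices only change the constant.
\<close>

lemma slow_vectors_shift: "v \<in> slow_vectors \<beta> \<omega> \<longleftrightarrow> cocycle m \<omega> *v v \<in> slow_vectors \<beta> ((shift ^^ m) \<omega>)"
proof
  assume "v \<in> slow_vectors \<beta> \<omega>"
  then obtain K where K: "\<And>n. norm (cocycle n \<omega> *v v) \<le> K * exp (\<beta> * real n)" by (metis slow_vectorsE)
  show "cocycle m \<omega> *v v \<in> slow_vectors \<beta> ((shift ^^ m) \<omega>)"
  proof (rule slow_vectorsI[of _ _ "K * exp (\<beta> * real m)"])
    fix n show "norm (cocycle n ((shift ^^ m) \<omega>) *v (cocycle m \<omega> *v v)) \<le> K * exp (\<beta> * real m) * exp (\<beta> * real n)"
      using K[of "m + n"] by (simp add: cocycle_add matrix_vector_mul_assoc distrib_left exp_add mult_ac)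
  qed
next
  assume "cocycle m \<omega> *v v \<in> slow_vectors \<beta> ((shift ^^ m) \<omega>)"
  then obtain K where K: "0 \<le> K" "\<And>n. norm (cocycle n ((shift ^^ m) \<omega>) *v (cocycle m \<omega> *v v)) \<le> K * exp (\<beta> * real n)"
    by (metis slow_vectorsE)
  define D where "D = (\<Sum>i<m. norm (cocycle i \<omega> *v v) * exp (- \<beta> * real i))"
  have D0: "0 \<le> D" by (auto simp: D_def intro: sum_nonneg)
  show "v \<in> slow_vectors \<beta> \<omega>"
  proof (rule slow_vectorsI[of _ _ "K * exp (- \<beta> * real m) + D"])
    fix n
    show "norm (cocycle n \<omega> *v v) \<le> (K * exp (- \<beta> * real m) + D) * exp (\<beta> * real n)"
    proof (cases "n < m")
      case True
      have "norm (cocycle n \<omega> *v v) * exp (- \<beta> * real n) \<le> D"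
        unfolding D_def using True by (intro member_le_sum) auto
      then have "norm (cocycle n \<omega> *v v) * exp (- \<beta> * real n) * exp (\<beta> * real n) \<le> D * exp (\<beta> * real n)"
        by (rule mult_right_mono) simp
      then have "norm (cocycle n \<omega> *v v) \<le> D * exp (\<beta> * real n)"
        by (simp add: mult.assoc exp_minus_inverse flip: exp_add)
      also have "\<dots> \<le> (K * exp (- \<beta> * real m) + D) * exp (\<beta> * real n)"
        using K(1) by (intro mult_right_mono) auto
      finally show ?thesis .
    next
      case False
      then obtain k where k: "n = m + k" by (metis le_Suc_ex not_less)
      have "norm (cocycle n \<omega> *v v) \<le> K * exp (\<beta> * real k)"
        using K(2)[of k] by (simp add: k cocycle_add matrix_vector_mul_assoc)
      also have "\<dots> = K * exp (- \<beta> * real m) * exp (\<beta> * real n)"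
        by (simp add: k algebra_simps flip: exp_add)
      also have "\<dots> \<le> (K * exp (- \<beta> * real m) + D) * exp (\<beta> * real n)"
        using D0 by (intro mult_right_mono) auto
      finally show ?thesis .
    qed
  qed
qed

lemma slow_subspace_bound:
  fixes E :: "(real^'n) set"
  assumes E: "subspace E" and slow: "E \<subseteq> slow_vectors \<beta> \<omega>"
  shows "\<exists>K\<ge>0. \<forall>n. \<forall>v\<in>E. norm (cocycle n \<omega> *v v) \<le> K * exp (\<beta> * real n) * norm v"
proof -
  obtain B where B: "B \<subseteq> E" "pairwise orthogonal B" "\<And>x. x \<in> B \<Longrightarrow> norm x = 1" "independent B" "span B = E"
    by (rule orthonormal_basis_subspace[OF E]) auto
  have fin: "finite B" using B(4) by (rule independent_imp_finite)
  have "\<exists>K. 0 \<le> K \<and> (\<forall>n. norm (cocycle n \<omega> *v b) \<le> K * exp (\<beta> * real n))" if "b \<in> B" for b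
    using that B(1) slow by (metis slow_vectorsE subsetD)
  then obtain K where K: "\<And>b. b \<in> B \<Longrightarrow> 0 \<le> K b" "\<And>b n. b \<in> B \<Longrightarrow> norm (cocycle n \<omega> *v b) \<le> K b * exp (\<beta> * real n)"
    by metis
  have "norm (cocycle n \<omega> *v v) \<le> sum K B * exp (\<beta> * real n) * norm v" if v: "v \<in> E" for n v
  proof -
    have "(\<Sum>b\<in>B. (v \<bullet> b) *\<^sub>R b) = v"
      using B v fin by (intro orthonormal_basis_expand) auto
    then have "cocycle n \<omega> *v v = cocycle n \<omega> *v (\<Sum>b\<in>B. (v \<bullet> b) *\<^sub>R b)" by simp
    also have "\<dots> = (\<Sum>b\<in>B. (v \<bullet> b) *\<^sub>R (cocycle n \<omega> *v b))"
      by (simp add: linear_sum[OF matrix_vector_mul_linear] matrix_vector_mult_scaleR)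
    also have "norm \<dots> \<le> (\<Sum>b\<in>B. norm v * (K b * exp (\<beta> * real n)))"
    proof (rule sum_norm_le)
      fix b assume b: "b \<in> B"
      have "\<bar>v \<bullet> b\<bar> \<le> norm v" using Cauchy_Schwarz_ineq2[of v b] B(3)[OF b] by simp
      then show "norm ((v \<bullet> b) *\<^sub>R (cocycle n \<omega> *v b)) \<le> norm v * (K b * exp (\<beta> * real n))"
        using K(2)[OF b, of n] by (simp add: mult_mono)
    qed
    also have "\<dots> = sum K B * exp (\<beta> * real n) * norm v"
      by (simp add: sum_distrib_left sum_distrib_right mult_ac)
    finally show ?thesis .
  qed
  moreover have "0 \<le> sum K B" using K(1) by (rule sum_nonneg)
  ultimately show ?thesis by blast
qed

context moment_walk
begin

lemma slow_vectors_measurable [measurable]: "Measurable.pred S (\<lambda>\<omega>. v \<in> slow_vectors \<beta> \<omega>)"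
  unfolding slow_vectors_def mem_Collect_eq by measurable

lemma AE_M_iff_AE_first:
  assumes [measurable]: "Measurable.pred borel Q"
  shows "(AE g in M. Q g) \<longleftrightarrow> (AE \<omega> in S. Q (\<omega> 0))"
proof -
  have "(AE g in M. Q g) \<longleftrightarrow> (AE g in distr S M (\<lambda>\<omega>. \<omega> 0). Q g)" by (subst PiM_component[of 0]) auto
  also have "\<dots> \<longleftrightarrow> (AE \<omega> in S. Q (\<omega> 0))"
  proof (rule AE_distr_iff)
    show "(\<lambda>\<omega>. \<omega> 0) \<in> measurable S M" by (rule measurable_component_singleton) simp
    have "{g \<in> space borel. Q g} \<in> sets borel" by (rule predE[OF assms])
    then show "{g \<in> space M. Q g} \<in> sets M" by (simp add: space_M sets_M)
  qed
  finally show ?thesis .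
qed

lemma slow_vectors_invariant:
  assumes "AE \<omega> in S. v \<in> slow_vectors \<beta> \<omega>"
  shows "AE \<omega> in S. AE \<omega>' in S. cocycle m \<omega> *v v \<in> slow_vectors \<beta> \<omega>'"
proof -
  have "AE \<omega> in S. AE \<omega>' in S. v \<in> slow_vectors \<beta> (comb_seq m \<omega> \<omega>')"
    using assms by (subst AE_split[symmetric]) auto
  then show ?thesis
    by (simp add: slow_vectors_shift[of v \<beta> "comb_seq m _ _" m] cocycle_comb_seq shift_pow_comb_seq)
qed

text \<open>
  The almost surely slow vectors form a subspace \<open>E\<close> that almost every matrix maps into itself. On \<open>E\<close> the
  products grow at a rate of at most \<open>\<beta> < L\<close>. This contradicts quasi-irreducibility if \<open>E\<close> is proper and
  nonzero, and the growth rate of the norm if \<open>E\<close> is the whole space.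
\<close>

lemma no_slow_vector:
  assumes qi: "quasi_irreducible M" and L: "lyapunov1 M = ereal L" "has_growth_rate M opnorm (ereal L)"
    and \<beta>: "\<beta> < L" and v: "v \<noteq> 0"
  shows "\<not> (AE \<omega> in S. v \<in> slow_vectors \<beta> \<omega>)"
proof
  assume slow: "AE \<omega> in S. v \<in> slow_vectors \<beta> \<omega>"
  define E where "E = {w. AE \<omega> in S. w \<in> slow_vectors \<beta> \<omega>}"
  have vE: "v \<in> E" using slow by (simp add: E_def)
  have E: "subspace E"
  proof (rule subspaceI)
    show "0 \<in> E" by (simp add: E_def subspace_0[OF subspace_slow_vectors])
  next
    fix x y assume "x \<in> E" "y \<in> E"
    then have "AE \<omega> in S. x \<in> slow_vectors \<beta> \<omega>" "AE \<omega> in S. y \<in> slow_vectors \<beta> \<omega>" by (auto simp: E_def)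
    then have "AE \<omega> in S. x + y \<in> slow_vectors \<beta> \<omega>"
      by eventually_elim (rule subspace_add[OF subspace_slow_vectors])
    then show "x + y \<in> E" by (simp add: E_def)
  next
    fix c x assume "x \<in> E"
    then have "AE \<omega> in S. x \<in> slow_vectors \<beta> \<omega>" by (auto simp: E_def)
    then have "AE \<omega> in S. c *\<^sub>R x \<in> slow_vectors \<beta> \<omega>"
      by eventually_elim (rule subspace_scale[OF subspace_slow_vectors])
    then show "c *\<^sub>R x \<in> E" by (simp add: E_def)
  qed
  have [measurable]: "E \<in> sets borel" using closed_subspace[OF E] by (rule borel_closed)
  obtain B where B: "B \<subseteq> E" "independent B" "span B = E"
    using basis_exists[of E] span_minimal[OF _ E] by (metis subset_antisym)
  have fin: "finite B" using B(2) by (rule independent_imp_finite)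
  have "AE g in M. \<forall>b\<in>B. g *v b \<in> E"
  proof (rule AE_finite_allI[OF fin])
    fix b assume "b \<in> B"
    then have "AE \<omega> in S. b \<in> slow_vectors \<beta> \<omega>" using B(1) by (auto simp: E_def)
    from slow_vectors_invariant[OF this, of "Suc 0"]
    have "AE \<omega> in S. \<omega> 0 *v b \<in> E" by (simp add: E_def)
    then show "AE g in M. g *v b \<in> E" by (subst AE_M_iff_AE_first) auto
  qed
  then have inv: "AE g in M. (*v) g ` E \<subseteq> E"
  proof eventually_elim
    case (elim g)
    have "(*v) g ` span B = span ((*v) g ` B)"
      by (rule linear_span_image[symmetric]) (rule matrix_vector_mul_linear)
    also have "\<dots> \<subseteq> E" using elim by (intro span_minimal E) auto
    finally show ?case using B(3) by simp
  qed
  have "AE \<omega> in S. \<forall>b\<in>B. b \<in> slow_vectors \<beta> \<omega>"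
    using B(1) by (intro AE_finite_allI[OF fin]) (auto simp: E_def)
  then have bound: "AE \<omega> in S. \<exists>K\<ge>0. \<forall>n. \<forall>w\<in>E. norm (cocycle n \<omega> *v w) \<le> K * exp (\<beta> * real n) * norm w"
  proof eventually_elim
    case (elim \<omega>)
    have "span B \<subseteq> slow_vectors \<beta> \<omega>" using elim by (intro span_minimal subspace_slow_vectors) auto
    then show ?case using slow_subspace_bound[OF E] B(3) by simp
  qed
  have "L \<le> \<beta>"
  proof (cases "E = UNIV")
    case True
    show ?thesis
    proof (rule growth_rate_le[OF prob_space_M L(2) opnorm_nonneg], use bound in eventually_elim)
      case (elim \<omega>)
      then obtain K where K: "0 \<le> K" "\<And>n w. norm (cocycle n \<omega> *v w) \<le> K * exp (\<beta> * real n) * norm w"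
        using True by auto
      have "opnorm (cocycle n \<omega>) \<le> K * exp (\<beta> * real n)" for n
      proof (rule opnorm_le)
        fix w :: "real^'n" assume "norm w = 1"
        then show "norm (cocycle n \<omega> *v w) \<le> K * exp (\<beta> * real n)" using K(2)[of n w] by simp
      qed (use K in simp)
      then show ?case by blast
    qed
  next
    case False
    have unit: "(1 / norm v) *\<^sub>R v \<in> {w \<in> E. norm w = 1}" using vE v E by (auto intro: subspace_scale)
    have g: "has_growth_rate M (opnorm_on E) (ereal L)"
      using qi E False inv vE v L(1) unfolding quasi_irreducible_def by auto
    show ?thesis
    proof (rule growth_rate_le[OF prob_space_M g])
      fix g :: "real^'n^'n"
      have "bdd_above ((\<lambda>w. norm (g *v w)) ` {w \<in> E. norm w = 1})"
        by (rule bdd_aboveI2[of _ _ "opnorm g"]) (use norm_matrix_vector_le[of g] in \<open>metis (lifting) mem_Collect_eq mult.right_neutral\<close>)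
      from cSUP_upper[OF unit this] show "0 \<le> opnorm_on E g"
        unfolding opnorm_on_def by (meson norm_ge_zero order_trans)
    next
      show "AE \<omega> in S. \<exists>K. \<forall>n. opnorm_on E (cocycle n \<omega>) \<le> K * exp (\<beta> * real n)"
        using bound
      proof eventually_elim
        case (elim \<omega>)
        then obtain K where K: "0 \<le> K" "\<And>n w. w \<in> E \<Longrightarrow> norm (cocycle n \<omega> *v w) \<le> K * exp (\<beta> * real n) * norm w"
          by auto
        have "opnorm_on E (cocycle n \<omega>) \<le> K * exp (\<beta> * real n)" for n
          unfolding opnorm_on_def
        proof (rule cSUP_least)
          show "{w \<in> E. norm w = 1} \<noteq> {}" using unit by blast
          fix w assume "w \<in> {w \<in> E. norm w = 1}"
          then show "norm (cocycle n \<omega> *v w) \<le> K * exp (\<beta> * real n)" using K(2)[of w n] by simp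
        qed
        then show ?case by blast
      qed
    qed
  qed
  with \<beta> show False by simp
qed

definition slow_prob :: "real \<Rightarrow> real^'n \<Rightarrow> real" where
  "slow_prob \<beta> v = P.prob {\<omega> \<in> space S. v \<in> slow_vectors \<beta> \<omega>}"

text \<open>
  The probability of being slow is upper semicontinuous on the sphere, because the slow vectors of a given
  sequence form a closed set. If it came arbitrarily close to one, it would be equal to one at a
  limit point.
\<close>

lemma slow_prob_bounded:
  assumes no: "\<And>v. v \<noteq> 0 \<Longrightarrow> \<not> (AE \<omega> in S. v \<in> slow_vectors \<beta> \<omega>)"
  shows "\<exists>q<1. \<forall>v. v \<noteq> 0 \<longrightarrow> slow_prob \<beta> v \<le> q"
proof (rule ccontr)
  assume neg: "\<not> ?thesis"
  have "\<exists>v. norm v = 1 \<and> 1 - 1 / real (Suc i) < slow_prob \<beta> v" for i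
  proof -
    have "\<not> (\<forall>v. v \<noteq> 0 \<longrightarrow> slow_prob \<beta> v \<le> 1 - 1 / real (Suc i))" using neg by (metis (no_types) diff_less_eq less_add_same_cancel1 of_nat_0_less_iff zero_less_Suc zero_less_divide_1_iff)
    then obtain v where v: "v \<noteq> 0" "1 - 1 / real (Suc i) < slow_prob \<beta> v" by (auto simp: not_le)
    let ?u = "(1 / norm v) *\<^sub>R v"
    have "?u \<in> slow_vectors \<beta> \<omega> \<longleftrightarrow> v \<in> slow_vectors \<beta> \<omega>" for \<omega>
      using v(1) subspace_scale[OF subspace_slow_vectors, of v \<beta> \<omega> "1 / norm v"]
        subspace_scale[OF subspace_slow_vectors, of ?u \<beta> \<omega> "norm v"] by auto
    then have "slow_prob \<beta> ?u = slow_prob \<beta> v" by (simp add: slow_prob_def)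
    then show ?thesis using v by (intro exI[of _ ?u]) auto
  qed
  then obtain u where u: "\<And>i. norm (u i) = 1" "\<And>i. 1 - 1 / real (Suc i) < slow_prob \<beta> (u i)" by metis
  have "compact (sphere (0 :: real^'n) 1)" by simp
  then obtain v s where v: "v \<in> sphere 0 1" "strict_mono (s :: nat \<Rightarrow> nat)" "(u \<circ> s) \<longlonglongrightarrow> v"
    using u(1) unfolding compact_def by (metis mem_sphere_0)
  \<comment> \<open>Almost surely, infinitely many members of the convergent subsequence are slow.\<close>
  let ?A = "\<lambda>i. {\<omega> \<in> space S. u (s i) \<in> slow_vectors \<beta> \<omega>}"
  let ?F = "{\<omega> \<in> space S. \<forall>m. \<exists>i\<ge>m. \<omega> \<in> ?A i}"
  have ge: "1 - 1 / real (Suc k) \<le> P.prob ?F" for k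
  proof (rule P.prob_infinitely_often_ge[where N=k])
    fix i assume "k \<le> i"
    then have "real (Suc k) \<le> real (Suc (s i))" using seq_suble[OF v(2), of i] by simp
    then have "1 - 1 / real (Suc k) \<le> 1 - 1 / real (Suc (s i))" by (simp add: frac_le)
    also have "\<dots> \<le> slow_prob \<beta> (u (s i))" using u(2)[of "s i"] by simp
    finally show "1 - 1 / real (Suc k) \<le> P.prob (?A i)" by (simp add: slow_prob_def)
  qed auto
  have "1 \<le> P.prob ?F"
  proof (rule LIMSEQ_le_const2)
    have "(\<lambda>k. 1 - 1 / real (Suc k)) \<longlonglongrightarrow> 1 - 0"
      by (intro tendsto_diff tendsto_const LIMSEQ_Suc lim_const_over_n)
    then show "(\<lambda>k. 1 - 1 / real (Suc k)) \<longlonglongrightarrow> 1" by simp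
  qed (use ge in blast)
  then have "P.prob ?F = 1" using P.prob_le_1[of ?F] by linarith
  then have "AE \<omega> in S. \<omega> \<in> ?F" by (intro P.AE_in_set_eq_1[THEN iffD2]) measurable
  then have "AE \<omega> in S. v \<in> slow_vectors \<beta> \<omega>"
  proof eventually_elim
    case (elim \<omega>)
    show ?case
    proof (rule ccontr)
      assume "v \<notin> slow_vectors \<beta> \<omega>"
      moreover have "open (- slow_vectors \<beta> \<omega>)" using closed_subspace[OF subspace_slow_vectors] by auto
      ultimately have "\<forall>\<^sub>F i in sequentially. (u \<circ> s) i \<in> - slow_vectors \<beta> \<omega>"
        by (intro topological_tendstoD[OF v(3)]) auto
      then show False using elim by (auto simp: eventually_sequentially)
    qed
  qed
  moreover have "v \<noteq> 0" using v(1) by auto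
  ultimately show False using no by blast
qed

text \<open>
  Given the first \<open>K\<close> matrices, \<open>v\<close> is slow exactly if its image is slow for the shifted sequence, which has
  probability at most \<open>q < 1\<close>. So the event is null by \<open>prob_le_of_cylinders\<close>.
\<close>

lemma slow_prob_zero:
  assumes no: "\<And>v. v \<noteq> 0 \<Longrightarrow> \<not> (AE \<omega> in S. v \<in> slow_vectors \<beta> \<omega>)" and v: "v \<noteq> 0"
  shows "AE \<omega> in S. v \<notin> slow_vectors \<beta> \<omega>"
proof -
  obtain q where q: "q < 1" "\<And>v. v \<noteq> 0 \<Longrightarrow> slow_prob \<beta> v \<le> q" using slow_prob_bounded[OF no] by blast
  have "0 \<le> slow_prob \<beta> v" by (simp add: slow_prob_def measure_nonneg)
  then have q0: "0 \<le> q" using q(2)[OF v] by linarith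
  let ?A = "{\<omega> \<in> space S. v \<in> slow_vectors \<beta> \<omega>}"
  have "P.prob ?A \<le> q * P.prob ?A"
  proof (rule prob_le_of_cylinders)
    show "?A \<in> sets S" by measurable
    fix K D assume D: "cylinder K D"
    then have D' [measurable]: "D \<in> sets S" by (simp add: cylinder_def)
    have "emeasure S (?A \<inter> D) = (\<integral>\<^sup>+\<omega>. indicator (?A \<inter> D) \<omega> \<partial>S)" by simp
    also have "\<dots> = (\<integral>\<^sup>+\<omega>. \<integral>\<^sup>+\<omega>'. indicator (?A \<inter> D) (comb_seq K \<omega> \<omega>') \<partial>S \<partial>S)"
      by (rule nn_integral_split) auto
    also have "\<dots> = (\<integral>\<^sup>+\<omega>. \<integral>\<^sup>+\<omega>'. indicator D \<omega> * indicator {\<omega>' \<in> space S. cocycle K \<omega> *v v \<in> slow_vectors \<beta> \<omega>'} \<omega>' \<partial>S \<partial>S)"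
      using cylinder_comb_seq[OF D] by (intro nn_integral_cong)
        (auto simp: indicator_def slow_vectors_shift[of v \<beta> "comb_seq K _ _" K] cocycle_comb_seq shift_pow_comb_seq space_S)
    also have "\<dots> = (\<integral>\<^sup>+\<omega>. indicator D \<omega> * emeasure S {\<omega>' \<in> space S. cocycle K \<omega> *v v \<in> slow_vectors \<beta> \<omega>'} \<partial>S)"
      by (simp add: nn_integral_cmult)
    also have "\<dots> \<le> (\<integral>\<^sup>+\<omega>. ennreal q * indicator D \<omega> \<partial>S)"
    proof (rule nn_integral_mono_AE, use AE_cocycle_nonzero[OF v, of K] in eventually_elim)
      case (elim \<omega>)
      have "emeasure S {\<omega>' \<in> space S. cocycle K \<omega> *v v \<in> slow_vectors \<beta> \<omega>'} \<le> ennreal q"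
        using q(2)[OF elim] by (simp add: P.emeasure_eq_measure slow_prob_def ennreal_leI)
      then show ?case by (subst mult.commute) (rule mult_right_mono, auto)
    qed
    also have "\<dots> = ennreal q * emeasure S D" by (simp add: nn_integral_cmult)
    finally show "P.prob (?A \<inter> D) \<le> q * P.prob D"
      using q0 by (simp add: P.emeasure_eq_measure flip: ennreal_mult)
  qed (rule q0)
  then have "(1 - q) * P.prob ?A \<le> 0" by (simp add: algebra_simps)
  then have "P.prob ?A = 0" using q(1) measure_nonneg[of S ?A] by (auto simp: mult_le_0_iff)
  then show ?thesis by (subst (asm) P.prob_eq_0) auto
qed

definition stay_slow :: "real \<Rightarrow> nat \<Rightarrow> real^'n \<Rightarrow> (nat \<Rightarrow> real^'n^'n) set" where
  "stay_slow \<beta> N v = {\<omega> \<in> space S. \<forall>n\<in>{1..N}. norm (cocycle n \<omega> *v v) \<le> exp (\<beta> * real n) * norm v}"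

lemma stay_slow_measurable [measurable]: "stay_slow \<beta> N v \<in> sets S"
  unfolding stay_slow_def by measurable

text \<open>
  Dini's theorem in probabilistic form: the probabilities decrease to zero in \<open>N\<close> for each \<open>v\<close>, and a limit
  of vectors that stay slow for longer and longer times would be slow with positive probability.
\<close>

lemma stay_slow_uniform:
  assumes fast: "\<And>v. v \<noteq> 0 \<Longrightarrow> AE \<omega> in S. v \<notin> slow_vectors \<beta> \<omega>" and e: "0 < e"
  shows "\<exists>N. \<forall>v. norm v = 1 \<longrightarrow> P.prob (stay_slow \<beta> N v) \<le> e"
proof (rule ccontr)
  assume "\<not> ?thesis"
  then obtain u where u: "\<And>N. norm (u N) = 1" "\<And>N. e < P.prob (stay_slow \<beta> N (u N))"
    by (metis not_le)
  have "compact (sphere (0 :: real^'n) 1)" by simp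
  then obtain v s where v: "v \<in> sphere 0 1" "strict_mono (s :: nat \<Rightarrow> nat)" "(u \<circ> s) \<longlonglongrightarrow> v"
    using u(1) unfolding compact_def by (metis mem_sphere_0)
  let ?A = "\<lambda>i. stay_slow \<beta> (s i) (u (s i))"
  let ?F = "{\<omega> \<in> space S. \<forall>m. \<exists>i\<ge>m. \<omega> \<in> ?A i}"
  have "e \<le> P.prob ?F"
    using u(2) by (intro P.prob_infinitely_often_ge[where N=0]) (auto intro: less_imp_le)
  have "v \<noteq> 0" using v(1) by auto
  from fast[OF this] have "AE \<omega> in S. \<omega> \<notin> ?F"
  proof eventually_elim
    case (elim \<omega>)
    show ?case
    proof
      assume F: "\<omega> \<in> ?F"
      have "norm (cocycle n \<omega> *v v) \<le> 1 * exp (\<beta> * real n)" for n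
      proof (cases "n = 0")
        case True then show ?thesis using v(1) by simp
      next
        case False
        show ?thesis
        proof (rule ccontr)
          assume "\<not> ?thesis"
          then have gt: "exp (\<beta> * real n) < norm (cocycle n \<omega> *v v)" by simp
          have "(\<lambda>i. norm (cocycle n \<omega> *v (u \<circ> s) i)) \<longlonglongrightarrow> norm (cocycle n \<omega> *v v)"
            by (intro tendsto_norm bounded_linear.tendsto[OF matrix_vector_mul_bounded_linear] v(3))
          then have "\<forall>\<^sub>F i in sequentially. exp (\<beta> * real n) < norm (cocycle n \<omega> *v (u \<circ> s) i)"
            using gt by (rule order_tendstoD)
          then obtain m where m: "\<And>i. m \<le> i \<Longrightarrow> exp (\<beta> * real n) < norm (cocycle n \<omega> *v u (s i))"
            by (auto simp: eventually_sequentially)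
          obtain i where i: "max m n \<le> i" "\<omega> \<in> ?A i" using F by blast
          then have "n \<in> {1..s i}" using False seq_suble[OF v(2), of i] by auto
          then have "norm (cocycle n \<omega> *v u (s i)) \<le> exp (\<beta> * real n)"
            using i(2) u(1)[of "s i"] unfolding stay_slow_def by auto
          then show False using m[of i] i(1) by simp
        qed
      qed
      then show False using elim slow_vectorsI by blast
    qed
  qed
  then have "P.prob ?F = 0" by (subst P.prob_eq_0) auto
  with \<open>e \<le> P.prob ?F\<close> e show False by simp
qed


text \<open>
  The second moment of a step makes the mean of a step over a rare event small.
\<close>

lemma step_log_square_bound:
  "\<exists>b>0. \<forall>u. norm u = 1 \<longrightarrow> (\<integral>\<^sup>+\<omega>. ennreal ((\<bar>ln (norm (cocycle (Suc 0) \<omega> *v u))\<bar> + \<bar>\<beta>\<bar>)\<^sup>2) \<partial>S) \<le> ennreal b"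
proof -
  define b where "b = 16 / p\<^sup>2 * (2 * C) + 2 * \<beta>\<^sup>2"
  have b0: "0 < b" using p C by (auto simp: b_def intro!: add_pos_nonneg mult_pos_pos divide_pos_pos)
  have "(\<integral>\<^sup>+\<omega>. ennreal ((\<bar>ln (norm (cocycle (Suc 0) \<omega> *v u))\<bar> + \<bar>\<beta>\<bar>)\<^sup>2) \<partial>S) \<le> ennreal b" if u: "norm u = 1" for u :: "real^'n"
  proof -
  from u have u0: "u \<noteq> 0" by auto
  let ?U = "\<lambda>\<omega>. opnorm (cocycle (Suc 0) \<omega>) powr p" and ?L = "\<lambda>\<omega>. norm (cocycle (Suc 0) \<omega> *v u) powr (- p)"
  have "(\<integral>\<^sup>+\<omega>. ennreal ((\<bar>ln (norm (cocycle (Suc 0) \<omega> *v u))\<bar> + \<bar>\<beta>\<bar>)\<^sup>2) \<partial>S) \<le>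
      (\<integral>\<^sup>+\<omega>. ennreal (16 / p\<^sup>2) * ennreal (?U \<omega>) + ennreal (16 / p\<^sup>2) * ennreal (?L \<omega>) + ennreal (2 * \<beta>\<^sup>2) \<partial>S)"
  proof (rule nn_integral_mono_AE, use AE_cocycle_nonzero[OF u0, of "Suc 0"] in eventually_elim)
    case (elim \<omega>)
    define x where "x = norm (cocycle (Suc 0) \<omega> *v u)"
    have x: "0 < x" "x \<le> opnorm (cocycle (Suc 0) \<omega>)"
      using elim norm_matrix_vector_le[of "cocycle (Suc 0) \<omega>" u] u by (auto simp: x_def)
    let ?q = "x powr (p / 2)" and ?r = "x powr (- (p / 2))"
    have "\<bar>ln x\<bar> \<le> (?q + ?r) / (p / 2)" using x p by (intro abs_ln_le) auto
    then have "(\<bar>ln x\<bar>)\<^sup>2 \<le> ((?q + ?r) / (p / 2))\<^sup>2" by (intro power_mono) auto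
    also have "\<dots> = 4 / p\<^sup>2 * (?q + ?r)\<^sup>2"
    proof -
      have "(y / (p / 2))\<^sup>2 = 4 / p\<^sup>2 * y\<^sup>2" for y by (simp add: power2_eq_square)
      then show ?thesis .
    qed
    also have "\<dots> \<le> 4 / p\<^sup>2 * (2 * (?q\<^sup>2 + ?r\<^sup>2))"
      using sum_squares_bound[of ?q ?r] by (intro mult_left_mono) (auto simp: power2_sum)
    also have "?q\<^sup>2 = x powr p" using x by (simp add: power2_eq_square flip: powr_add)
    also have "?r\<^sup>2 = x powr (- p)" using x by (simp add: power2_eq_square flip: powr_add)
    finally have sq: "(\<bar>ln x\<bar>)\<^sup>2 \<le> 8 / p\<^sup>2 * (x powr p + x powr (- p))" by simp
    have "(\<bar>ln x\<bar> + \<bar>\<beta>\<bar>)\<^sup>2 \<le> 2 * (\<bar>ln x\<bar>)\<^sup>2 + 2 * \<beta>\<^sup>2"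
      using sum_squares_bound[of "\<bar>ln x\<bar>" "\<bar>\<beta>\<bar>"] by (simp add: power2_sum)
    also have "\<dots> \<le> 2 * (8 / p\<^sup>2 * (x powr p + x powr (- p))) + 2 * \<beta>\<^sup>2"
      using sq by (intro add_right_mono mult_left_mono) auto
    also have "\<dots> = 16 / p\<^sup>2 * x powr p + 16 / p\<^sup>2 * x powr (- p) + 2 * \<beta>\<^sup>2"
      by (simp add: algebra_simps add_divide_distrib)
    also have "\<dots> \<le> 16 / p\<^sup>2 * ?U \<omega> + 16 / p\<^sup>2 * ?L \<omega> + 2 * \<beta>\<^sup>2"
    proof -
      have "x powr p \<le> ?U \<omega>" using x p by (intro powr_mono2) auto
      then show ?thesis by (simp add: x_def mult_left_mono divide_right_mono)
    qed
    finally have "(\<bar>ln x\<bar> + \<bar>\<beta>\<bar>)\<^sup>2 \<le> 16 / p\<^sup>2 * ?U \<omega> + 16 / p\<^sup>2 * ?L \<omega> + 2 * \<beta>\<^sup>2" .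
    then show ?case using p by (simp add: x_def ennreal_leI flip: ennreal_mult ennreal_plus)
  qed
  also have "\<dots> = ennreal (16 / p\<^sup>2) * (\<integral>\<^sup>+\<omega>. ennreal (?U \<omega>) \<partial>S) + ennreal (16 / p\<^sup>2) * (\<integral>\<^sup>+\<omega>. ennreal (?L \<omega>) \<partial>S) + ennreal (2 * \<beta>\<^sup>2)"
    by (simp add: nn_integral_cmult nn_integral_add P.emeasure_space_1)
  also have "\<dots> \<le> ennreal (16 / p\<^sup>2) * ennreal C + ennreal (16 / p\<^sup>2) * ennreal C + ennreal (2 * \<beta>\<^sup>2)"
    using moment_upper[of "Suc 0"] moment_lower[OF u0, of "Suc 0"] u by (intro add_mono mult_left_mono) auto
  also have "\<dots> = ennreal b" using p C by (simp add: b_def flip: ennreal_mult ennreal_plus)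
  finally show "(\<integral>\<^sup>+\<omega>. ennreal ((\<bar>ln (norm (cocycle (Suc 0) \<omega> *v u))\<bar> + \<bar>\<beta>\<bar>)\<^sup>2) \<partial>S) \<le> ennreal b" .
  qed
  with b0 show ?thesis by blast
qed

definition step_log :: "real \<Rightarrow> real^'n \<Rightarrow> (nat \<Rightarrow> real^'n^'n) \<Rightarrow> real" where
  "step_log \<beta> v \<omega> = \<bar>ln (norm (cocycle (Suc 0) \<omega> *v v)) - ln (norm v)\<bar> + \<bar>\<beta>\<bar>"

text \<open>
  Write \<open>x\<^sub>k\<close> for the image of \<open>v\<close> at time \<open>k\<close> and apply \<open>covering_bound\<close> to the amount by which the logarithmic
  growth of the vector between the times \<open>k\<close> and \<open>k + l\<close> falls short of \<open>\<beta> * l\<close>. A time \<open>k\<close> is bad if \<open>x\<^sub>k\<close> stays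
  slow for \<open>N\<close> steps; uniformly in the direction of \<open>x\<^sub>k\<close>, this is a rare event with a small mean cost.
\<close>

lemma uniform_growth:
  assumes fast: "\<And>v. v \<noteq> 0 \<Longrightarrow> AE \<omega> in S. v \<notin> slow_vectors \<beta> \<omega>" and \<gamma>: "\<gamma> < \<beta>"
  shows "\<exists>n0. \<forall>n\<ge>n0. \<forall>v. norm v = 1 \<longrightarrow> \<gamma> * real n \<le> (\<integral>\<omega>. ln (norm (cocycle n \<omega> *v v)) \<partial>S)"
proof -
  obtain b where b: "0 < b"
    "\<And>u. norm u = 1 \<Longrightarrow> (\<integral>\<^sup>+\<omega>. ennreal ((\<bar>ln (norm (cocycle (Suc 0) \<omega> *v u))\<bar> + \<bar>\<beta>\<bar>)\<^sup>2) \<partial>S) \<le> ennreal b"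
    using step_log_square_bound[of \<beta>] by blast
  define e where "e = (\<beta> - \<gamma>) / 2"
  have e: "0 < e" using \<gamma> by (simp add: e_def)
  \<comment> \<open>The weight in \<open>x \<le> s / 2 * x\<^sup>2 + 1 / (2 * s)\<close>: with a second moment of at most \<open>b\<close>, the first term
    contributes \<open>e / 2\<close>, and on an event of probability at most \<open>s * e\<close> so does the second.\<close>
  define s where "s = e / b"
  have s: "0 < s" using e b by (simp add: s_def)
  obtain N where N: "\<And>u. norm u = 1 \<Longrightarrow> P.prob (stay_slow \<beta> N u) \<le> s * e"
    using stay_slow_uniform[OF fast, of "s * e"] s e by auto
  define g where "g v \<omega> = (if \<omega> \<in> stay_slow \<beta> N v then step_log \<beta> v \<omega> else 0)" for v \<omega>
  have scale: "step_log \<beta> (c *\<^sub>R v) \<omega> = step_log \<beta> v \<omega>" if "0 < c" "cocycle (Suc 0) \<omega> *v v \<noteq> 0" "v \<noteq> 0" for c v \<omega>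
    using that by (simp add: step_log_def matrix_vector_mult_scaleR ln_mult_pos)
  have scale': "\<omega> \<in> stay_slow \<beta> N (c *\<^sub>R v) \<longleftrightarrow> \<omega> \<in> stay_slow \<beta> N v" if "0 < c" for c v \<omega>
    using that by (simp add: stay_slow_def matrix_vector_mult_scaleR mult.left_commute[of _ c])
  have unit: "(\<integral>\<^sup>+\<omega>. ennreal (step_log \<beta> v \<omega>) \<partial>S) \<le> ennreal ((1 + b) / 2)"
      "(\<integral>\<^sup>+\<omega>. ennreal (g v \<omega>) \<partial>S) \<le> ennreal e" if v: "norm v = 1" for v
  proof -
    let ?h = "\<lambda>\<omega>. ennreal ((\<bar>ln (norm (cocycle (Suc 0) \<omega> *v v))\<bar> + \<bar>\<beta>\<bar>)\<^sup>2)"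
    have "(\<integral>\<^sup>+\<omega>. ennreal (step_log \<beta> v \<omega>) \<partial>S) \<le> (\<integral>\<^sup>+\<omega>. ennreal (1 / 2) + ennreal (1 / 2) * ?h \<omega> \<partial>S)"
    proof (rule nn_integral_mono)
      fix \<omega>
      have "step_log \<beta> v \<omega> \<le> 1 / 2 + 1 / 2 * (step_log \<beta> v \<omega>)\<^sup>2"
        using sum_squares_bound[of 1 "step_log \<beta> v \<omega>"] by simp
      then have "ennreal (step_log \<beta> v \<omega>) \<le> ennreal (1 / 2 + 1 / 2 * (step_log \<beta> v \<omega>)\<^sup>2)"
        by (rule ennreal_leI)
      also have "\<dots> = ennreal (1 / 2) + ennreal (1 / 2) * ennreal ((step_log \<beta> v \<omega>)\<^sup>2)"
        by (rule ennreal_affine) auto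
      also have "(step_log \<beta> v \<omega>)\<^sup>2 = (\<bar>ln (norm (cocycle (Suc 0) \<omega> *v v))\<bar> + \<bar>\<beta>\<bar>)\<^sup>2"
        using v by (simp add: step_log_def)
      finally show "ennreal (step_log \<beta> v \<omega>) \<le> ennreal (1 / 2) + ennreal (1 / 2) * ?h \<omega>" .
    qed
    also have "\<dots> = ennreal (1 / 2) + ennreal (1 / 2) * (\<integral>\<^sup>+\<omega>. ?h \<omega> \<partial>S)"
      by (simp add: nn_integral_add nn_integral_cmult P.emeasure_space_1)
    also have "\<dots> \<le> ennreal (1 / 2) + ennreal (1 / 2) * ennreal b"
      by (intro add_left_mono mult_left_mono b v) simp
    also have "\<dots> = ennreal ((1 + b) / 2)" 
      using b(1) by (subst ennreal_affine[symmetric]) (auto simp: add_divide_distrib)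
    finally show "(\<integral>\<^sup>+\<omega>. ennreal (step_log \<beta> v \<omega>) \<partial>S) \<le> ennreal ((1 + b) / 2)" .
    have "(\<integral>\<^sup>+\<omega>. ennreal (g v \<omega>) \<partial>S) \<le> (\<integral>\<^sup>+\<omega>. ennreal (s / 2) * ?h \<omega> + ennreal (1 / (2 * s)) * indicator (stay_slow \<beta> N v) \<omega> \<partial>S)"
    proof (rule nn_integral_mono)
      fix \<omega>
      let ?x = "step_log \<beta> v \<omega>"
      have "2 * (s * ?x) * 1 \<le> (s * ?x)\<^sup>2 + 1\<^sup>2" by (rule sum_squares_bound)
      then have "?x \<le> ((s * ?x)\<^sup>2 + 1) / (2 * s)" using s by (simp add: field_simps)
      also have "\<dots> = s / 2 * ?x\<^sup>2 + 1 / (2 * s)" using s by (simp add: field_simps power2_eq_square)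
      finally have "?x \<le> s / 2 * ?x\<^sup>2 + 1 / (2 * s)" .
      then show "ennreal (g v \<omega>) \<le> ennreal (s / 2) * ?h \<omega> + ennreal (1 / (2 * s)) * indicator (stay_slow \<beta> N v) \<omega>"
        using v s by (auto simp: g_def step_log_def indicator_def simp flip: ennreal_plus ennreal_mult intro!: ennreal_leI)
    qed
    also have "\<dots> = ennreal (s / 2) * (\<integral>\<^sup>+\<omega>. ?h \<omega> \<partial>S) + ennreal (1 / (2 * s)) * emeasure S (stay_slow \<beta> N v)"
      by (simp add: nn_integral_add nn_integral_cmult)
    also have "\<dots> \<le> ennreal (s / 2) * ennreal b + ennreal (1 / (2 * s)) * ennreal (s * e)"
      using N[OF v] b(2)[OF v] by (intro add_mono mult_left_mono) (auto simp: P.emeasure_eq_measure ennreal_leI)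
    also have "\<dots> = ennreal (s / 2 * b + 1 / (2 * s) * (s * e))" using s b e by (simp flip: ennreal_plus ennreal_mult)
    also have "s / 2 * b + 1 / (2 * s) * (s * e) = e" using s b by (simp add: s_def field_simps)
    finally show "(\<integral>\<^sup>+\<omega>. ennreal (g v \<omega>) \<partial>S) \<le> ennreal e" .
  qed
  have nonzero: "(\<integral>\<^sup>+\<omega>. ennreal (step_log \<beta> v \<omega>) \<partial>S) \<le> ennreal ((1 + b) / 2)"
      "(\<integral>\<^sup>+\<omega>. ennreal (g v \<omega>) \<partial>S) \<le> ennreal e" if v: "v \<noteq> 0" for v
  proof -
    let ?u = "(1 / norm v) *\<^sub>R v"
    have u: "norm ?u = 1" using v by simp
    have "(\<integral>\<^sup>+\<omega>. ennreal (step_log \<beta> v \<omega>) \<partial>S) = (\<integral>\<^sup>+\<omega>. ennreal (step_log \<beta> ?u \<omega>) \<partial>S)"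
      by (rule nn_integral_cong_AE, use AE_cocycle_nonzero[OF v, of "Suc 0"] in eventually_elim) (simp only: scale v zero_less_divide_iff zero_less_norm_iff simp_thms zero_less_one)
    then show "(\<integral>\<^sup>+\<omega>. ennreal (step_log \<beta> v \<omega>) \<partial>S) \<le> ennreal ((1 + b) / 2)" using unit(1)[OF u] by (simp only:)
    have "(\<integral>\<^sup>+\<omega>. ennreal (g v \<omega>) \<partial>S) = (\<integral>\<^sup>+\<omega>. ennreal (g ?u \<omega>) \<partial>S)"
      by (rule nn_integral_cong_AE, use AE_cocycle_nonzero[OF v, of "Suc 0"] in eventually_elim) (simp only: g_def scale scale' v zero_less_divide_iff zero_less_norm_iff simp_thms zero_less_one)
    then show "(\<integral>\<^sup>+\<omega>. ennreal (g v \<omega>) \<partial>S) \<le> ennreal e" using unit(2)[OF u] by (simp only:)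
  qed
  have main: "\<beta> * real n - (\<integral>\<omega>. ln (norm (cocycle n \<omega> *v v)) \<partial>S) \<le> real n * e + real N * ((1 + b) / 2)"
    if v: "norm v = 1" for n v
  proof -
    have v0: "v \<noteq> 0" using v by auto
    let ?x = "\<lambda>k \<omega>. cocycle k \<omega> *v v"
    let ?G = "\<lambda>k \<omega>. g (?x k \<omega>) ((shift ^^ k) \<omega>)" and ?H = "\<lambda>k \<omega>. step_log \<beta> (?x k \<omega>) ((shift ^^ k) \<omega>)"
    have step0: "0 \<le> step_log \<beta> u \<omega>" for u \<omega> by (simp add: step_log_def)
    have g0: "0 \<le> g u \<omega>" for u \<omega> by (simp add: g_def step0)
    have Hm [measurable]: "?H k \<in> borel_measurable S" for k unfolding step_log_def by measurable
    have cm: "(\<lambda>\<omega>. cocycle l ((shift ^^ k) \<omega>)) \<in> borel_measurable S" for k l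
      by (rule measurable_compose[OF shift_pow_measurable cocycle_measurable])
    have xm: "?x k \<in> borel_measurable S" "(\<lambda>\<omega>. norm (?x k \<omega>)) \<in> borel_measurable S" for k by measurable
    have [measurable]: "{\<omega> \<in> space S. (shift ^^ k) \<omega> \<in> stay_slow \<beta> N (?x k \<omega>)} \<in> sets S" for k
    proof -
      have "{\<omega> \<in> space S. \<forall>l\<in>{1..N}. norm (cocycle l ((shift ^^ k) \<omega>) *v ?x k \<omega>) \<le> exp (\<beta> * real l) * norm (?x k \<omega>)} \<in> sets S"
        by (intro sets.sets_Collect_finite_All borel_measurable_le borel_measurable_norm borel_measurable_times
            borel_measurable_const borel_measurable_matrix_vector_mult cm xm) simp_all
      then show ?thesis by (simp add: stay_slow_def space_S)
    qed
    have Gm [measurable]: "?G k \<in> borel_measurable S" for k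
      unfolding g_def by measurable
    have Hint: "(\<integral>\<^sup>+\<omega>. ennreal (?H k \<omega>) \<partial>S) \<le> ennreal ((1 + b) / 2)" for k
    proof -
      have "(\<integral>\<^sup>+\<omega>. ennreal (?H k \<omega>) \<partial>S) = (\<integral>\<^sup>+\<omega>. \<integral>\<^sup>+\<omega>'. ennreal (step_log \<beta> (?x k \<omega>) \<omega>') \<partial>S \<partial>S)"
        by (subst nn_integral_split[of _ k]) (simp_all add: cocycle_comb_seq shift_pow_comb_seq)
      also have "\<dots> \<le> (\<integral>\<^sup>+\<omega>. ennreal ((1 + b) / 2) \<partial>S)"
        by (rule nn_integral_mono_AE, use AE_cocycle_nonzero[OF v0, of k] in eventually_elim) (rule nonzero)
      finally show ?thesis by (simp add: P.emeasure_space_1)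
    qed
    have Gint: "(\<integral>\<^sup>+\<omega>. ennreal (?G k \<omega>) \<partial>S) \<le> ennreal e" for k
    proof -
      have "(\<integral>\<^sup>+\<omega>. ennreal (?G k \<omega>) \<partial>S) = (\<integral>\<^sup>+\<omega>. \<integral>\<^sup>+\<omega>'. ennreal (g (?x k \<omega>) \<omega>') \<partial>S \<partial>S)"
        by (subst nn_integral_split[of _ k]) (simp_all add: cocycle_comb_seq shift_pow_comb_seq)
      also have "\<dots> \<le> (\<integral>\<^sup>+\<omega>. ennreal e \<partial>S)"
        by (rule nn_integral_mono_AE, use AE_cocycle_nonzero[OF v0, of k] in eventually_elim) (rule nonzero)
      finally show ?thesis by (simp add: P.emeasure_space_1)
    qed
    have Hi: "integrable S (?H k)" and Hle: "(\<integral>\<omega>. ?H k \<omega> \<partial>S) \<le> (1 + b) / 2" for k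
    proof -
      show "integrable S (?H k)"
        by (rule nn_integral_finite_integrable[OF Hm]) (use step0 le_less_trans[OF Hint[of k] ennreal_less_top] in auto)
      have "\<bar>\<integral>\<omega>. ?H k \<omega> \<partial>S\<bar> \<le> (1 + b) / 2" by (rule integral_le_of_nn_integral[OF _ Hint]) (use b step0 in auto)
      then show "(\<integral>\<omega>. ?H k \<omega> \<partial>S) \<le> (1 + b) / 2" by simp
    qed
    have Gi: "integrable S (?G k)" and Gle: "(\<integral>\<omega>. ?G k \<omega> \<partial>S) \<le> e" for k
    proof -
      show "integrable S (?G k)"
        by (rule nn_integral_finite_integrable[OF Gm]) (use g0 le_less_trans[OF Gint[of k] ennreal_less_top] in auto)
      have "\<bar>\<integral>\<omega>. ?G k \<omega> \<partial>S\<bar> \<le> e" by (rule integral_le_of_nn_integral[OF _ Gint]) (use e g0 in auto)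
      then show "(\<integral>\<omega>. ?G k \<omega> \<partial>S) \<le> e" by simp
    qed
    have "\<beta> * real n - (\<integral>\<omega>. ln (norm (?x n \<omega>)) \<partial>S) = (\<integral>\<omega>. \<beta> * real n - ln (norm (?x n \<omega>)) \<partial>S)"
      using integrable_ln_norm[OF v, of n] by (simp add: P.prob_space)
    also have "\<dots> \<le> (\<integral>\<omega>. (\<Sum>k<n. ?G k \<omega>) + (\<Sum>k\<in>{n - N..<n}. ?H k \<omega>) \<partial>S)"
    proof (rule integral_mono_AE)
      show "AE \<omega> in S. \<beta> * real n - ln (norm (?x n \<omega>)) \<le> (\<Sum>k<n. ?G k \<omega>) + (\<Sum>k\<in>{n - N..<n}. ?H k \<omega>)"
        using AE_cocycle_nonzero_all[OF v0]
      proof eventually_elim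
        case (elim \<omega>)
        define a where "a k l = \<beta> * real l - (ln (norm (?x (k + l) \<omega>)) - ln (norm (?x k \<omega>)))" for k l
        have shift_x: "cocycle l ((shift ^^ k) \<omega>) *v ?x k \<omega> = ?x (k + l) \<omega>" for k l
          by (simp add: cocycle_add matrix_vector_mul_assoc)
        have H: "?H k \<omega> = \<bar>ln (norm (?x (Suc k) \<omega>)) - ln (norm (?x k \<omega>))\<bar> + \<bar>\<beta>\<bar>" for k
          using shift_x[of "Suc 0" k] by (simp add: step_log_def)
        have "a 0 n \<le> (\<Sum>i<n. if \<exists>l\<in>{1..N}. a i l \<le> 0 then 0 else ?H i \<omega>) + (\<Sum>i\<in>{n - N..<n}. ?H i \<omega>)"
        proof (rule covering_bound)
          fix k l l'
          show "a k (l + l') \<le> a k l + a (k + l) l'" by (simp add: a_def algebra_simps)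
          show "a k 0 \<le> 0" by (simp add: a_def)
          show "a k 1 \<le> ?H k \<omega>" unfolding H by (simp add: a_def)
          show "0 \<le> ?H k \<omega>" by (rule step0)
        qed
        also have "(\<Sum>i<n. if \<exists>l\<in>{1..N}. a i l \<le> 0 then 0 else ?H i \<omega>) \<le> (\<Sum>i<n. ?G i \<omega>)"
        proof (rule sum_mono)
          fix k
          show "(if \<exists>l\<in>{1..N}. a k l \<le> 0 then 0 else ?H k \<omega>) \<le> ?G k \<omega>"
          proof (cases "\<exists>l\<in>{1..N}. a k l \<le> 0")
            case True then show ?thesis by (simp add: g0)
          next
            case False
            have "(shift ^^ k) \<omega> \<in> stay_slow \<beta> N (?x k \<omega>)"
              unfolding stay_slow_def
            proof (intro CollectI conjI ballI)
              show "(shift ^^ k) \<omega> \<in> space S" by (simp add: space_S)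
              fix l assume "l \<in> {1..N}"
              then have "0 < a k l" using False by force
              then have "ln (norm (?x (k + l) \<omega>)) \<le> \<beta> * real l + ln (norm (?x k \<omega>))" by (simp add: a_def)
              then have "exp (ln (norm (?x (k + l) \<omega>))) \<le> exp (\<beta> * real l + ln (norm (?x k \<omega>)))" by simp
              then show "norm (cocycle l ((shift ^^ k) \<omega>) *v ?x k \<omega>) \<le> exp (\<beta> * real l) * norm (?x k \<omega>)"
                using elim unfolding shift_x by (simp add: exp_add)
            qed
            then show ?thesis using False by (simp add: g_def)
          qed
        qed
        finally show ?case using v by (simp add: a_def)
      qed
    qed (use integrable_ln_norm[OF v, of n] Gi Hi in auto)
    also have "\<dots> = (\<Sum>k<n. \<integral>\<omega>. ?G k \<omega> \<partial>S) + (\<Sum>k\<in>{n - N..<n}. \<integral>\<omega>. ?H k \<omega> \<partial>S)"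
      using Gi Hi by simp
    also have "\<dots> \<le> (\<Sum>k<n. e) + (\<Sum>k\<in>{n - N..<n}. (1 + b) / 2)"
      by (intro add_mono sum_mono Gle Hle)
    also have "\<dots> \<le> real n * e + real N * ((1 + b) / 2)" using b(1) by (simp add: divide_right_mono mult_right_mono)
    finally show ?thesis .
  qed
  have "\<forall>\<^sub>F n in sequentially. real N * ((1 + b) / 2) + e * real n \<le> (\<beta> - \<gamma>) * real n"
    using e by (intro eventually_le_linear) (simp add: e_def)
  then obtain n0 where n0: "\<And>n. n0 \<le> n \<Longrightarrow> real N * ((1 + b) / 2) + e * real n \<le> (\<beta> - \<gamma>) * real n"
    by (auto simp: eventually_sequentially)
  show ?thesis
  proof (intro exI[of _ n0] allI impI)
    fix n and v :: "real^'n" assume "n0 \<le> n" "norm v = 1"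
    with n0[of n] main[of v n] show "\<gamma> * real n \<le> (\<integral>\<omega>. ln (norm (cocycle n \<omega> *v v)) \<partial>S)"
      by (simp add: algebra_simps)
  qed
qed

end


section \<open>Contraction of directions\<close>

lemma exp_le_quadratic:
  fixes x :: real shows "exp x \<le> 1 + x + x\<^sup>2 * exp \<bar>x\<bar>"
proof -
  obtain t where t: "\<bar>t\<bar> \<le> \<bar>x\<bar>" "exp x = (\<Sum>m<2. x ^ m / fact m) + exp t / fact 2 * x ^ 2"
    using Maclaurin_exp_le[of x 2] by blast
  have "exp t \<le> exp \<bar>x\<bar>" using t(1) by simp
  moreover have "exp t / fact 2 = exp t / 2" by (simp add: fact_numeral)
  ultimately have "exp t / fact 2 \<le> exp \<bar>x\<bar>" using exp_ge_zero[of "\<bar>x\<bar>"] by linarith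
  then have "exp t / fact 2 * x ^ 2 \<le> exp \<bar>x\<bar> * x\<^sup>2" by (rule mult_right_mono) simp
  with t(2) show ?thesis by (simp add: numeral_2_eq_2 mult.commute)
qed

lemma exp_scaled_le:
  fixes z a a0 :: real
  assumes "0 < a" "a \<le> a0"
  shows "exp (a * z) \<le> 1 + a * z + a\<^sup>2 * (2 / a0\<^sup>2) * exp (2 * a0 * \<bar>z\<bar>)"
proof -
  have a0: "0 < a0" using assms by simp
  have "(a0 * \<bar>z\<bar>)\<^sup>2 / 2 \<le> exp (a0 * \<bar>z\<bar>)"
    using exp_lower_Taylor_quadratic[of "a0 * \<bar>z\<bar>"] a0 by (smt (verit) abs_ge_zero mult_nonneg_nonneg)
  then have z: "z\<^sup>2 \<le> 2 / a0\<^sup>2 * exp (a0 * \<bar>z\<bar>)" using a0 by (simp add: field_simps power_mult_distrib)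
  have "exp \<bar>a * z\<bar> \<le> exp (a0 * \<bar>z\<bar>)" using assms by (simp add: abs_mult mult_right_mono)
  with z have "z\<^sup>2 * exp \<bar>a * z\<bar> \<le> (2 / a0\<^sup>2 * exp (a0 * \<bar>z\<bar>)) * exp (a0 * \<bar>z\<bar>)"
    by (intro mult_mono) auto
  also have "\<dots> = 2 / a0\<^sup>2 * exp (2 * a0 * \<bar>z\<bar>)" by (simp flip: exp_add)
  finally have "a\<^sup>2 * (z\<^sup>2 * exp \<bar>a * z\<bar>) \<le> a\<^sup>2 * (2 / a0\<^sup>2 * exp (2 * a0 * \<bar>z\<bar>))"
    by (intro mult_left_mono) auto
  then show ?thesis using exp_le_quadratic[of "a * z"] by (simp add: power_mult_distrib mult.assoc)
qed

text \<open>
  The action of \<open>g\<close> multiplies small angles at the unit vector \<open>v\<close> by at most the quotient of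
  \<open>area_factor g\<close> and \<open>(norm (g *v v))\<^sup>2\<close>; this is the \<open>a\<close>-th power of that quotient.
\<close>

definition area_ratio :: "real \<Rightarrow> real^'n^'n \<Rightarrow> real^'n \<Rightarrow> real" where
  "area_ratio a g v = area_factor g powr a * norm (g *v v) powr (- 2 * a)"

lemma area_ratio_nonneg: "0 \<le> area_ratio a g v"
  by (simp add: area_ratio_def)

lemma area_ratio_measurable [measurable (raw)]:
  assumes [measurable]: "f \<in> borel_measurable N" shows "(\<lambda>x. area_ratio a (f x) v) \<in> borel_measurable N"
  unfolding area_ratio_def by measurable

context moment_walk
begin

lemma exp_log_area: "exp (log_area K n \<omega>) = max (area_factor (cocycle n \<omega>)) (exp (- K * real n))"
  unfolding log_area_def by (rule exp_ln) (simp add: less_max_iff_disj)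

lemma integral_moment_upper_le:
  shows "integrable S (\<lambda>\<omega>. opnorm (cocycle n \<omega>) powr p)"
    "(\<integral>\<omega>. opnorm (cocycle n \<omega>) powr p \<partial>S) \<le> C ^ n"
proof -
  show "integrable S (\<lambda>\<omega>. opnorm (cocycle n \<omega>) powr p)"
    by (rule integrable_of_moments[OF _ e0_nonzero, of _ 1 0 0]) auto
  have "\<bar>\<integral>\<omega>. opnorm (cocycle n \<omega>) powr p \<partial>S\<bar> \<le> C ^ n"
    by (rule integral_le_of_nn_integral[OF _ moment_upper]) (use C in auto)
  then show "(\<integral>\<omega>. opnorm (cocycle n \<omega>) powr p \<partial>S) \<le> C ^ n" by simp
qed

text \<open>
  Let \<open>z\<close> be the truncated logarithm of the quotient of the area factor and the squared norm of the image
  of \<open>v\<close>. Its mean is at most \<open>- c\<close>, and the mean of \<open>exp (a * z)\<close> is \<open>1 + a * mean z + O(a\<^sup>2)\<close>, where the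
  moment bounds make the error uniform in \<open>v\<close>. So it is less than one for small \<open>a\<close>.
\<close>

lemma area_ratio_contracts:
  assumes K: "0 \<le> K" and c: "0 < c"
    and drift: "\<And>v. norm v = 1 \<Longrightarrow> (\<integral>\<omega>. log_area K n \<omega> \<partial>S) - 2 * (\<integral>\<omega>. ln (norm (cocycle n \<omega> *v v)) \<partial>S) \<le> - c"
    and r: "0 < r"
  shows "\<exists>a \<kappa>. 0 < a \<and> a \<le> r \<and> \<kappa> < 1 \<and> 0 \<le> \<kappa> \<and>
    (\<forall>v. norm v = 1 \<longrightarrow> (\<integral>\<^sup>+\<omega>. ennreal (area_ratio a (cocycle n \<omega>) v) \<partial>S) \<le> ennreal \<kappa>)"
proof -
  \<comment> \<open>Below, \<open>exp \<bar>z\<bar>\<close> is at most the fourth power of a variable with \<open>p\<close>-th moment at most \<open>H\<close>, and the quadratic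
    error term requires the moment of order \<open>8 * a0\<close> of that variable.\<close>
  define a0 where "a0 = p / 16"
  have a0: "0 < a0" "8 * a0 \<le> p" using p by (auto simp: a0_def)
  define H where "H = 1 + C ^ n + C ^ n + exp (K * real n) powr p"
  have H: "1 \<le> H" using C by (auto simp: H_def)
  define D where "D = 2 / a0\<^sup>2"
  have D: "0 < D" using a0 by (simp add: D_def)
  \<comment> \<open>The third bound makes the quadratic error at most half of the linear gain \<open>a * c\<close>, the last one keeps
    \<open>\<kappa>\<close> nonnegative.\<close>
  define a where "a = Min {r, a0, c / (2 * D * H), 1 / (2 * c)}"
  have a: "0 < a" "a \<le> r" "a \<le> a0" "a \<le> c / (2 * D * H)" "a \<le> 1 / (2 * c)"
    unfolding a_def using r a0 c D H by (simp_all add: min_less_iff_disj min_le_iff_disj)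
  define \<kappa> where "\<kappa> = 1 - a * c / 2"
  have "a * c \<le> 1 / 2" using a(5) c by (simp add: field_simps)
  then have \<kappa>: "\<kappa> < 1" "0 \<le> \<kappa>" using a(1) c by (auto simp: \<kappa>_def)
  have "(\<integral>\<^sup>+\<omega>. ennreal (area_ratio a (cocycle n \<omega>) v) \<partial>S) \<le> ennreal \<kappa>" if v: "norm v = 1" for v
  proof -
    have v0: "v \<noteq> 0" using v by auto
    let ?x = "\<lambda>\<omega>. norm (cocycle n \<omega> *v v)"
    let ?z = "\<lambda>\<omega>. log_area K n \<omega> - 2 * ln (?x \<omega>)"
    let ?Y = "\<lambda>\<omega>. 1 + opnorm (cocycle n \<omega>) powr p + ?x \<omega> powr (- p) + exp (K * real n) powr p"
    let ?f = "\<lambda>\<omega>. 1 + a * ?z \<omega> + a\<^sup>2 * D * ?Y \<omega>"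
    have pt: "AE \<omega> in S. area_ratio a (cocycle n \<omega>) v \<le> ?f \<omega>"
      using AE_cocycle_nonzero[OF v0, of n]
    proof eventually_elim
      case (elim \<omega>)
      then have x: "0 < ?x \<omega>" by simp
      let ?l = "log_area K n \<omega>"
      have "area_factor (cocycle n \<omega>) powr a \<le> exp ?l powr a"
        using a(1) area_factor_nonneg unfolding exp_log_area by (intro powr_mono2) auto
      then have "area_ratio a (cocycle n \<omega>) v \<le> exp ?l powr a * ?x \<omega> powr (- 2 * a)"
        unfolding area_ratio_def by (rule mult_right_mono) simp
      also have "\<dots> = exp (a * ?z \<omega>)"
        using x by (simp add: powr_def algebra_simps flip: exp_add)
      also have "\<dots> \<le> 1 + a * ?z \<omega> + a\<^sup>2 * D * exp (2 * a0 * \<bar>?z \<omega>\<bar>)"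
        unfolding D_def by (rule exp_scaled_le[OF a(1,3)])
      also have "exp (2 * a0 * \<bar>?z \<omega>\<bar>) \<le> ?Y \<omega>"
      proof -
        define y where "y = Max {1, opnorm (cocycle n \<omega>), 1 / ?x \<omega>, exp (K * real n)}"
        have y: "1 \<le> y" "opnorm (cocycle n \<omega>) \<le> y" "1 / ?x \<omega> \<le> y" "exp (K * real n) \<le> y"
          by (auto simp: y_def)
        have yy: "y \<le> y * y" using y(1) by simp
        have "exp ?l \<le> y * y"
        proof -
          have "area_factor (cocycle n \<omega>) \<le> y * y"
            using area_factor_le_opnorm[of "cocycle n \<omega>"] mult_mono[OF y(2) y(2)] y(1) opnorm_nonneg[of "cocycle n \<omega>"]
            by linarith
          moreover have "exp (- K * real n) \<le> 1" using K by simp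
          ultimately show ?thesis unfolding exp_log_area using y(1) yy by (intro max.boundedI) linarith+
        qed
        moreover have "exp (- ?l) \<le> y * y"
        proof -
          have "exp (- ?l) \<le> exp (K * real n)" using log_area_ge[of K n \<omega>] by simp
          then show ?thesis using y(4) yy by linarith
        qed
        ultimately have 1: "exp \<bar>?l\<bar> \<le> y * y" by (auto simp: abs_if)
        have "?x \<omega> \<le> y" using norm_matrix_vector_le[of "cocycle n \<omega>" v] v y(2) by simp
        then have 2: "exp \<bar>ln (?x \<omega>)\<bar> \<le> y"
          using x y(3) by (auto simp: abs_if exp_minus inverse_eq_divide)
        have "exp \<bar>?z \<omega>\<bar> \<le> exp (\<bar>?l\<bar> + \<bar>ln (?x \<omega>)\<bar> + \<bar>ln (?x \<omega>)\<bar>)" by simp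
        also have "\<dots> = exp \<bar>?l\<bar> * exp \<bar>ln (?x \<omega>)\<bar> * exp \<bar>ln (?x \<omega>)\<bar>" by (simp only: exp_add)
        also have "\<dots> \<le> (y * y) * y * y" using 1 2 y(1) by (intro mult_mono) auto
        also have "\<dots> = y powr 4" using y(1) by (simp add: powr_numeral eval_nat_numeral)
        finally have 3: "exp \<bar>?z \<omega>\<bar> \<le> y powr 4" .
        have "exp (2 * a0 * \<bar>?z \<omega>\<bar>) = exp \<bar>?z \<omega>\<bar> powr (2 * a0)" by (simp add: powr_def)
        also have "\<dots> \<le> (y powr 4) powr (2 * a0)" using a0 by (intro powr_mono2 3) auto
        also have "\<dots> = y powr (8 * a0)" by (simp add: powr_powr)
        also have "\<dots> \<le> y powr p" using y(1) a0 by (intro powr_mono) auto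
        also have "\<dots> \<le> ?Y \<omega>"
        proof -
          have "y \<in> {1, opnorm (cocycle n \<omega>), 1 / ?x \<omega>, exp (K * real n)}" unfolding y_def by (rule Max_in) auto
          then have "y powr p \<in> {1, opnorm (cocycle n \<omega>) powr p, ?x \<omega> powr (- p), exp (K * real n) powr p}"
            using x by (auto simp: powr_divide powr_minus_divide)
          then show ?thesis
            by (elim insertE) (auto intro!: add_nonneg_nonneg)
        qed
        finally show ?thesis .
      qed
      finally show ?case using D by (simp add: mult_left_mono)
    qed
    have int: "integrable S (log_area K n)" "integrable S (\<lambda>\<omega>. ln (?x \<omega>))"
      "integrable S (\<lambda>\<omega>. opnorm (cocycle n \<omega>) powr p)" "integrable S (\<lambda>\<omega>. ?x \<omega> powr (- p))"
      by (rule integrable_log_area[OF K] integrable_ln_norm[OF v] integral_moment_upper_le(1) integral_moment_lower_le(1)[OF v0])+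
    have intf: "integrable S ?f" using int by auto
    have "(\<integral>\<^sup>+\<omega>. ennreal (area_ratio a (cocycle n \<omega>) v) \<partial>S) \<le> (\<integral>\<^sup>+\<omega>. ennreal (?f \<omega>) \<partial>S)"
      by (rule nn_integral_mono_AE) (use pt in \<open>auto intro: ennreal_leI\<close>)
    also have "\<dots> = ennreal (\<integral>\<omega>. ?f \<omega> \<partial>S)"
      by (rule nn_integral_eq_integral[OF intf]) (use pt in eventually_elim, use area_ratio_nonneg order_trans in blast)
    also have "(\<integral>\<omega>. ?f \<omega> \<partial>S) = 1 + a * ((\<integral>\<omega>. log_area K n \<omega> \<partial>S) - 2 * (\<integral>\<omega>. ln (?x \<omega>) \<partial>S)) +
        a\<^sup>2 * D * (1 + (\<integral>\<omega>. opnorm (cocycle n \<omega>) powr p \<partial>S) + (\<integral>\<omega>. ?x \<omega> powr (- p) \<partial>S) + exp (K * real n) powr p)"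
      using int by (simp add: P.prob_space)
    also have "\<dots> \<le> 1 + a * (- c) + a\<^sup>2 * D * H"
      unfolding H_def using a(1) D integral_moment_upper_le(2)[of n] integral_moment_lower_le(2)[OF v0, of n] v
      by (intro add_mono mult_left_mono drift[OF v]) auto
    also have "a\<^sup>2 * D * H \<le> a * (c / 2)"
    proof -
      have "a * (a * (D * H)) \<le> a * (c / 2)"
        using a(1,4) D H by (intro mult_left_mono) (auto simp: field_simps)
      then show ?thesis by (simp add: power2_eq_square mult.assoc)
    qed
    finally show ?thesis by (simp add: \<kappa>_def ennreal_leI)
  qed
  then show ?thesis using a \<kappa> by blast
qed

text \<open>
  The mean of the truncated logarithm of the area is subadditive and so stays below \<open>(2 * L - e) * n\<close> along
  multiples \<open>n\<close> of \<open>m\<close>, while every unit vector grows at a rate of at least \<open>L - e / 4\<close> if \<open>n\<close> is large.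
\<close>

lemma contracting_block:
  assumes qi: "quasi_irreducible M" and gap: "lyapunov2 M < lyapunov1 M" and r: "0 < r"
  shows "\<exists>n a \<kappa>. 1 \<le> n \<and> 0 < a \<and> a \<le> r \<and> \<kappa> < 1 \<and> 0 \<le> \<kappa> \<and>
    (\<forall>v. norm v = 1 \<longrightarrow> (\<integral>\<^sup>+\<omega>. ennreal (area_ratio a (cocycle n \<omega>) v) \<partial>S) \<le> ennreal \<kappa>)"
proof -
  obtain L where L: "lyapunov1 M = ereal L" "has_growth_rate M opnorm (ereal L)"
    "AE \<omega> in S. (\<lambda>n. ln (opnorm (cocycle n \<omega>)) / real n) \<longlonglongrightarrow> L"
    using furstenberg_kesten by blast
  obtain K e m where K: "0 \<le> K" "0 < e" "1 \<le> m" "(\<integral>\<omega>. log_area K m \<omega> \<partial>S) < (2 * L - e) * real m"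
    by (rule expected_log_area_gap[OF L(1) gap L(3)])
  have fast: "AE \<omega> in S. v \<notin> slow_vectors (L - e / 8) \<omega>" if "v \<noteq> 0" for v
    by (rule slow_prob_zero[OF no_slow_vector[OF qi L(1,2)] that]) (use K(2) in auto)
  obtain n0 where n0: "\<And>n v. n0 \<le> n \<Longrightarrow> norm v = 1 \<Longrightarrow> (L - e / 4) * real n \<le> (\<integral>\<omega>. ln (norm (cocycle n \<omega> *v v)) \<partial>S)"
    using uniform_growth[OF fast, of "L - e / 4"] K(2) by auto
  define j where "j = n0 + 1"
  define n where "n = j * m"
  have n: "1 \<le> n" "n0 \<le> n" using mult_le_mono2[OF K(3), of "n0 + 1"] by (auto simp: n_def j_def)
  have "(\<integral>\<omega>. log_area K n \<omega> \<partial>S) \<le> real j * (\<integral>\<omega>. log_area K m \<omega> \<partial>S)"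
    unfolding n_def by (rule E.expectation_multiple_le[OF subadditive_log_area[OF K(1)]])
  also have "\<dots> \<le> real j * ((2 * L - e) * real m)" using K(4) by (intro mult_left_mono) auto
  also have "\<dots> = (2 * L - e) * real n" by (simp add: n_def)
  finally have la: "(\<integral>\<omega>. log_area K n \<omega> \<partial>S) \<le> (2 * L - e) * real n" .
  have "(\<integral>\<omega>. log_area K n \<omega> \<partial>S) - 2 * (\<integral>\<omega>. ln (norm (cocycle n \<omega> *v v)) \<partial>S) \<le> - (e / 2 * real n)"
    if "norm v = 1" for v
    using la n0[OF n(2) that] by (simp add: algebra_simps)
  moreover have "0 < e / 2 * real n" using K(2) n(1) by simp
  ultimately obtain a \<kappa> where "0 < a" "a \<le> r" "\<kappa> < 1" "0 \<le> \<kappa>"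
    "\<forall>v. norm v = 1 \<longrightarrow> (\<integral>\<^sup>+\<omega>. ennreal (area_ratio a (cocycle n \<omega>) v) \<partial>S) \<le> ennreal \<kappa>"
    using area_ratio_contracts[OF K(1), of "e / 2 * real n" n r] r by blast
  with n(1) show ?thesis by blast
qed

end

section \<open>Two nearby random matrices\<close>

lemma powr_add_le_add_powr:
  fixes x y a :: real assumes "0 \<le> x" "0 \<le> y" "0 < a" "a \<le> 1"
  shows "(x + y) powr a \<le> x powr a + y powr a"
proof (cases "x + y = 0")
  case False
  define s where "s = x + y"
  have s: "0 < s" using False assms by (simp add: s_def)
  have le: "u \<le> u powr a" if "0 \<le> u" "u \<le> 1" for u
    using powr_mono'[of a 1 u] that assms by simp
  have "1 = x / s + y / s" using s by (simp add: s_def add_divide_distrib[symmetric])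
  also have "\<dots> \<le> (x / s) powr a + (y / s) powr a"
    using assms s by (intro add_mono le) (auto simp: s_def)
  also have "\<dots> = (x powr a + y powr a) / s powr a"
    using assms s by (simp add: powr_divide add_divide_distrib)
  finally show ?thesis using s by (simp add: s_def[symmetric] field_simps)
qed (use assms in auto)

lemma ennreal_linear:
  "0 \<le> a \<Longrightarrow> 0 \<le> b \<Longrightarrow> 0 \<le> x \<Longrightarrow> 0 \<le> y \<Longrightarrow> ennreal (a * x + b * y) = ennreal a * ennreal x + ennreal b * ennreal y"
  by (simp add: ennreal_mult)

text \<open>
  This follows from \<open>ln (1 + t) \<le> t powr a / a\<close> for \<open>t \<ge> 0\<close>.
\<close>

lemma abs_ln_diff_le:
  fixes x y a :: real assumes "0 < x" "0 < y" "0 < a" "a \<le> 1"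
  shows "\<bar>ln x - ln y\<bar> \<le> 1 / a * \<bar>x - y\<bar> powr a * (x powr (- a) + y powr (- a))"
proof -
  have main: "ln x - ln y \<le> 1 / a * \<bar>x - y\<bar> powr a * y powr (- a)" if xy: "0 < y" "y \<le> x" for x y :: real
  proof -
    define t where "t = (x - y) / y"
    have t: "0 \<le> t" "x = y * (1 + t)" using xy by (auto simp: t_def field_simps)
    have "a * ln (1 + t) \<le> ln (1 + t powr a)"
    proof -
      have "(1 + t) powr a \<le> 1 powr a + t powr a" using t assms by (intro powr_add_le_add_powr) auto
      then have "ln ((1 + t) powr a) \<le> ln (1 + t powr a)" using t by (intro ln_mono) auto
      then show ?thesis by simp
    qed
    also have "\<dots> \<le> t powr a" by (rule ln_add_one_self_le_self) simp
    finally have "ln (1 + t) \<le> 1 / a * t powr a" using assms by (simp add: field_simps)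
    moreover have "ln x - ln y = ln (1 + t)" unfolding t(2) using xy t by (simp add: ln_mult_pos)
    moreover have "t powr a = \<bar>x - y\<bar> powr a * y powr (- a)"
      using xy by (simp add: t_def powr_divide powr_minus_divide)
    ultimately show ?thesis by (simp add: mult.assoc)
  qed
  show ?thesis
  proof (cases "y \<le> x")
    case True
    then have "\<bar>ln x - ln y\<bar> = ln x - ln y" using assms by simp
    also have "\<dots> \<le> 1 / a * \<bar>x - y\<bar> powr a * y powr (- a)" by (rule main[OF assms(2) True])
    also have "\<dots> \<le> 1 / a * \<bar>x - y\<bar> powr a * (x powr (- a) + y powr (- a))" using assms by (intro mult_left_mono) auto
    finally show ?thesis .
  next
    case False
    then have "\<bar>ln x - ln y\<bar> = ln y - ln x" using assms by simp
    also have "\<dots> \<le> 1 / a * \<bar>y - x\<bar> powr a * x powr (- a)" by (rule main[OF assms(1)]) (use False in simp)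
    also have "\<dots> \<le> 1 / a * \<bar>x - y\<bar> powr a * (x powr (- a) + y powr (- a))"
      using assms by (subst abs_minus_commute) (intro mult_left_mono, auto)
    finally show ?thesis .
  qed
qed

locale matrix_pair = prob_space N for N :: "'a measure" +
  fixes G G' :: "'a \<Rightarrow> real^'n^'n" and p B W :: real
  assumes G_measurable [measurable]: "G \<in> borel_measurable N" and G'_measurable [measurable]: "G' \<in> borel_measurable N"
    and p: "0 < p" "p \<le> 1" and B: "1 \<le> B" and W: "0 < W"
    and upper: "(\<integral>\<^sup>+x. ennreal (opnorm (G x) powr p) \<partial>N) \<le> ennreal B"
      "(\<integral>\<^sup>+x. ennreal (opnorm (G' x) powr p) \<partial>N) \<le> ennreal B"
    and nonzero: "norm v = 1 \<Longrightarrow> AE x in N. G x *v v \<noteq> 0" "norm v = 1 \<Longrightarrow> AE x in N. G' x *v v \<noteq> 0"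
    and lower: "norm v = 1 \<Longrightarrow> (\<integral>\<^sup>+x. ennreal (norm (G x *v v) powr (- p)) \<partial>N) \<le> ennreal B"
      "norm v = 1 \<Longrightarrow> (\<integral>\<^sup>+x. ennreal (norm (G' x *v v) powr (- p)) \<partial>N) \<le> ennreal B"
    and close: "(\<integral>\<^sup>+x. ennreal (opnorm (G x - G' x) powr p) \<partial>N) \<le> ennreal W"
begin

text \<open>
  One variable that dominates both norms and the reciprocals of both image norms. Every estimate below then
  takes the form of a bound by \<open>discrepancy x powr a * spread v x powr (p / 2)\<close>.
\<close>

definition spread :: "real^'n \<Rightarrow> 'a \<Rightarrow> real" where
  "spread v x = Max {1, opnorm (G x), opnorm (G' x), 1 / norm (G x *v v), 1 / norm (G' x *v v)}"

definition discrepancy :: "'a \<Rightarrow> real" where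
  "discrepancy x = opnorm (G x - G' x)"

lemma spread_ge:
  "1 \<le> spread v x" "opnorm (G x) \<le> spread v x" "opnorm (G' x) \<le> spread v x"
  "1 / norm (G x *v v) \<le> spread v x" "1 / norm (G' x *v v) \<le> spread v x"
  by (auto simp: spread_def)

lemma spread_powr_le:
  assumes "norm v = 1"
  shows "spread v x powr p \<le> 1 + opnorm (G x) powr p + opnorm (G' x) powr p +
    norm (G x *v v) powr (- p) + norm (G' x *v v) powr (- p)"
proof -
  have "spread v x \<in> {1, opnorm (G x), opnorm (G' x), 1 / norm (G x *v v), 1 / norm (G' x *v v)}"
    unfolding spread_def by (rule Max_in) auto
  then have "spread v x powr p \<in> {1, opnorm (G x) powr p, opnorm (G' x) powr p,
      norm (G x *v v) powr (- p), norm (G' x *v v) powr (- p)}"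
    by (auto simp: powr_divide powr_minus_divide)
  then show ?thesis by (elim insertE) (auto intro!: add_nonneg_nonneg)
qed

lemma spread_moment:
  assumes v: "norm v = 1"
  shows "(\<integral>\<^sup>+x. ennreal (spread v x powr p) \<partial>N) \<le> ennreal (1 + 4 * B)"
proof -
  have "(\<integral>\<^sup>+x. ennreal (spread v x powr p) \<partial>N) \<le>
      (\<integral>\<^sup>+x. 1 + ennreal (opnorm (G x) powr p) + ennreal (opnorm (G' x) powr p) +
        ennreal (norm (G x *v v) powr (- p)) + ennreal (norm (G' x *v v) powr (- p)) \<partial>N)"
    using spread_powr_le[OF v] by (intro nn_integral_mono) (simp add: ennreal_leI flip: ennreal_plus ennreal_1)
  also have "\<dots> = 1 + (\<integral>\<^sup>+x. ennreal (opnorm (G x) powr p) \<partial>N) + (\<integral>\<^sup>+x. ennreal (opnorm (G' x) powr p) \<partial>N) +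
      (\<integral>\<^sup>+x. ennreal (norm (G x *v v) powr (- p)) \<partial>N) + (\<integral>\<^sup>+x. ennreal (norm (G' x *v v) powr (- p)) \<partial>N)"
    by (simp add: nn_integral_add emeasure_space_1)
  also have "\<dots> \<le> 1 + ennreal B + ennreal B + ennreal B + ennreal B"
    by (intro add_mono upper lower v order_refl)
  also have "\<dots> = ennreal (1 + 4 * B)" using B by (simp flip: ennreal_plus ennreal_1)
  finally show ?thesis .
qed

text \<open>
  With \<open>t = W powr (1 / p)\<close> and \<open>r = discrepancy x / t\<close>, the mean of \<open>r powr p\<close> is at most one. Bound
  \<open>r powr a\<close> by \<open>1 + r powr (p / 2)\<close> and the product \<open>r powr (p / 2) * spread v x powr (p / 2)\<close> by the inequality
  of the arithmetic and geometric means.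
\<close>

lemma discrepancy_spread:
  assumes v: "norm v = 1" and a: "0 < a" "a \<le> p / 2" and f: "f \<in> borel_measurable N" and c: "0 \<le> c"
    and le: "AE x in N. f x \<le> c * (discrepancy x powr a * spread v x powr (p / 2))"
  shows "(\<integral>\<^sup>+x. ennreal (f x) \<partial>N) \<le> ennreal (c * (2 + 6 * B) * W powr (a / p))"
proof -
  define t where "t = W powr (1 / p)"
  have t: "0 < t" "t powr p = W" "t powr a = W powr (a / p)"
    using W p by (auto simp: t_def powr_powr)
  let ?X = discrepancy and ?S = "spread v"
  let ?T = "c * W powr (a / p)"
  have T0: "0 \<le> ?T" using c by simp
  have pt: "discrepancy x powr a * ?S x powr (p / 2) \<le> W powr (a / p) * (3 / 2 * ?S x powr p + 1 / (2 * W) * ?X x powr p)" for x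
  proof -
    define r where "r = ?X x / t"
    have r: "0 \<le> r" "?X x = t * r" using t by (auto simp: r_def discrepancy_def opnorm_nonneg)
    have S1: "1 \<le> ?S x" by (rule spread_ge)
    have "r powr a \<le> 1 + r powr (p / 2)" using r a by (intro powr_le_add_1) auto
    then have "r powr a * ?S x powr (p / 2) \<le> (1 + r powr (p / 2)) * ?S x powr (p / 2)"
      by (rule mult_right_mono) simp
    also have "\<dots> = ?S x powr (p / 2) + r powr (p / 2) * ?S x powr (p / 2)" by (simp add: algebra_simps)
    also have "\<dots> \<le> ?S x powr p + 1 / 2 * (r powr p + ?S x powr p)"
    proof (rule add_mono)
      show "?S x powr (p / 2) \<le> ?S x powr p" using S1 p by (intro powr_mono) auto
      have "r powr (p / 2) * ?S x powr (p / 2) \<le> 1 / 2 * ((r powr (p / 2))\<^sup>2 + (?S x powr (p / 2))\<^sup>2)"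
        using sum_squares_bound[of "r powr (p / 2)" "?S x powr (p / 2)"] by simp
      also have "(r powr (p / 2))\<^sup>2 = r powr p" by (simp add: power2_eq_square flip: powr_add)
      also have "(?S x powr (p / 2))\<^sup>2 = ?S x powr p" by (simp add: power2_eq_square flip: powr_add)
      finally show "r powr (p / 2) * ?S x powr (p / 2) \<le> 1 / 2 * (r powr p + ?S x powr p)" .
    qed
    also have "\<dots> = 3 / 2 * ?S x powr p + 1 / 2 * r powr p" by (simp add: algebra_simps)
    also have "r powr p = 1 / W * ?X x powr p"
      using r t by (simp add: r_def powr_divide discrepancy_def opnorm_nonneg)
    finally have "r powr a * ?S x powr (p / 2) \<le> 3 / 2 * ?S x powr p + 1 / (2 * W) * ?X x powr p" by simp
    then have "t powr a * (r powr a * ?S x powr (p / 2)) \<le> t powr a * (3 / 2 * ?S x powr p + 1 / (2 * W) * ?X x powr p)"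
      by (rule mult_left_mono) simp
    moreover have "discrepancy x powr a = t powr a * r powr a" unfolding r(2) using t(1) r(1) by (simp add: powr_mult)
    ultimately show ?thesis using t(3) by (simp add: mult.assoc)
  qed
  have S_meas [measurable]: "?S \<in> borel_measurable N" by (simp add: spread_def[abs_def])
  have X_meas [measurable]: "?X \<in> borel_measurable N" unfolding discrepancy_def[abs_def] by measurable
  have "(\<integral>\<^sup>+x. ennreal (f x) \<partial>N) \<le>
      (\<integral>\<^sup>+x. ennreal (?T * (3 / 2)) * ennreal (?S x powr p) + ennreal (?T * (1 / (2 * W))) * ennreal (?X x powr p) \<partial>N)"
  proof (rule nn_integral_mono_AE, use le in eventually_elim)
    case (elim x)
    have "c * (discrepancy x powr a * ?S x powr (p / 2)) \<le> c * (W powr (a / p) * (3 / 2 * ?S x powr p + 1 / (2 * W) * ?X x powr p))"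
      by (rule mult_left_mono[OF pt c])
    with elim have "f x \<le> ?T * (3 / 2) * ?S x powr p + ?T * (1 / (2 * W)) * ?X x powr p" by (simp add: algebra_simps)
    then have "ennreal (f x) \<le> ennreal (?T * (3 / 2) * ?S x powr p + ?T * (1 / (2 * W)) * ?X x powr p)" by (rule ennreal_leI)
    also have "\<dots> = ennreal (?T * (3 / 2)) * ennreal (?S x powr p) + ennreal (?T * (1 / (2 * W))) * ennreal (?X x powr p)"
      using T0 W by (intro ennreal_linear) auto
    finally show ?case .
  qed
  also have "\<dots> = ennreal (?T * (3 / 2)) * (\<integral>\<^sup>+x. ennreal (?S x powr p) \<partial>N) + ennreal (?T * (1 / (2 * W))) * (\<integral>\<^sup>+x. ennreal (?X x powr p) \<partial>N)"
    by (simp add: nn_integral_add nn_integral_cmult)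
  also have "\<dots> \<le> ennreal (?T * (3 / 2)) * ennreal (1 + 4 * B) + ennreal (?T * (1 / (2 * W))) * ennreal W"
    using spread_moment[OF v] close by (intro add_mono mult_left_mono) (auto simp: discrepancy_def)
  also have "\<dots> = ennreal (?T * (3 / 2) * (1 + 4 * B) + ?T * (1 / (2 * W)) * W)"
    using T0 W B by (intro ennreal_linear[symmetric]) auto
  also have "?T * (3 / 2) * (1 + 4 * B) + ?T * (1 / (2 * W)) * W = c * (2 + 6 * B) * W powr (a / p)"
    using W by (simp add: field_simps)
  finally show ?thesis .
qed

lemma norm_diff_le: "norm v = 1 \<Longrightarrow> norm (G x *v v - G' x *v v) \<le> discrepancy x"
  using norm_matrix_vector_le[of "G x - G' x" v] by (simp add: discrepancy_def matrix_vector_mult_diff_rdistrib)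

lemma discrepancy_nonneg: "0 \<le> discrepancy x"
  by (simp add: discrepancy_def opnorm_nonneg)

lemma inverse_powr_le_spread:
  assumes "0 \<le> b"
  shows "norm (G x *v v) powr (- b) \<le> spread v x powr b" "norm (G' x *v v) powr (- b) \<le> spread v x powr b"
proof -
  have "(1 / norm (G x *v v)) powr b \<le> spread v x powr b" "(1 / norm (G' x *v v)) powr b \<le> spread v x powr b"
    using assms spread_ge by (auto intro!: powr_mono2)
  then show "norm (G x *v v) powr (- b) \<le> spread v x powr b" "norm (G' x *v v) powr (- b) \<le> spread v x powr b"
    by (simp_all add: powr_divide powr_minus_divide)
qed

lemma spread_powr_mono: "b \<le> b' \<Longrightarrow> spread v x powr b \<le> spread v x powr b'"
  using spread_ge(1)[of v x] by (rule powr_mono[rotated])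

lemma sin_dist_images:
  assumes v: "norm v = 1" and a: "0 < a" "a \<le> p / 2"
  shows "(\<integral>\<^sup>+x. ennreal (sin_dist (G x *v v) (G' x *v v) powr a) \<partial>N) \<le> ennreal (1 * (2 + 6 * B) * W powr (a / p))"
proof (rule discrepancy_spread[OF v a])
  show "(\<lambda>x. sin_dist (G x *v v) (G' x *v v) powr a) \<in> borel_measurable N"
    unfolding sin_dist_def wedge_norm_def by measurable
  show "AE x in N. sin_dist (G x *v v) (G' x *v v) powr a \<le> 1 * (discrepancy x powr a * spread v x powr (p / 2))"
    using nonzero(2)[OF v]
  proof eventually_elim
    case (elim x)
    have "sin_dist (G x *v v) (G' x *v v) \<le> norm (G x *v v - G' x *v v) * (1 / norm (G' x *v v))"
      using sin_dist_le_diff[OF elim, of "G x *v v"] by simp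
    also have "\<dots> \<le> discrepancy x * spread v x"
      using norm_diff_le[OF v] spread_ge(5) discrepancy_nonneg by (intro mult_mono) auto
    finally have "sin_dist (G x *v v) (G' x *v v) powr a \<le> (discrepancy x * spread v x) powr a"
      using a sin_dist_nonneg by (intro powr_mono2) auto
    also have "\<dots> = discrepancy x powr a * spread v x powr a"
      using spread_ge(1)[of v x] discrepancy_nonneg by (intro powr_mult) 
    also have "\<dots> \<le> discrepancy x powr a * spread v x powr (p / 2)"
      using a by (intro mult_left_mono spread_powr_mono) auto
    finally show ?case by simp
  qed
qed simp

lemma ln_images:
  assumes v: "norm v = 1" and a: "0 < a" "a \<le> p / 2"
  shows "(\<integral>\<^sup>+x. ennreal \<bar>ln (norm (G x *v v)) - ln (norm (G' x *v v))\<bar> \<partial>N) \<le> ennreal (2 / a * (2 + 6 * B) * W powr (a / p))"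
proof (rule discrepancy_spread[OF v a])
  show "AE x in N. \<bar>ln (norm (G x *v v)) - ln (norm (G' x *v v))\<bar> \<le> 2 / a * (discrepancy x powr a * spread v x powr (p / 2))"
    using nonzero[OF v]
  proof eventually_elim
    case (elim x)
    let ?x = "norm (G x *v v)" and ?y = "norm (G' x *v v)"
    have "\<bar>ln ?x - ln ?y\<bar> \<le> 1 / a * \<bar>?x - ?y\<bar> powr a * (?x powr (- a) + ?y powr (- a))"
      using elim a p by (intro abs_ln_diff_le) auto
    also have "\<dots> \<le> 1 / a * discrepancy x powr a * (spread v x powr a + spread v x powr a)"
      using a norm_diff_le[OF v, of x] norm_triangle_ineq3[of "G x *v v" "G' x *v v"]
      by (intro mult_mono add_mono inverse_powr_le_spread powr_mono2) auto
    also have "\<dots> = 2 / a * (discrepancy x powr a * spread v x powr a)" by simp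
    also have "\<dots> \<le> 2 / a * (discrepancy x powr a * spread v x powr (p / 2))"
      using a by (intro mult_left_mono spread_powr_mono) auto
    finally show ?case .
  qed
qed (use a in auto)

text \<open>
  Pass from \<open>G x\<close> to \<open>G' x\<close> first in the area factor and then in the norm of the image of \<open>v\<close>; each error is at
  most twice \<open>discrepancy x powr a * spread v x powr (7 * a)\<close>.
\<close>

lemma area_ratio_diff:
  assumes v: "norm v = 1" and a: "0 < a" "7 * a \<le> p / 2"
  shows "(\<integral>\<^sup>+x. ennreal (area_ratio a (G x) v) \<partial>N) \<le>
    (\<integral>\<^sup>+x. ennreal (area_ratio a (G' x) v) \<partial>N) + ennreal (4 * (2 + 6 * B) * W powr (a / p))"
proof -
  have a1: "a \<le> 1" "2 * a \<le> 1" using a p by auto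
  let ?f = "\<lambda>x. area_ratio a (G x) v - area_ratio a (G' x) v"
  have pt: "AE x in N. ?f x \<le> 4 * (discrepancy x powr a * spread v x powr (p / 2))"
    using nonzero[OF v]
  proof eventually_elim
    case (elim x)
    let ?x = "norm (G x *v v)" and ?y = "norm (G' x *v v)" and ?A = "area_factor (G x)" and ?A' = "area_factor (G' x)"
    let ?S = "spread v x" and ?X = "discrepancy x"
    have xy: "0 < ?x" "0 < ?y" using elim by auto
    have S1: "1 \<le> ?S" by (rule spread_ge)
    have X0: "0 \<le> ?X" by (rule discrepancy_nonneg)
    have "?A powr a \<le> (?A' + ?X * (2 * ?S)) powr a"
    proof (rule powr_mono2)
      have "?X * (opnorm (G x) + opnorm (G' x)) \<le> ?X * (2 * ?S)"
        using spread_ge(2,3)[where v=v and x=x] X0 by (intro mult_left_mono) auto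
      then show "?A \<le> ?A' + ?X * (2 * ?S)"
        using area_factor_diff[of "G x" "G' x"] by (simp add: discrepancy_def)
    qed (use a area_factor_nonneg in auto)
    also have "\<dots> \<le> ?A' powr a + (?X * (2 * ?S)) powr a"
      using X0 S1 a a1 area_factor_nonneg by (intro powr_add_le_add_powr) auto
    also have "(?X * (2 * ?S)) powr a = 2 powr a * (?X powr a * ?S powr a)"
      using X0 S1 by (simp add: powr_mult)
    also have "\<dots> \<le> 2 * (?X powr a * ?S powr a)"
      using a1 powr_mono[of a 1 2] by (intro mult_right_mono) auto
    finally have 1: "?A powr a \<le> ?A' powr a + 2 * (?X powr a * ?S powr a)" by simp
    have 2: "?x powr (- 2 * a) \<le> ?y powr (- 2 * a) + ?X powr (2 * a) * ?S powr (4 * a)"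
    proof -
      have "?y \<le> ?x + ?X"
        using norm_diff_le[OF v, of x] norm_triangle_ineq2[of "G' x *v v" "G x *v v"] by (simp add: norm_minus_commute)
      then have "?y powr (2 * a) \<le> (?x + ?X) powr (2 * a)" using a xy by (intro powr_mono2) auto
      also have "\<dots> \<le> ?x powr (2 * a) + ?X powr (2 * a)" using a a1 X0 by (intro powr_add_le_add_powr) auto
      finally have "?y powr (2 * a) * (?x powr (- 2 * a) * ?y powr (- 2 * a)) \<le>
          (?x powr (2 * a) + ?X powr (2 * a)) * (?x powr (- 2 * a) * ?y powr (- 2 * a))"
        by (rule mult_right_mono) simp
      moreover have "?y powr (2 * a) * (?x powr (- 2 * a) * ?y powr (- 2 * a)) = ?x powr (- 2 * a)"
        using xy by (simp add: powr_minus)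
      moreover have "(?x powr (2 * a) + ?X powr (2 * a)) * (?x powr (- 2 * a) * ?y powr (- 2 * a)) =
          ?y powr (- 2 * a) + ?X powr (2 * a) * (?x powr (- 2 * a) * ?y powr (- 2 * a))"
        using xy by (simp add: powr_minus field_simps)
      moreover have "?X powr (2 * a) * (?x powr (- 2 * a) * ?y powr (- 2 * a)) \<le> ?X powr (2 * a) * (?S powr (2 * a) * ?S powr (2 * a))"
        using inverse_powr_le_spread[of "2 * a" x v] a by (intro mult_left_mono mult_mono) auto
      moreover have eq: "?S powr (2 * a) * ?S powr (2 * a) = ?S powr (4 * a)" by (simp flip: powr_add)
      ultimately show ?thesis unfolding eq by linarith
    qed
    have 3: "?A' powr a * (?X powr (2 * a) * ?S powr (4 * a)) \<le> 2 * (?X powr a * ?S powr (7 * a))"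
    proof -
      have "?A' \<le> ?S * ?S"
      proof -
        have "opnorm (G' x) * opnorm (G' x) \<le> ?S * ?S"
          using S1 by (intro mult_mono spread_ge) (auto simp: opnorm_nonneg)
        then show ?thesis using area_factor_le_opnorm[of "G' x"] by linarith
      qed
      then have "?A' powr a \<le> (?S * ?S) powr a" using a area_factor_nonneg by (intro powr_mono2) auto
      also have "\<dots> = ?S powr (2 * a)" using S1 by (simp add: powr_mult flip: powr_add)
      finally have A': "?A' powr a \<le> ?S powr (2 * a)" .
      have "?X \<le> 2 * ?S"
        using opnorm_diff_le[of "G x" "G' x"] spread_ge(2,3)[where v=v and x=x] unfolding discrepancy_def by linarith
      then have "?X powr a \<le> (2 * ?S) powr a" using a X0 by (intro powr_mono2) auto
      also have "\<dots> = 2 powr a * ?S powr a" using S1 by (simp add: powr_mult)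
      also have "\<dots> \<le> 2 * ?S powr a" using a1 powr_mono[of a 1 2] by (intro mult_right_mono) auto
      finally have X: "?X powr a \<le> 2 * ?S powr a" .
      have "?A' powr a * (?X powr (2 * a) * ?S powr (4 * a)) = ?A' powr a * ((?X powr a * ?X powr a) * ?S powr (4 * a))"
        by (simp flip: powr_add)
      also have "\<dots> \<le> ?S powr (2 * a) * ((?X powr a * (2 * ?S powr a)) * ?S powr (4 * a))"
        using A' X by (intro mult_mono) auto
      also have "\<dots> = 2 * (?X powr a * (?S powr (2 * a) * ?S powr a * ?S powr (4 * a)))" by simp
      also have "?S powr (2 * a) * ?S powr a * ?S powr (4 * a) = ?S powr (7 * a)" by (simp flip: powr_add)
      finally show ?thesis .
    qed
    have 4: "?X powr a * ?S powr a * ?x powr (- 2 * a) \<le> ?X powr a * ?S powr (7 * a)"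
    proof -
      have "?S powr a * ?x powr (- 2 * a) \<le> ?S powr a * ?S powr (2 * a)"
        using inverse_powr_le_spread(1)[of "2 * a" x v] a by (intro mult_left_mono) auto
      also have "\<dots> = ?S powr (3 * a)" by (simp flip: powr_add)
      also have "\<dots> \<le> ?S powr (7 * a)" using a by (intro spread_powr_mono) auto
      finally show ?thesis by (simp add: mult.assoc mult_left_mono)
    qed
    have "area_ratio a (G x) v \<le> (?A' powr a + 2 * (?X powr a * ?S powr a)) * ?x powr (- 2 * a)"
      unfolding area_ratio_def using 1 by (rule mult_right_mono) simp
    also have "\<dots> = ?A' powr a * ?x powr (- 2 * a) + 2 * (?X powr a * ?S powr a * ?x powr (- 2 * a))" by (simp add: algebra_simps)
    also have "?A' powr a * ?x powr (- 2 * a) \<le> ?A' powr a * (?y powr (- 2 * a) + ?X powr (2 * a) * ?S powr (4 * a))"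
      using 2 by (rule mult_left_mono) simp
    also have "\<dots> = area_ratio a (G' x) v + ?A' powr a * (?X powr (2 * a) * ?S powr (4 * a))"
      by (simp add: area_ratio_def algebra_simps)
    finally have "?f x \<le> ?A' powr a * (?X powr (2 * a) * ?S powr (4 * a)) + 2 * (?X powr a * ?S powr a * ?x powr (- 2 * a))" by simp
    also have "\<dots> \<le> 4 * (?X powr a * ?S powr (7 * a))" using 3 4 by linarith
    also have "\<dots> \<le> 4 * (?X powr a * ?S powr (p / 2))" using a by (intro mult_left_mono spread_powr_mono) auto
    finally show ?case .
  qed
  have "(\<integral>\<^sup>+x. ennreal (area_ratio a (G x) v) \<partial>N) \<le> (\<integral>\<^sup>+x. ennreal (area_ratio a (G' x) v) + ennreal (?f x) \<partial>N)"
  proof (rule nn_integral_mono)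
    fix x
    show "ennreal (area_ratio a (G x) v) \<le> ennreal (area_ratio a (G' x) v) + ennreal (?f x)"
    proof (cases "0 \<le> ?f x")
      case True then show ?thesis by (subst ennreal_plus[symmetric]) (auto simp: area_ratio_nonneg)
    next
      case False then show ?thesis by (simp add: ennreal_neg ennreal_leI)
    qed
  qed
  also have "\<dots> = (\<integral>\<^sup>+x. ennreal (area_ratio a (G' x) v) \<partial>N) + (\<integral>\<^sup>+x. ennreal (?f x) \<partial>N)"
    by (rule nn_integral_add) measurable
  also have "\<dots> \<le> (\<integral>\<^sup>+x. ennreal (area_ratio a (G' x) v) \<partial>N) + ennreal (4 * (2 + 6 * B) * W powr (a / p))"
    using a p by (intro add_left_mono discrepancy_spread[OF v _ _ _ _ pt]) auto
  finally show ?thesis .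
qed

lemma ln_directions:
  assumes v: "norm v = 1" and w: "norm w = 1" and a: "0 < a" "a \<le> p / 2"
  shows "(\<integral>\<^sup>+x. ennreal \<bar>ln (norm (G x *v v)) - ln (norm (G x *v w))\<bar> \<partial>N) \<le> ennreal ((4 + 4 * B) / a * sin_dist v w powr a)"
proof -
  obtain s where s: "\<bar>s\<bar> = 1" "norm (v - s *\<^sub>R w) \<le> 2 * sin_dist v w" by (rule norm_diff_le_sin_dist[OF v w])
  let ?d = "sin_dist v w powr a"
  let ?c = "1 / a * ?d"
  have c0: "0 \<le> ?c" using a by simp
  have "(\<integral>\<^sup>+x. ennreal \<bar>ln (norm (G x *v v)) - ln (norm (G x *v w))\<bar> \<partial>N) \<le>
      (\<integral>\<^sup>+x. ennreal ?c * (ennreal 4 + ennreal 2 * ennreal (opnorm (G x) powr p) + ennreal (norm (G x *v v) powr (- p)) + ennreal (norm (G x *v w) powr (- p))) \<partial>N)"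
  proof (rule nn_integral_mono_AE, use nonzero(1)[OF v] nonzero(1)[OF w] in eventually_elim)
    case (elim x)
    let ?x = "norm (G x *v v)" and ?y = "norm (G x *v w)" and ?U = "opnorm (G x)"
    have xy: "0 < ?x" "0 < ?y" using elim by auto
    have "?y = norm (G x *v (s *\<^sub>R w))" using s(1) by (simp add: matrix_vector_mult_scaleR)
    then have "\<bar>?x - ?y\<bar> \<le> norm (G x *v v - G x *v (s *\<^sub>R w))" by (simp add: norm_triangle_ineq3)
    also have "\<dots> = norm (G x *v (v - s *\<^sub>R w))" by (simp add: matrix_vector_mult_diff_distrib)
    also have "\<dots> \<le> ?U * norm (v - s *\<^sub>R w)" by (rule norm_matrix_vector_le)
    also have "\<dots> \<le> ?U * (2 * sin_dist v w)" using s(2) opnorm_nonneg by (rule mult_left_mono)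
    finally have "\<bar>?x - ?y\<bar> powr a \<le> (?U * (2 * sin_dist v w)) powr a" using a by (intro powr_mono2) auto
    also have "\<dots> = 2 powr a * (?U powr a * ?d)" by (simp add: powr_mult opnorm_nonneg sin_dist_nonneg)
    also have "\<dots> \<le> 2 * (?U powr a * ?d)" using a p powr_mono[of a 1 2] by (intro mult_right_mono) auto
    finally have d: "\<bar>?x - ?y\<bar> powr a \<le> 2 * (?U powr a * ?d)" .
    have prod: "2 * (?U powr a * z powr (- a)) \<le> 2 + ?U powr p + z powr (- p)" if "0 < z" for z
    proof -
      have "2 * (?U powr a * z powr (- a)) \<le> (?U powr a)\<^sup>2 + (z powr (- a))\<^sup>2"
        using sum_squares_bound[of "?U powr a" "z powr (- a)"] by simp
      also have "(?U powr a)\<^sup>2 = ?U powr (2 * a)" by (simp add: power2_eq_square flip: powr_add)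
      also have "(z powr (- a))\<^sup>2 = (1 / z) powr (2 * a)"
        using that by (simp add: power2_eq_square powr_divide powr_minus_divide flip: powr_add)
      also have "?U powr (2 * a) \<le> 1 + ?U powr p" using a opnorm_nonneg by (intro powr_le_add_1) auto
      also have "(1 / z) powr (2 * a) \<le> 1 + (1 / z) powr p" using a that by (intro powr_le_add_1) auto
      finally show ?thesis using that by (simp add: powr_divide powr_minus_divide)
    qed
    have "\<bar>ln ?x - ln ?y\<bar> \<le> 1 / a * \<bar>?x - ?y\<bar> powr a * (?x powr (- a) + ?y powr (- a))"
      using xy a p by (intro abs_ln_diff_le) auto
    also have "\<dots> \<le> 1 / a * (2 * (?U powr a * ?d)) * (?x powr (- a) + ?y powr (- a))"
      using d a by (intro mult_right_mono mult_left_mono) auto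
    also have "\<dots> = ?c * (2 * (?U powr a * ?x powr (- a)) + 2 * (?U powr a * ?y powr (- a)))"
      by (simp add: algebra_simps add_divide_distrib)
    also have "\<dots> \<le> ?c * ((2 + ?U powr p + ?x powr (- p)) + (2 + ?U powr p + ?y powr (- p)))"
      using xy by (intro mult_left_mono[OF _ c0] add_mono prod)
    also have "\<dots> = ?c * (4 + 2 * ?U powr p + ?x powr (- p) + ?y powr (- p))" by simp
    finally have "ennreal \<bar>ln ?x - ln ?y\<bar> \<le> ennreal (?c * (4 + 2 * ?U powr p + ?x powr (- p) + ?y powr (- p)))"
      by (rule ennreal_leI)
    also have "\<dots> = ennreal ?c * (ennreal 4 + ennreal 2 * ennreal (?U powr p) + ennreal (?x powr (- p)) + ennreal (?y powr (- p)))"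
      using c0 by (subst ennreal_mult) (auto simp: ennreal_mult)
    finally show ?case .
  qed
  also have "\<dots> = ennreal ?c * (ennreal 4 + ennreal 2 * (\<integral>\<^sup>+x. ennreal (opnorm (G x) powr p) \<partial>N) +
      (\<integral>\<^sup>+x. ennreal (norm (G x *v v) powr (- p)) \<partial>N) + (\<integral>\<^sup>+x. ennreal (norm (G x *v w) powr (- p)) \<partial>N))"
    by (simp add: nn_integral_add nn_integral_cmult emeasure_space_1)
  also have "\<dots> \<le> ennreal ?c * (ennreal 4 + ennreal 2 * ennreal B + ennreal B + ennreal B)"
    by (intro mult_left_mono add_mono upper lower v w order_refl) auto
  also have "\<dots> = ennreal (?c * (4 + 2 * B + B + B))"
  proof -
    have "ennreal c * (ennreal 4 + ennreal 2 * ennreal B + ennreal B + ennreal B) = ennreal (c * (4 + 2 * B + B + B))"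
      if c: "0 \<le> c" for c
    proof -
      have h: "0 \<le> B" "0 \<le> 4 + 2 * B" "0 \<le> 4 + 2 * B + B" "0 \<le> 4 + 2 * B + B + B" "0 \<le> 2 * B" "(0 :: real) \<le> 4" "(0 :: real) \<le> 2"
        using B by auto
      show ?thesis by (simp only: h c ennreal_plus ennreal_mult)
    qed
    then show ?thesis using c0 .
  qed
  also have "?c * (4 + 2 * B + B + B) = (4 + 4 * B) / a * ?d" by (simp add: algebra_simps add_divide_distrib)
  finally show ?thesis .
qed

text \<open>
  The sine of the angle is multiplied by at most \<open>area_factor (G x) / (norm (G x *v v) * norm (G x *v w))\<close>; the
  arithmetic-geometric mean inequality separates \<open>v\<close> from \<open>w\<close>.
\<close>

lemma sin_dist_contraction:
  assumes v: "norm v = 1" and w: "norm w = 1" and a: "0 < a" and \<kappa>: "0 \<le> \<kappa>"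
    and contr: "\<And>v. norm v = 1 \<Longrightarrow> (\<integral>\<^sup>+x. ennreal (area_ratio a (G x) v) \<partial>N) \<le> ennreal \<kappa>"
  shows "(\<integral>\<^sup>+x. ennreal (sin_dist (G x *v v) (G x *v w) powr a) \<partial>N) \<le> ennreal (\<kappa> * sin_dist v w powr a)"
proof -
  let ?d = "sin_dist v w powr a"
  have "(\<integral>\<^sup>+x. ennreal (sin_dist (G x *v v) (G x *v w) powr a) \<partial>N) \<le>
      (\<integral>\<^sup>+x. ennreal (?d / 2) * (ennreal (area_ratio a (G x) v) + ennreal (area_ratio a (G x) w)) \<partial>N)"
  proof (rule nn_integral_mono_AE, use nonzero(1)[OF v] nonzero(1)[OF w] in eventually_elim)
    case (elim x)
    let ?x = "norm (G x *v v)" and ?y = "norm (G x *v w)" and ?A = "area_factor (G x)"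
    have xy: "0 < ?x" "0 < ?y" using elim by auto
    have "sin_dist (G x *v v) (G x *v w) \<le> ?A * sin_dist v w / (?x * ?y)"
      using wedge_norm_image_le[of "G x" v w] xy v w by (simp add: sin_dist_def divide_right_mono)
    then have "sin_dist (G x *v v) (G x *v w) powr a \<le> (?A * sin_dist v w / (?x * ?y)) powr a"
      using a sin_dist_nonneg by (intro powr_mono2) auto
    also have "\<dots> = ?A powr a * ?d * (?x powr (- a) * ?y powr (- a))"
      using xy by (simp add: powr_divide powr_mult powr_minus_divide area_factor_nonneg sin_dist_nonneg)
    also have "\<dots> \<le> ?A powr a * ?d * (1 / 2 * (?x powr (- 2 * a) + ?y powr (- 2 * a)))"
    proof (rule mult_left_mono)
      have "2 * (?x powr (- a) * ?y powr (- a)) \<le> (?x powr (- a))\<^sup>2 + (?y powr (- a))\<^sup>2"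
        using sum_squares_bound[of "?x powr (- a)" "?y powr (- a)"] by simp
      moreover have "(z powr (- a))\<^sup>2 = z powr (- 2 * a)" for z :: real
        by (simp add: power2_eq_square flip: powr_add)
      ultimately show "?x powr (- a) * ?y powr (- a) \<le> 1 / 2 * (?x powr (- 2 * a) + ?y powr (- 2 * a))" by simp
    qed simp
    also have "\<dots> = ?d / 2 * (area_ratio a (G x) v + area_ratio a (G x) w)" by (simp add: area_ratio_def algebra_simps)
    finally have "ennreal (sin_dist (G x *v v) (G x *v w) powr a) \<le> ennreal (?d / 2 * (area_ratio a (G x) v + area_ratio a (G x) w))"
      by (rule ennreal_leI)
    also have "\<dots> = ennreal (?d / 2) * (ennreal (area_ratio a (G x) v) + ennreal (area_ratio a (G x) w))"
      by (subst ennreal_mult) (auto simp: area_ratio_nonneg)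
    finally show ?case .
  qed
  also have "\<dots> = ennreal (?d / 2) * ((\<integral>\<^sup>+x. ennreal (area_ratio a (G x) v) \<partial>N) + (\<integral>\<^sup>+x. ennreal (area_ratio a (G x) w) \<partial>N))"
    by (simp add: nn_integral_add nn_integral_cmult)
  also have "\<dots> \<le> ennreal (?d / 2) * (ennreal \<kappa> + ennreal \<kappa>)"
    by (intro mult_left_mono add_mono contr v w) auto
  also have "\<dots> = ennreal (\<kappa> * ?d)"
    using \<kappa> by (simp add: mult.commute flip: ennreal_plus ennreal_mult)
  finally show ?thesis .
qed

end


section \<open>Coupled random matrix products\<close>

context matrix_pair
begin

text \<open>
  Move the direction \<open>v\<close> to \<open>w\<close> under the same matrix, where the angle contracts, and then change the matrix.
\<close>

lemma sin_dist_step: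
  assumes v: "v \<noteq> 0" and w: "w \<noteq> 0" and a: "0 < a" "a \<le> p / 2" and \<kappa>: "0 \<le> \<kappa>"
    and contr: "\<And>v. norm v = 1 \<Longrightarrow> (\<integral>\<^sup>+x. ennreal (area_ratio a (G x) v) \<partial>N) \<le> ennreal \<kappa>"
  shows "(\<integral>\<^sup>+x. ennreal (sin_dist (G x *v v) (G' x *v w) powr a) \<partial>N) \<le>
    ennreal (\<kappa> * sin_dist v w powr a + (2 + 6 * B) * W powr (a / p))"
proof -
  let ?v = "(1 / norm v) *\<^sub>R v" and ?w = "(1 / norm w) *\<^sub>R w"
  have u: "norm ?v = 1" "norm ?w = 1" using v w by auto
  have sc: "sin_dist (g *v v) (h *v w) = sin_dist (g *v ?v) (h *v ?w)" for g h
    using v w by (simp add: matrix_vector_mult_scaleR sin_dist_scaleR)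
  have sc0: "sin_dist ?v ?w = sin_dist v w" using v w by (simp add: sin_dist_scaleR)
  have R0: "0 \<le> (2 + 6 * B) * W powr (a / p)" using B by simp
  have "(\<integral>\<^sup>+x. ennreal (sin_dist (G x *v v) (G' x *v w) powr a) \<partial>N) \<le>
      (\<integral>\<^sup>+x. ennreal (sin_dist (G x *v ?v) (G x *v ?w) powr a) + ennreal (sin_dist (G x *v ?w) (G' x *v ?w) powr a) \<partial>N)"
  proof (rule nn_integral_mono_AE, use nonzero(1)[OF u(2)] in eventually_elim)
    case (elim x)
    let ?p = "sin_dist (G x *v ?v) (G x *v ?w)" and ?q = "sin_dist (G x *v ?w) (G' x *v ?w)"
    have "sin_dist (G x *v v) (G' x *v w) powr a \<le> (?p + ?q) powr a"
      unfolding sc using a sin_dist_triangle[OF elim] by (intro powr_mono2) (auto simp: sin_dist_nonneg)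
    also have "\<dots> \<le> ?p powr a + ?q powr a"
      using a p by (intro powr_add_le_add_powr) (auto simp: sin_dist_nonneg)
    finally show ?case by (simp add: ennreal_leI flip: ennreal_plus)
  qed
  also have "\<dots> = (\<integral>\<^sup>+x. ennreal (sin_dist (G x *v ?v) (G x *v ?w) powr a) \<partial>N) +
      (\<integral>\<^sup>+x. ennreal (sin_dist (G x *v ?w) (G' x *v ?w) powr a) \<partial>N)"
    by (rule nn_integral_add) (unfold sin_dist_def wedge_norm_def, measurable)
  also have "\<dots> \<le> ennreal (\<kappa> * sin_dist ?v ?w powr a) + ennreal (1 * (2 + 6 * B) * W powr (a / p))"
    by (intro add_mono sin_dist_contraction sin_dist_images u a \<kappa> contr)
  also have "\<dots> = ennreal (\<kappa> * sin_dist v w powr a + (2 + 6 * B) * W powr (a / p))"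
    using \<kappa> R0 by (simp add: sc0)
  finally show ?thesis .
qed

lemma ln_step:
  assumes v: "v \<noteq> 0" and w: "w \<noteq> 0" and a: "0 < a" "a \<le> p / 2"
  shows "(\<integral>\<^sup>+x. ennreal \<bar>(ln (norm (G x *v v)) - ln (norm v)) - (ln (norm (G' x *v w)) - ln (norm w))\<bar> \<partial>N) \<le>
    ennreal ((4 + 4 * B) / a * sin_dist v w powr a + 2 / a * (2 + 6 * B) * W powr (a / p))"
proof -
  let ?v = "(1 / norm v) *\<^sub>R v" and ?w = "(1 / norm w) *\<^sub>R w"
  have u: "norm ?v = 1" "norm ?w = 1" using v w by auto
  have sc0: "sin_dist ?v ?w = sin_dist v w" using v w by (simp add: sin_dist_scaleR)
  have R0: "0 \<le> 2 / a * (2 + 6 * B) * W powr (a / p)" "0 \<le> (4 + 4 * B) / a" using B a by simp_all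
  have "(\<integral>\<^sup>+x. ennreal \<bar>(ln (norm (G x *v v)) - ln (norm v)) - (ln (norm (G' x *v w)) - ln (norm w))\<bar> \<partial>N) \<le>
      (\<integral>\<^sup>+x. ennreal \<bar>ln (norm (G x *v ?v)) - ln (norm (G x *v ?w))\<bar> + ennreal \<bar>ln (norm (G x *v ?w)) - ln (norm (G' x *v ?w))\<bar> \<partial>N)"
  proof (rule nn_integral_mono_AE, use nonzero(1)[OF u(1)] nonzero(2)[OF u(2)] in eventually_elim)
    case (elim x)
    have ln_sc: "ln (norm (g *v ((1 / norm z) *\<^sub>R z))) = ln (norm (g *v z)) - ln (norm z)"
      if "g *v ((1 / norm z) *\<^sub>R z) \<noteq> 0" for g :: "real^'n^'n" and z
    proof -
      have "z \<noteq> 0" "g *v z \<noteq> 0" using that by (auto simp: matrix_vector_mult_scaleR)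
      then show ?thesis by (simp add: matrix_vector_mult_scaleR ln_divide_pos)
    qed
    have "\<bar>(ln (norm (G x *v v)) - ln (norm v)) - (ln (norm (G' x *v w)) - ln (norm w))\<bar> \<le>
        \<bar>ln (norm (G x *v ?v)) - ln (norm (G x *v ?w))\<bar> + \<bar>ln (norm (G x *v ?w)) - ln (norm (G' x *v ?w))\<bar>"
      unfolding ln_sc[OF elim(1), symmetric] ln_sc[OF elim(2), symmetric] by linarith
    then show ?case by (simp add: ennreal_leI flip: ennreal_plus)
  qed
  also have "\<dots> = (\<integral>\<^sup>+x. ennreal \<bar>ln (norm (G x *v ?v)) - ln (norm (G x *v ?w))\<bar> \<partial>N) +
      (\<integral>\<^sup>+x. ennreal \<bar>ln (norm (G x *v ?w)) - ln (norm (G' x *v ?w))\<bar> \<partial>N)"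
    by (rule nn_integral_add) measurable
  also have "\<dots> \<le> ennreal ((4 + 4 * B) / a * sin_dist ?v ?w powr a) + ennreal (2 / a * (2 + 6 * B) * W powr (a / p))"
    by (intro add_mono ln_directions ln_images u a)
  also have "\<dots> = ennreal ((4 + 4 * B) / a * sin_dist v w powr a + 2 / a * (2 + 6 * B) * W powr (a / p))"
    unfolding sc0 using R0 a B by (intro ennreal_plus[symmetric] mult_nonneg_nonneg) auto
  finally show ?thesis .
qed

end

lemma distr_iid_map:
  assumes M: "prob_space M" and N: "prob_space N" and f [measurable]: "f \<in> measurable M N" and d: "distr M N f = N"
  shows "distr (iid M) (iid N) (\<lambda>\<omega> i. f (\<omega> i)) = iid N"
proof -
  interpret M: sequence_space M
    by (simp add: sequence_space_def product_prob_space_def product_prob_space_axioms_def product_sigma_finite_def M prob_space_imp_sigma_finite)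
  interpret N: sequence_space N
    by (simp add: sequence_space_def product_prob_space_def product_prob_space_axioms_def product_sigma_finite_def N prob_space_imp_sigma_finite)
  have meas: "(\<lambda>\<omega> i. f (\<omega> i)) \<in> measurable (iid M) (iid N)"
    by (rule measurable_PiM_single') (use measurable_space[OF f] in \<open>auto simp: space_PiM PiE_iff\<close>)
  show ?thesis
  proof (rule N.PiM_eq)
    fix J :: "nat set" and F assume J: "finite J" "J \<subseteq> UNIV" "\<And>j. j \<in> J \<Longrightarrow> F j \<in> sets N"
    let ?E = "prod_emb UNIV (\<lambda>_. N) J (\<Pi>\<^sub>E j\<in>J. F j)"
    have "emeasure (distr (iid M) (iid N) (\<lambda>\<omega> i. f (\<omega> i))) ?E =
        emeasure (iid M) ((\<lambda>\<omega> i. f (\<omega> i)) -` ?E \<inter> space (iid M))"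
      using J by (intro emeasure_distr meas sets_PiM_I) auto
    also have "(\<lambda>\<omega> i. f (\<omega> i)) -` ?E \<inter> space (iid M) = {\<omega> \<in> space (iid M). \<forall>j\<in>J. \<omega> j \<in> f -` F j \<inter> space M}"
      using measurable_space[OF f] by (auto simp: prod_emb_def space_PiM PiE_iff extensional_def restrict_def)
    also have "emeasure (iid M) \<dots> = (\<Prod>j\<in>J. emeasure M (f -` F j \<inter> space M))"
      using J by (intro M.emeasure_PiM_Collect) (auto intro: measurable_sets[OF f])
    also have "\<dots> = (\<Prod>j\<in>J. emeasure N (F j))"
    proof (rule prod.cong)
      fix j assume "j \<in> J"
      then have "emeasure (distr M N f) (F j) = emeasure M (f -` F j \<inter> space M)"
        using J by (intro emeasure_distr f) auto
      then show "emeasure M (f -` F j \<inter> space M) = emeasure N (F j)" by (simp add: d)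
    qed simp
    finally show "emeasure (distr (iid M) (iid N) (\<lambda>\<omega> i. f (\<omega> i))) ?E = (\<Prod>j\<in>J. emeasure N (F j))" .
  qed simp
qed

lemma (in matrix_walk)
  assumes \<pi>: "prob_space \<pi>" and f [measurable]: "f \<in> measurable \<pi> M" and d: "distr \<pi> M f = M"
  shows cocycle_image_measurable: "(\<lambda>\<omega>. cocycle n (\<lambda>i. f (\<omega> i))) \<in> borel_measurable (iid \<pi>)"
    and distr_cocycle_image: "distr (iid \<pi>) borel (\<lambda>\<omega>. cocycle n (\<lambda>i. f (\<omega> i))) = distr S borel (cocycle n)"
proof -
  have path: "(\<lambda>\<omega> i. f (\<omega> i)) \<in> measurable (iid \<pi>) S"
    by (rule measurable_PiM_single') (auto simp: space_PiM PiE_iff space_M)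
  show "(\<lambda>\<omega>. cocycle n (\<lambda>i. f (\<omega> i))) \<in> borel_measurable (iid \<pi>)"
    by (rule measurable_compose[OF path cocycle_measurable])
  have "distr S borel (cocycle n) = distr (distr (iid \<pi>) S (\<lambda>\<omega> i. f (\<omega> i))) borel (cocycle n)"
    by (subst distr_iid_map[OF \<pi> M.prob_space_axioms f d]) (rule refl)
  also have "\<dots> = distr (iid \<pi>) borel (\<lambda>\<omega>. cocycle n (\<lambda>i. f (\<omega> i)))"
    using distr_distr[OF cocycle_measurable path] by (simp add: comp_def)
  finally show "distr (iid \<pi>) borel (\<lambda>\<omega>. cocycle n (\<lambda>i. f (\<omega> i))) = distr S borel (cocycle n)" ..
qed

lemma equal_distr_transfer:
  fixes A :: "'a \<Rightarrow> 'c::topological_space" and h :: "'c \<Rightarrow> real"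
  assumes A: "A \<in> borel_measurable M" and B: "B \<in> borel_measurable N" and d: "distr M borel A = distr N borel B"
  shows "g \<in> borel_measurable borel \<Longrightarrow> (\<integral>\<^sup>+x. g (A x) \<partial>M) = (\<integral>\<^sup>+x. g (B x) \<partial>N)"
    and "Measurable.pred borel Q \<Longrightarrow> (AE x in M. Q (A x)) \<longleftrightarrow> (AE x in N. Q (B x))"
    and "h \<in> borel_measurable borel \<Longrightarrow> (\<integral>x. h (A x) \<partial>M) = (\<integral>x. h (B x) \<partial>N)"
    and "h \<in> borel_measurable borel \<Longrightarrow> integrable M (\<lambda>x. h (A x)) \<longleftrightarrow> integrable N (\<lambda>x. h (B x))"
proof -
  show "(\<integral>\<^sup>+x. g (A x) \<partial>M) = (\<integral>\<^sup>+x. g (B x) \<partial>N)" if "g \<in> borel_measurable borel"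
    using nn_integral_distr[OF A, of g] nn_integral_distr[OF B, of g] that by (simp add: d)
  show "(AE x in M. Q (A x)) \<longleftrightarrow> (AE x in N. Q (B x))" if "Measurable.pred borel Q"
  proof -
    have Q: "{x \<in> space borel. Q x} \<in> sets borel" by (rule predE[OF that])
    show ?thesis using AE_distr_iff[OF A Q] AE_distr_iff[OF B Q] unfolding d by blast
  qed
  show "(\<integral>x. h (A x) \<partial>M) = (\<integral>x. h (B x) \<partial>N)" if "h \<in> borel_measurable borel"
    using integral_distr[OF A, of h] integral_distr[OF B, of h] that by (simp add: d)
  show "integrable M (\<lambda>x. h (A x)) \<longleftrightarrow> integrable N (\<lambda>x. h (B x))" if "h \<in> borel_measurable borel"
    using integrable_distr_eq[OF A, of h] integrable_distr_eq[OF B, of h] that by (simp add: d)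
qed

text \<open>
  Independent draws from a coupling \<open>\<pi>\<close> of \<open>\<mu>\<close> and \<open>\<nu>\<close> whose cost is at most \<open>W\<close>.
\<close>

locale coupled_walk = X: moment_walk \<mu> p C + Y: moment_walk \<nu> p C
  for \<mu> \<nu> :: "(real^'n^'n) measure" and p C :: real +
  fixes \<pi> :: "((real^'n^'n) \<times> (real^'n^'n)) measure" and W :: real
  assumes coupling: "\<pi> \<in> couplings \<mu> \<nu>"
    and cost: "(\<integral>\<^sup>+z. ennreal (opnorm (fst z - snd z) powr p) \<partial>\<pi>) \<le> ennreal W" and W: "0 < W"

sublocale coupled_walk \<subseteq> Z: sequence_space \<pi>
  using coupling
  by (simp add: couplings_def sequence_space_def product_prob_space_def product_prob_space_axioms_def
      product_sigma_finite_def prob_space_imp_sigma_finite)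

context coupled_walk
begin

abbreviation "S \<equiv> (\<Pi>\<^sub>M i\<in>(UNIV::nat set). \<pi>)"

lemma sets_coupling [measurable_cong]: "sets \<pi> = sets (borel \<Otimes>\<^sub>M borel)"
proof -
  have "sets \<pi> = sets (\<mu> \<Otimes>\<^sub>M \<nu>)" using coupling by (simp add: couplings_def)
  also have "\<dots> = sets (borel \<Otimes>\<^sub>M borel)" by (rule sets_pair_measure_cong[OF X.sets_M Y.sets_M])
  finally show ?thesis .
qed

definition left :: "nat \<Rightarrow> (nat \<Rightarrow> (real^'n^'n) \<times> (real^'n^'n)) \<Rightarrow> real^'n^'n" where
  "left n \<omega> = cocycle n (\<lambda>i. fst (\<omega> i))"

definition right :: "nat \<Rightarrow> (nat \<Rightarrow> (real^'n^'n) \<times> (real^'n^'n)) \<Rightarrow> real^'n^'n" where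
  "right n \<omega> = cocycle n (\<lambda>i. snd (\<omega> i))"

lemma left_measurable [measurable]: "left n \<in> borel_measurable S"
  and distr_left: "distr S borel (left n) = distr (iid \<mu>) borel (cocycle n)"
proof -
  have "fst \<in> measurable \<pi> \<mu>" by measurable
  with coupling show "left n \<in> borel_measurable S" "distr S borel (left n) = distr (iid \<mu>) borel (cocycle n)"
    unfolding left_def[abs_def] couplings_def
    by (auto intro!: X.cocycle_image_measurable X.distr_cocycle_image)
qed

lemma right_measurable [measurable]: "right n \<in> borel_measurable S"
  and distr_right: "distr S borel (right n) = distr (iid \<nu>) borel (cocycle n)"
proof -
  have "snd \<in> measurable \<pi> \<nu>" by measurable
  with coupling show "right n \<in> borel_measurable S" "distr S borel (right n) = distr (iid \<nu>) borel (cocycle n)"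
    unfolding right_def[abs_def] couplings_def
    by (auto intro!: Y.cocycle_image_measurable Y.distr_cocycle_image)
qed

lemmas transfer_left = equal_distr_transfer[OF left_measurable X.cocycle_measurable distr_left]
lemmas transfer_right = equal_distr_transfer[OF right_measurable Y.cocycle_measurable distr_right]

lemma AE_left_nonzero: "v \<noteq> 0 \<Longrightarrow> AE \<omega> in S. left n \<omega> *v v \<noteq> 0"
  using X.AE_cocycle_nonzero[of v n] by (subst transfer_left(2)[of "\<lambda>g. g *v v \<noteq> 0"]) auto

lemma AE_right_nonzero: "v \<noteq> 0 \<Longrightarrow> AE \<omega> in S. right n \<omega> *v v \<noteq> 0"
  using Y.AE_cocycle_nonzero[of v n] by (subst transfer_right(2)[of "\<lambda>g. g *v v \<noteq> 0"]) auto

lemma left_comb_seq: "left (m + n) (comb_seq m \<omega> \<omega>') = left n \<omega>' ** left m \<omega>"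
  and right_comb_seq: "right (m + n) (comb_seq m \<omega> \<omega>') = right n \<omega>' ** right m \<omega>"
proof -
  have "(\<lambda>i. f (comb_seq m \<omega> \<omega>' i)) = comb_seq m (\<lambda>i. f (\<omega> i)) (\<lambda>i. f (\<omega>' i))"
    for f :: "(real^'n^'n) \<times> (real^'n^'n) \<Rightarrow> real^'n^'n"
    by (auto simp: comb_seq_def)
  then show "left (m + n) (comb_seq m \<omega> \<omega>') = left n \<omega>' ** left m \<omega>"
    "right (m + n) (comb_seq m \<omega> \<omega>') = right n \<omega>' ** right m \<omega>"
    by (simp_all add: left_def right_def cocycle_add cocycle_comb_seq shift_pow_comb_seq)
qed

text \<open>
  Replace one factor of the product at a time; the factors before and after it are independent of it and
  contribute their moments.
\<close>

lemma block_distance: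
  "(\<integral>\<^sup>+\<omega>. ennreal (opnorm (left n \<omega> - right n \<omega>) powr p) \<partial>S) \<le> ennreal (real n * C ^ n * W)"
proof (induction n)
  case 0 then show ?case by (simp add: left_def right_def)
next
  case (Suc n)
  have C0: "0 \<le> C" "0 \<le> C ^ n" using X.C by auto
  let ?D = "\<lambda>\<omega>. ennreal (opnorm (left n \<omega> - right n \<omega>) powr p)"
  let ?d = "\<lambda>\<omega>. ennreal (opnorm (left (Suc 0) \<omega> - right (Suc 0) \<omega>) powr p)"
  let ?U = "\<lambda>\<omega>. ennreal (opnorm (left (Suc 0) \<omega>) powr p)"
  let ?V = "\<lambda>\<omega>. ennreal (opnorm (right n \<omega>) powr p)"
  have U: "(\<integral>\<^sup>+\<omega>. ?U \<omega> \<partial>S) \<le> ennreal C"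
    using transfer_left(1)[of "\<lambda>g. ennreal (opnorm g powr p)" "Suc 0"] X.moment_upper[of "Suc 0"] by simp
  have V: "(\<integral>\<^sup>+\<omega>. ?V \<omega> \<partial>S) \<le> ennreal (C ^ n)"
    using transfer_right(1)[of "\<lambda>g. ennreal (opnorm g powr p)" n] Y.moment_upper[of n] by simp
  have d: "(\<integral>\<^sup>+\<omega>. ?d \<omega> \<partial>S) \<le> ennreal W"
    using Z.nn_integral_coordinate[of "\<lambda>z. ennreal (opnorm (fst z - snd z) powr p)" 0] cost
    by (simp add: left_def right_def)
  have "(\<integral>\<^sup>+\<omega>. ennreal (opnorm (left (Suc n) \<omega> - right (Suc n) \<omega>) powr p) \<partial>S) =
      (\<integral>\<^sup>+\<omega>. \<integral>\<^sup>+\<omega>'. ennreal (opnorm (left (Suc 0) \<omega>' ** left n \<omega> - right (Suc 0) \<omega>' ** right n \<omega>) powr p) \<partial>S \<partial>S)"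
    using left_comb_seq[of n "Suc 0"] right_comb_seq[of n "Suc 0"]
    by (subst Z.nn_integral_split[of _ n]) auto
  also have "\<dots> \<le> (\<integral>\<^sup>+\<omega>. \<integral>\<^sup>+\<omega>'. ?U \<omega>' * ?D \<omega> + ?d \<omega>' * ?V \<omega> \<partial>S \<partial>S)"
  proof (intro nn_integral_mono)
    fix \<omega> \<omega>'
    let ?g = "left (Suc 0) \<omega>'" and ?h = "right (Suc 0) \<omega>'" and ?A = "left n \<omega>" and ?B = "right n \<omega>"
    have "?g ** ?A - ?h ** ?B = ?g ** (?A - ?B) + (?g - ?h) ** ?B"
      by (simp add: vec_eq_iff matrix_matrix_mult_def sum_subtractf sum.distrib algebra_simps)
    then have "opnorm (?g ** ?A - ?h ** ?B) \<le> opnorm ?g * opnorm (?A - ?B) + opnorm (?g - ?h) * opnorm ?B"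
      using opnorm_add[of "?g ** (?A - ?B)" "(?g - ?h) ** ?B"] opnorm_mult[of ?g "?A - ?B"] opnorm_mult[of "?g - ?h" ?B] by simp
    then have "opnorm (?g ** ?A - ?h ** ?B) powr p \<le> (opnorm ?g * opnorm (?A - ?B) + opnorm (?g - ?h) * opnorm ?B) powr p"
      using X.p by (intro powr_mono2) (auto simp: opnorm_nonneg)
    also have "\<dots> \<le> (opnorm ?g * opnorm (?A - ?B)) powr p + (opnorm (?g - ?h) * opnorm ?B) powr p"
      using X.p by (intro powr_add_le_add_powr) (auto simp: opnorm_nonneg)
    also have "\<dots> = opnorm ?g powr p * opnorm (?A - ?B) powr p + opnorm (?g - ?h) powr p * opnorm ?B powr p"
      by (simp add: powr_mult opnorm_nonneg)
    finally have "ennreal (opnorm (?g ** ?A - ?h ** ?B) powr p) \<le>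
        ennreal (opnorm ?g powr p * opnorm (?A - ?B) powr p + opnorm (?g - ?h) powr p * opnorm ?B powr p)" by (rule ennreal_leI)
    also have "\<dots> = ?U \<omega>' * ?D \<omega> + ?d \<omega>' * ?V \<omega>" by (rule ennreal_linear) auto
    finally show "ennreal (opnorm (?g ** ?A - ?h ** ?B) powr p) \<le> ?U \<omega>' * ?D \<omega> + ?d \<omega>' * ?V \<omega>" .
  qed
  also have "\<dots> = (\<integral>\<^sup>+\<omega>. (\<integral>\<^sup>+\<omega>'. ?U \<omega>' \<partial>S) * ?D \<omega> + (\<integral>\<^sup>+\<omega>'. ?d \<omega>' \<partial>S) * ?V \<omega> \<partial>S)"
    by (simp add: nn_integral_add nn_integral_multc)
  also have "\<dots> = (\<integral>\<^sup>+\<omega>'. ?U \<omega>' \<partial>S) * (\<integral>\<^sup>+\<omega>. ?D \<omega> \<partial>S) + (\<integral>\<^sup>+\<omega>'. ?d \<omega>' \<partial>S) * (\<integral>\<^sup>+\<omega>. ?V \<omega> \<partial>S)"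
    by (simp add: nn_integral_add nn_integral_cmult)
  also have "\<dots> \<le> ennreal C * ennreal (real n * C ^ n * W) + ennreal W * ennreal (C ^ n)"
    by (intro add_mono mult_mono U V d Suc) auto
  also have "\<dots> = ennreal (C * (real n * C ^ n * W) + W * C ^ n)"
    using C0 W by (intro ennreal_linear[symmetric]) auto
  also have "\<dots> \<le> ennreal (real (Suc n) * C ^ Suc n * W)"
  proof (rule ennreal_leI)
    have "W * C ^ n * 1 \<le> W * C ^ n * C" using W C0 X.C by (intro mult_left_mono) auto
    then show "C * (real n * C ^ n * W) + W * C ^ n \<le> real (Suc n) * C ^ Suc n * W" by (simp add: algebra_simps)
  qed
  finally show ?case .
qed

lemma block_pair:
  assumes n: "1 \<le> n"
  shows "matrix_pair S (left n) (right n) p (C ^ n) (real n * C ^ n * W)"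
proof unfold_locales
  fix v :: "real^'n" assume v: "norm v = 1"
  then have v0: "v \<noteq> 0" by auto
  show "AE x in S. left n x *v v \<noteq> 0" by (rule AE_left_nonzero[OF v0])
  show "AE x in S. right n x *v v \<noteq> 0" by (rule AE_right_nonzero[OF v0])
  show "(\<integral>\<^sup>+x. ennreal (norm (left n x *v v) powr (- p)) \<partial>S) \<le> ennreal (C ^ n)"
    using transfer_left(1)[of "\<lambda>g. ennreal (norm (g *v v) powr (- p))" n] X.moment_lower[OF v0, of n] v by simp
  show "(\<integral>\<^sup>+x. ennreal (norm (right n x *v v) powr (- p)) \<partial>S) \<le> ennreal (C ^ n)"
    using transfer_right(1)[of "\<lambda>g. ennreal (norm (g *v v) powr (- p))" n] Y.moment_lower[OF v0, of n] v by simp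
next
  show "(\<integral>\<^sup>+x. ennreal (opnorm (left n x) powr p) \<partial>S) \<le> ennreal (C ^ n)"
    using transfer_left(1)[of "\<lambda>g. ennreal (opnorm g powr p)" n] X.moment_upper[of n] by simp
  show "(\<integral>\<^sup>+x. ennreal (opnorm (right n x) powr p) \<partial>S) \<le> ennreal (C ^ n)"
    using transfer_right(1)[of "\<lambda>g. ennreal (opnorm g powr p)" n] Y.moment_upper[of n] by simp
  show "(\<integral>\<^sup>+x. ennreal (opnorm (left n x - right n x) powr p) \<partial>S) \<le> ennreal (real n * C ^ n * W)"
    by (rule block_distance)
qed (use X.p X.C W n in auto)

text \<open>
  Let \<open>e\<^sub>k\<close> be the mean \<open>a\<close>-th power of the angle between the two vectors after \<open>k\<close> blocks. A block gives
  \<open>e\<^sub>k\<^sub>+\<^sub>1 \<le> \<kappa> * e\<^sub>k + R\<close>, hence \<open>e\<^sub>k \<le> \<kappa> ^ k + R / (1 - \<kappa>)\<close>, and it changes the logarithmic distance of the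
  norms by at most \<open>K * e\<^sub>k + 2 / a * R\<close> in the mean. So the initial angle costs a constant, and afterwards
  each block costs a multiple of \<open>R\<close>.
\<close>

lemma chain_estimate:
  assumes n: "1 \<le> n" and a: "0 < a" "a \<le> p / 2" and \<kappa>: "0 \<le> \<kappa>" "\<kappa> < 1"
    and contr: "\<And>v. norm v = 1 \<Longrightarrow> (\<integral>\<^sup>+\<omega>. ennreal (area_ratio a (left n \<omega>) v) \<partial>S) \<le> ennreal \<kappa>"
    and v: "norm v = 1" and w: "norm w = 1"
  defines "R \<equiv> (2 + 6 * C ^ n) * (real n * C ^ n * W) powr (a / p)"
  defines "K \<equiv> (4 + 4 * C ^ n) / a"
  shows "(\<integral>\<^sup>+\<omega>. ennreal \<bar>ln (norm (left (k * n) \<omega> *v v)) - ln (norm (right (k * n) \<omega> *v w))\<bar> \<partial>S) \<le>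
    ennreal (K / (1 - \<kappa>) + real k * (K * R / (1 - \<kappa>) + 2 / a * R))"
proof -
  interpret B: matrix_pair S "left n" "right n" p "C ^ n" "real n * C ^ n * W" by (rule block_pair[OF n])
  have v0: "v \<noteq> 0" "w \<noteq> 0" using v w by auto
  have R0: "0 \<le> R" and K0: "0 \<le> K" using B.B a by (auto simp: R_def K_def)
  \<comment> \<open>The fixed point of the recursion for the angles.\<close>
  define q where "q = R / (1 - \<kappa>)"
  have q: "0 \<le> q" "\<kappa> * q + R = q" using \<kappa> R0 by (auto simp: q_def field_simps)
  let ?x = "\<lambda>k \<omega>. left (k * n) \<omega> *v v" and ?y = "\<lambda>k \<omega>. right (k * n) \<omega> *v w"
  have nz: "AE \<omega> in S. ?x k \<omega> \<noteq> 0 \<and> ?y k \<omega> \<noteq> 0" for k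
    using AE_left_nonzero[OF v0(1), of "k * n"] AE_right_nonzero[OF v0(2), of "k * n"] by simp
  have xs: "?x (Suc k) (comb_seq (k * n) \<omega> \<omega>') = left n \<omega>' *v ?x k \<omega>"
    "?y (Suc k) (comb_seq (k * n) \<omega> \<omega>') = right n \<omega>' *v ?y k \<omega>" for k \<omega> \<omega>'
    using left_comb_seq[of "k * n" n \<omega> \<omega>'] right_comb_seq[of "k * n" n \<omega> \<omega>']
    by (simp_all add: add.commute matrix_vector_mul_assoc)
  let ?e = "\<lambda>k. \<integral>\<^sup>+\<omega>. ennreal (sin_dist (?x k \<omega>) (?y k \<omega>) powr a) \<partial>S"
  let ?l = "\<lambda>k. \<integral>\<^sup>+\<omega>. ennreal \<bar>ln (norm (?x k \<omega>)) - ln (norm (?y k \<omega>))\<bar> \<partial>S"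
  have em [measurable]: "(\<lambda>\<omega>. sin_dist (?x k \<omega>) (?y k \<omega>) powr a) \<in> borel_measurable S" for k
    unfolding sin_dist_def wedge_norm_def by measurable
  have e: "?e k \<le> ennreal (\<kappa> ^ k + q)" for k
  proof (induction k)
    case 0
    have "?e 0 \<le> (\<integral>\<^sup>+\<omega>. 1 \<partial>S)"
      using powr_le1[of a] a by (intro nn_integral_mono) (auto simp: sin_dist_nonneg sin_dist_le_1)
    also have "\<dots> = ennreal 1" by (simp add: Z.P.emeasure_space_1)
    also have "\<dots> \<le> ennreal (\<kappa> ^ 0 + q)" using q by (intro ennreal_leI) simp
    finally show ?case .
  next
    case (Suc k)
    have "?e (Suc k) = (\<integral>\<^sup>+\<omega>. \<integral>\<^sup>+\<omega>'. ennreal (sin_dist (left n \<omega>' *v ?x k \<omega>) (right n \<omega>' *v ?y k \<omega>) powr a) \<partial>S \<partial>S)"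
      by (subst Z.nn_integral_split[of _ "k * n"]) (measurable, simp only: xs)
    also have "\<dots> \<le> (\<integral>\<^sup>+\<omega>. ennreal R + ennreal \<kappa> * ennreal (sin_dist (?x k \<omega>) (?y k \<omega>) powr a) \<partial>S)"
    proof (rule nn_integral_mono_AE, use nz[of k] in eventually_elim)
      case (elim \<omega>)
      have "(\<integral>\<^sup>+\<omega>'. ennreal (sin_dist (left n \<omega>' *v ?x k \<omega>) (right n \<omega>' *v ?y k \<omega>) powr a) \<partial>S) \<le>
          ennreal (\<kappa> * sin_dist (?x k \<omega>) (?y k \<omega>) powr a + R)"
        unfolding R_def using elim by (intro B.sin_dist_step a \<kappa> contr) auto
      also have "\<dots> = ennreal R + ennreal \<kappa> * ennreal (sin_dist (?x k \<omega>) (?y k \<omega>) powr a)"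
        by (subst add.commute) (rule ennreal_affine, use R0 \<kappa> in auto)
      finally show ?case .
    qed
    also have "\<dots> = ennreal R + ennreal \<kappa> * ?e k"
      by (simp add: nn_integral_add nn_integral_cmult Z.P.emeasure_space_1)
    also have "\<dots> \<le> ennreal R + ennreal \<kappa> * ennreal (\<kappa> ^ k + q)"
      by (intro add_left_mono mult_left_mono Suc) simp
    also have "\<dots> = ennreal (R + \<kappa> * (\<kappa> ^ k + q))"
      using R0 \<kappa> q by (intro ennreal_affine[symmetric]) auto
    also have "R + \<kappa> * (\<kappa> ^ k + q) = \<kappa> ^ Suc k + q" using q(2) by (simp add: algebra_simps)
    finally show ?case .
  qed
  have "?l k \<le> ennreal ((\<Sum>j<k. K * \<kappa> ^ j) + real k * (K * q + 2 / a * R))" for k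
  proof (induction k)
    case 0 then show ?case using v w by (simp add: left_def right_def)
  next
    case (Suc k)
    let ?t = "(\<Sum>j<k. K * \<kappa> ^ j) + real k * (K * q + 2 / a * R)"
    have t0: "0 \<le> ?t" using K0 \<kappa> q R0 a by (intro add_nonneg_nonneg sum_nonneg mult_nonneg_nonneg) auto
    have "?l (Suc k) = (\<integral>\<^sup>+\<omega>. \<integral>\<^sup>+\<omega>'. ennreal \<bar>ln (norm (left n \<omega>' *v ?x k \<omega>)) - ln (norm (right n \<omega>' *v ?y k \<omega>))\<bar> \<partial>S \<partial>S)"
      by (subst Z.nn_integral_split[of _ "k * n"]) (measurable, simp only: xs)
    also have "\<dots> \<le> (\<integral>\<^sup>+\<omega>. ennreal \<bar>ln (norm (?x k \<omega>)) - ln (norm (?y k \<omega>))\<bar> +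
        (ennreal (2 / a * R) + ennreal K * ennreal (sin_dist (?x k \<omega>) (?y k \<omega>) powr a)) \<partial>S)"
    proof (rule nn_integral_mono_AE, use nz[of k] in eventually_elim)
      case (elim \<omega>)
      let ?\<Delta> = "\<bar>ln (norm (?x k \<omega>)) - ln (norm (?y k \<omega>))\<bar>"
      let ?i = "\<lambda>\<omega>'. \<bar>(ln (norm (left n \<omega>' *v ?x k \<omega>)) - ln (norm (?x k \<omega>))) - (ln (norm (right n \<omega>' *v ?y k \<omega>)) - ln (norm (?y k \<omega>)))\<bar>"
      have "(\<integral>\<^sup>+\<omega>'. ennreal \<bar>ln (norm (left n \<omega>' *v ?x k \<omega>)) - ln (norm (right n \<omega>' *v ?y k \<omega>))\<bar> \<partial>S) \<le>
          (\<integral>\<^sup>+\<omega>'. ennreal ?\<Delta> + ennreal (?i \<omega>') \<partial>S)"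
      proof (rule nn_integral_mono)
        fix \<omega>'
        have "\<bar>ln (norm (left n \<omega>' *v ?x k \<omega>)) - ln (norm (right n \<omega>' *v ?y k \<omega>))\<bar> \<le> ?\<Delta> + ?i \<omega>'" by linarith
        then show "ennreal \<bar>ln (norm (left n \<omega>' *v ?x k \<omega>)) - ln (norm (right n \<omega>' *v ?y k \<omega>))\<bar> \<le> ennreal ?\<Delta> + ennreal (?i \<omega>')"
          by (simp add: ennreal_leI flip: ennreal_plus)
      qed
      also have "\<dots> = ennreal ?\<Delta> + (\<integral>\<^sup>+\<omega>'. ennreal (?i \<omega>') \<partial>S)"
        by (simp add: nn_integral_add Z.P.emeasure_space_1)
      also have "\<dots> \<le> ennreal ?\<Delta> + ennreal (K * sin_dist (?x k \<omega>) (?y k \<omega>) powr a + 2 / a * (2 + 6 * C ^ n) * (real n * C ^ n * W) powr (a / p))"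
        unfolding K_def using elim by (intro add_left_mono B.ln_step a) auto
      also have "ennreal (K * sin_dist (?x k \<omega>) (?y k \<omega>) powr a + 2 / a * (2 + 6 * C ^ n) * (real n * C ^ n * W) powr (a / p)) =
          ennreal (2 / a * R + K * sin_dist (?x k \<omega>) (?y k \<omega>) powr a)"
        by (simp only: R_def mult.assoc add.commute)
      also have "\<dots> = ennreal (2 / a * R) + ennreal K * ennreal (sin_dist (?x k \<omega>) (?y k \<omega>) powr a)"
        using a R0 K0 by (intro ennreal_affine) auto
      finally show ?case .
    qed
    also have "\<dots> = ?l k + (ennreal (2 / a * R) + ennreal K * ?e k)"
      by (simp add: nn_integral_add nn_integral_cmult Z.P.emeasure_space_1)
    also have "\<dots> \<le> ennreal ?t + (ennreal (2 / a * R) + ennreal K * ennreal (\<kappa> ^ k + q))"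
      by (intro add_mono Suc mult_left_mono e order_refl) simp
    also have "ennreal (2 / a * R) + ennreal K * ennreal (\<kappa> ^ k + q) = ennreal (2 / a * R + K * (\<kappa> ^ k + q))"
      using a R0 K0 \<kappa> q by (intro ennreal_affine[symmetric]) auto
    also have "ennreal ?t + \<dots> = ennreal (?t + (2 / a * R + K * (\<kappa> ^ k + q)))"
      using t0 a R0 K0 \<kappa> q by (intro ennreal_plus[symmetric]) auto
    also have "?t + (2 / a * R + K * (\<kappa> ^ k + q)) = (\<Sum>j<Suc k. K * \<kappa> ^ j) + real (Suc k) * (K * q + 2 / a * R)"
      by (simp add: algebra_simps add_divide_distrib)
    finally show ?case .
  qed
  also have "ennreal ((\<Sum>j<k. K * \<kappa> ^ j) + real k * (K * q + 2 / a * R)) \<le> ennreal (K / (1 - \<kappa>) + real k * (K * R / (1 - \<kappa>) + 2 / a * R))"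
  proof (rule ennreal_leI)
    have "(\<Sum>j<k. K * \<kappa> ^ j) = K * (\<Sum>j<k. \<kappa> ^ j)" by (simp add: sum_distrib_left)
    also have "(\<Sum>j<k. \<kappa> ^ j) = (1 - \<kappa> ^ k) / (1 - \<kappa>)" using \<kappa> by (simp add: sum_gp_strict)
    also have "K * \<dots> \<le> K * (1 / (1 - \<kappa>))" using \<kappa> K0 by (intro mult_left_mono divide_right_mono) auto
    finally show "(\<Sum>j<k. K * \<kappa> ^ j) + real k * (K * q + 2 / a * R) \<le> K / (1 - \<kappa>) + real k * (K * R / (1 - \<kappa>) + 2 / a * R)"
      by (simp add: q_def)
  qed
  finally show ?thesis .
qed

end

text \<open>
  Up to a factor \<open>CARD('n)\<close>, the operator norm is attained at a coordinate vector.
\<close>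

lemma ln_opnorm_le_vector:
  fixes g :: "real^'n^'n" and z :: real
  assumes "0 < z" and nz: "\<And>i. g *v axis i 1 \<noteq> 0"
  shows "ln (opnorm g) \<le> ln z + ln (real CARD('n)) + (\<Sum>i\<in>UNIV. \<bar>ln (norm (g *v axis i 1)) - ln z\<bar>)"
proof -
  let ?d = "\<lambda>i. \<bar>ln (norm (g *v axis i 1)) - ln z\<bar>"
  have le: "norm (g *v axis i 1) \<le> z * exp (\<Sum>i\<in>UNIV. ?d i)" for i
  proof -
    have "ln (norm (g *v axis i 1)) \<le> ln z + ?d i" by linarith
    also have "?d i \<le> (\<Sum>i\<in>UNIV. ?d i)" by (rule member_le_sum) auto
    finally have "exp (ln (norm (g *v axis i 1))) \<le> exp (ln z + (\<Sum>i\<in>UNIV. ?d i))" by simp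
    then show ?thesis using assms(1) nz[of i] by (simp add: exp_add)
  qed
  have "0 < norm (g *v axis undefined 1)" using nz by simp
  also have "\<dots> \<le> opnorm g" using norm_matrix_vector_le[of g "axis undefined 1"] by simp
  finally have pos: "0 < opnorm g" .
  have "opnorm g \<le> (\<Sum>i\<in>UNIV. norm (g *v axis i 1))" by (rule opnorm_le_sum_axis)
  also have "\<dots> \<le> (\<Sum>i\<in>(UNIV::'n set). z * exp (\<Sum>i\<in>UNIV. ?d i))" by (intro sum_mono le)
  also have "\<dots> = real CARD('n) * (z * exp (\<Sum>i\<in>UNIV. ?d i))" by simp
  finally have "ln (opnorm g) \<le> ln (real CARD('n) * (z * exp (\<Sum>i\<in>UNIV. ?d i)))" using pos by (rule ln_mono)
  also have "\<dots> = ln (real CARD('n)) + (ln z + (\<Sum>i\<in>UNIV. ?d i))" using assms(1) by (simp add: ln_mult_pos)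
  finally show ?thesis by simp
qed

lemma (in prob_space) expected_ln_opnorm_le:
  fixes G H :: "'a \<Rightarrow> real^'n^'n"
  assumes int: "integrable M (\<lambda>x. ln (opnorm (G x)))" "integrable M (\<lambda>x. ln (opnorm (H x)))"
    and intv: "\<And>v. norm v = 1 \<Longrightarrow> integrable M (\<lambda>x. ln (norm (G x *v v)))" "\<And>v. norm v = 1 \<Longrightarrow> integrable M (\<lambda>x. ln (norm (H x *v v)))"
    and nz: "\<And>v. v \<noteq> 0 \<Longrightarrow> AE x in M. G x *v v \<noteq> 0" "\<And>v. v \<noteq> 0 \<Longrightarrow> AE x in M. H x *v v \<noteq> 0"
    and le: "\<And>v w. norm v = 1 \<Longrightarrow> norm w = 1 \<Longrightarrow> (\<integral>\<^sup>+x. ennreal \<bar>ln (norm (G x *v v)) - ln (norm (H x *v w))\<bar> \<partial>M) \<le> ennreal b"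
    and b0: "0 \<le> b"
  shows "(\<integral>x. ln (opnorm (G x)) \<partial>M) \<le> (\<integral>x. ln (opnorm (H x)) \<partial>M) + ln (real CARD('n)) + real CARD('n) * b"
proof -
  define e :: "real^'n" where "e = axis undefined 1"
  have e: "norm e = 1" "e \<noteq> 0" by (auto simp: e_def axis_eq_0_iff)
  have ax: "norm (axis i 1 :: real^'n) = 1" "(axis i 1 :: real^'n) \<noteq> 0" for i by (auto simp: axis_eq_0_iff)
  let ?d = "\<lambda>i x. \<bar>ln (norm (G x *v axis i 1)) - ln (norm (H x *v e))\<bar>"
  have intd: "integrable M (?d i)" for i using intv(1)[OF ax(1)] intv(2)[OF e(1)] by simp
  have d_le: "(\<integral>x. ?d i x \<partial>M) \<le> b" for i
    using integral_le_of_nn_integral[of "?d i" "?d i" M b] le[OF ax(1) e(1)] b0 by simp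
  have "AE x in M. \<forall>i\<in>UNIV. G x *v axis i 1 \<noteq> 0" by (intro AE_finite_allI nz(1) ax) simp
  then have pt: "AE x in M. ln (opnorm (G x)) \<le> ln (opnorm (H x)) + ln (real CARD('n)) + (\<Sum>i\<in>UNIV. ?d i x)"
    using nz(2)[OF e(2)]
  proof eventually_elim
    case (elim x)
    then have pos: "0 < norm (H x *v e)" by simp
    have "ln (norm (H x *v e)) \<le> ln (opnorm (H x))"
      using norm_matrix_vector_le[of "H x" e] e by (intro ln_mono pos) simp
    then show ?case using ln_opnorm_le_vector[OF pos, of "G x"] elim(1) by simp
  qed
  have "(\<integral>x. ln (opnorm (G x)) \<partial>M) \<le> (\<integral>x. ln (opnorm (H x)) + ln (real CARD('n)) + (\<Sum>i\<in>UNIV. ?d i x) \<partial>M)"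
    by (rule integral_mono_AE[OF int(1) _ pt]) (use int(2) intd in auto)
  also have "\<dots> = (\<integral>x. ln (opnorm (H x)) \<partial>M) + ln (real CARD('n)) + (\<Sum>i\<in>UNIV. \<integral>x. ?d i x \<partial>M)"
    using int(2) intd by (simp add: prob_space)
  also have "\<dots> \<le> (\<integral>x. ln (opnorm (H x)) \<partial>M) + ln (real CARD('n)) + (\<Sum>i\<in>(UNIV :: 'n set). b)"
    by (intro add_left_mono sum_mono d_le)
  finally show ?thesis by simp
qed

context coupled_walk
begin

lemma expected_ln_norm_compare:
  assumes b0: "0 \<le> b"
    and est: "\<And>v w. norm v = 1 \<Longrightarrow> norm w = 1 \<Longrightarrow>
      (\<integral>\<^sup>+\<omega>. ennreal \<bar>ln (norm (left n \<omega> *v v)) - ln (norm (right n \<omega> *v w))\<bar> \<partial>S) \<le> ennreal b"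
  shows "(\<integral>\<omega>. ln (opnorm (cocycle n \<omega>)) \<partial>iid \<mu>) \<le>
      (\<integral>\<omega>. ln (opnorm (cocycle n \<omega>)) \<partial>iid \<nu>) + ln (real CARD('n)) + real CARD('n) * b" (is ?le)
    and "(\<integral>\<omega>. ln (opnorm (cocycle n \<omega>)) \<partial>iid \<nu>) \<le>
      (\<integral>\<omega>. ln (opnorm (cocycle n \<omega>)) \<partial>iid \<mu>) + ln (real CARD('n)) + real CARD('n) * b" (is ?ge)
proof -
  let ?op = "\<lambda>g :: real^'n^'n. ln (opnorm g)" and ?nm = "\<lambda>v g. ln (norm (g *v v :: real^'n))"
  have int: "integrable S (\<lambda>\<omega>. ?op (left n \<omega>))" "integrable S (\<lambda>\<omega>. ?op (right n \<omega>))"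
    using transfer_left(4)[of ?op n] transfer_right(4)[of ?op n] X.integrable_ln_opnorm Y.integrable_ln_opnorm by simp_all
  have intv: "integrable S (\<lambda>\<omega>. ?nm v (left n \<omega>))" "integrable S (\<lambda>\<omega>. ?nm v (right n \<omega>))" if "norm v = 1" for v
    using transfer_left(4)[of "?nm v" n] transfer_right(4)[of "?nm v" n] X.integrable_ln_norm[OF that] Y.integrable_ln_norm[OF that] by simp_all
  have eq: "(\<integral>\<omega>. ?op (left n \<omega>) \<partial>S) = (\<integral>\<omega>. ?op (cocycle n \<omega>) \<partial>iid \<mu>)"
    "(\<integral>\<omega>. ?op (right n \<omega>) \<partial>S) = (\<integral>\<omega>. ?op (cocycle n \<omega>) \<partial>iid \<nu>)"
    by (simp_all add: transfer_left(3)[of ?op] transfer_right(3)[of ?op])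
  show ?le unfolding eq[symmetric]
    by (rule Z.P.expected_ln_opnorm_le[OF int intv AE_left_nonzero AE_right_nonzero est b0])
  show ?ge unfolding eq[symmetric]
  proof (rule Z.P.expected_ln_opnorm_le[OF int(2,1) intv(2,1) AE_right_nonzero AE_left_nonzero _ b0])
    fix v w :: "real^'n" assume "norm v = 1" "norm w = 1"
    then show "(\<integral>\<^sup>+\<omega>. ennreal \<bar>?nm v (right n \<omega>) - ?nm w (left n \<omega>)\<bar> \<partial>S) \<le> ennreal b"
      using est[of w v] by (simp add: abs_minus_commute)
  qed
qed

end

text \<open>
  Compare along the multiples of \<open>m * n\<close>, where \<open>E\<close> and \<open>E'\<close> are comparable and a bound on \<open>E' m\<close> carries over by
  subadditivity. The constant \<open>c\<close> disappears in the limit.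
\<close>

lemma growth_compare:
  fixes E E' :: "nat \<Rightarrow> real"
  assumes lower: "\<And>N. L * real N \<le> E N" and upper: "\<And>e. 0 < e \<Longrightarrow> \<exists>m\<ge>1. E' m < (L' + e) * real m"
    and sub: "\<And>j m. E' (j * m) \<le> real j * E' m"
    and le: "\<And>k. E (k * n) \<le> E' (k * n) + c + real k * d" and n: "1 \<le> n"
  shows "L \<le> L' + d / real n"
proof (rule field_le_epsilon)
  fix e :: real assume e: "0 < e"
  obtain m where m: "1 \<le> m" "E' m < (L' + e / 2) * real m" using upper[of "e / 2"] e by auto
  obtain j :: nat where j: "2 * \<bar>c\<bar> / e \<le> real j" "1 \<le> j"
    using real_arch_simple[of "max 1 (2 * \<bar>c\<bar> / e)"] by (auto simp: max_def split: if_splits)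
  define k where "k = j * m"
  define t where "t = real k * real n"
  have k1: "real j \<le> real k" using m(1) mult_left_mono[of 1 "real m" "real j"] by (simp add: k_def)
  have t1: "real j \<le> t" using k1 n mult_mono[of "real j" "real k" 1 "real n"] by (simp add: t_def)
  have t0: "0 < t" using t1 j(2) by linarith
  have "L * t \<le> E (k * n)" using lower[of "k * n"] by (simp add: t_def)
  also have "\<dots> \<le> E' (k * n) + c + real k * d" by (rule le)
  also have "E' (k * n) = E' ((j * n) * m)" by (simp add: k_def mult_ac)
  also have "\<dots> \<le> real (j * n) * E' m" by (rule sub)
  also have "\<dots> \<le> real (j * n) * ((L' + e / 2) * real m)" using m(2) by (intro mult_left_mono) auto
  also have "\<dots> = (L' + e / 2) * t" by (simp add: t_def k_def)
  also have "real k * d = d / real n * t" using n by (simp add: t_def)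
  also have "c \<le> e / 2 * t"
  proof -
    have "\<bar>c\<bar> \<le> e / 2 * real j" using j(1) e by (simp add: field_simps)
    also have "\<dots> \<le> e / 2 * t" using t1 e by (intro mult_left_mono) auto
    finally show ?thesis by simp
  qed
  finally have "L * t \<le> (L' + d / real n + e) * t" by (simp add: algebra_simps)
  then show "L \<le> L' + d / real n + e" using t0 by simp
qed

context coupled_walk
begin

lemma lyapunov_close:
  assumes n: "1 \<le> n" and a: "0 < a" "a \<le> p / 2" and \<kappa>: "0 \<le> \<kappa>" "\<kappa> < 1"
    and contr: "\<And>v. norm v = 1 \<Longrightarrow> (\<integral>\<^sup>+\<omega>. ennreal (area_ratio a (cocycle n \<omega>) v) \<partial>iid \<mu>) \<le> ennreal \<kappa>"
    and L: "lyapunov1 \<mu> = ereal L" and L': "lyapunov1 \<nu> = ereal L'"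
  defines "K \<equiv> ((4 + 4 * C ^ n) / a / (1 - \<kappa>) + 2 / a) * (2 + 6 * C ^ n) * (real n * C ^ n) powr (a / p)"
  shows "\<bar>L - L'\<bar> \<le> real CARD('n) * K * W powr (a / p)"
proof -
  define R where "R = (2 + 6 * C ^ n) * (real n * C ^ n * W) powr (a / p)"
  define c0 where "c0 = (4 + 4 * C ^ n) / a / (1 - \<kappa>)"
  define c1 where "c1 = (4 + 4 * C ^ n) / a * R / (1 - \<kappa>) + 2 / a * R"
  have C0: "0 \<le> C ^ n" using X.C by simp
  have R0: "0 \<le> R" using C0 by (simp add: R_def)
  have c: "0 \<le> c0" "0 \<le> c1" using C0 a \<kappa> R0 by (auto simp: c0_def c1_def intro!: add_nonneg_nonneg mult_nonneg_nonneg divide_nonneg_nonneg)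
  have c1: "c1 = K * W powr (a / p)"
  proof -
    have "(real n * C ^ n * W) powr (a / p) = (real n * C ^ n) powr (a / p) * W powr (a / p)"
      using C0 W by (simp add: powr_mult)
    then have R: "R = (2 + 6 * C ^ n) * (real n * C ^ n) powr (a / p) * W powr (a / p)" by (simp add: R_def)
    have "x * r / y + z * r = (x / y + z) * r" for x y z r :: real by (simp add: field_simps)
    from this[of "(4 + 4 * C ^ n) / a" R "1 - \<kappa>" "2 / a"]
    have "c1 = ((4 + 4 * C ^ n) / a / (1 - \<kappa>) + 2 / a) * R" by (simp only: c1_def)
    then show ?thesis by (simp only: R K_def mult.assoc)
  qed
  have contr': "(\<integral>\<^sup>+\<omega>. ennreal (area_ratio a (left n \<omega>) v) \<partial>S) \<le> ennreal \<kappa>" if "norm v = 1" for v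
    using transfer_left(1)[of "\<lambda>g. ennreal (area_ratio a g v)" n] contr[OF that] by simp
  have est: "(\<integral>\<^sup>+\<omega>. ennreal \<bar>ln (norm (left (k * n) \<omega> *v v)) - ln (norm (right (k * n) \<omega> *v w))\<bar> \<partial>S) \<le> ennreal (c0 + real k * c1)"
    if "norm v = 1" "norm w = 1" for k v w
    using chain_estimate[OF n a \<kappa> contr' that, of k] by (simp only: c0_def c1_def R_def)
  have nn: "0 \<le> c0 + real k * c1" for k using c by simp
  obtain l where l: "lyapunov1 \<mu> = ereal l"
    and lE: "\<And>n. l * real n \<le> (\<integral>\<omega>. ln (opnorm (cocycle n \<omega>)) \<partial>iid \<mu>)"
    "\<And>e. 0 < e \<Longrightarrow> \<exists>n\<ge>1. (\<integral>\<omega>. ln (opnorm (cocycle n \<omega>)) \<partial>iid \<mu>) < (l + e) * real n"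
    using X.furstenberg_kesten by blast
  obtain l' where l': "lyapunov1 \<nu> = ereal l'"
    and l'E: "\<And>n. l' * real n \<le> (\<integral>\<omega>. ln (opnorm (cocycle n \<omega>)) \<partial>iid \<nu>)"
    "\<And>e. 0 < e \<Longrightarrow> \<exists>n\<ge>1. (\<integral>\<omega>. ln (opnorm (cocycle n \<omega>)) \<partial>iid \<nu>) < (l' + e) * real n"
    using Y.furstenberg_kesten by blast
  have eq: "l = L" "l' = L'" using L L' l l' by simp_all
  let ?m = "real CARD('n)"
  have eqc: "?m * (c0 + real k * c1) = ?m * c0 + real k * (?m * c1)" for k by (simp add: algebra_simps)
  note comp = expected_ln_norm_compare[OF nn est]
  have "l \<le> l' + ?m * c1 / real n"
  proof (rule growth_compare[OF lE(1) l'E(2) Y.E.expectation_multiple_le[OF Y.subadditive_ln_opnorm] _ n])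
    fix k show "(\<integral>\<omega>. ln (opnorm (cocycle (k * n) \<omega>)) \<partial>iid \<mu>) \<le>
        (\<integral>\<omega>. ln (opnorm (cocycle (k * n) \<omega>)) \<partial>iid \<nu>) + (ln ?m + ?m * c0) + real k * (?m * c1)"
      using comp(1)[of k] eqc[of k] by linarith
  qed
  moreover have "l' \<le> l + ?m * c1 / real n"
  proof (rule growth_compare[OF l'E(1) lE(2) X.E.expectation_multiple_le[OF X.subadditive_ln_opnorm] _ n])
    fix k show "(\<integral>\<omega>. ln (opnorm (cocycle (k * n) \<omega>)) \<partial>iid \<nu>) \<le>
        (\<integral>\<omega>. ln (opnorm (cocycle (k * n) \<omega>)) \<partial>iid \<mu>) + (ln ?m + ?m * c0) + real k * (?m * c1)"
      using comp(2)[of k] eqc[of k] by linarith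
  qed
  moreover have "?m * c1 / real n \<le> ?m * c1"
  proof -
    have "?m * c1 / real n \<le> ?m * c1 / 1" using n c by (intro divide_left_mono) auto
    then show ?thesis by simp
  qed
  ultimately show ?thesis unfolding eq using c1 by (simp add: abs_le_iff mult.assoc)
qed

end

section \<open>Hoelder continuity of the first exponent\<close>

lemma coupled_walk_exists:
  fixes \<mu> \<nu> :: "(real^'n^'n) measure"
  assumes "moment_walk \<mu> p C" "moment_walk \<nu> p C" "wasserstein p \<mu> \<nu> < ennreal W"
  obtains \<pi> where "coupled_walk \<mu> \<nu> p C \<pi> W"
proof -
  have W: "0 < W"
  proof (rule ccontr)
    assume "\<not> 0 < W"
    then have "ennreal W = 0" by (simp add: ennreal_neg)
    then show False using assms(3) by simp
  qed
  obtain \<pi> where \<pi>: "\<pi> \<in> couplings \<mu> \<nu>" "(\<integral>\<^sup>+ (g, g'). ennreal (opnorm (g - g') powr p) \<partial>\<pi>) < ennreal W"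
    using assms(3) unfolding wasserstein_def INF_less_iff by blast
  have "coupled_walk \<mu> \<nu> p C \<pi> W"
    using assms(1,2) \<pi> W by (intro coupled_walk.intro coupled_walk_axioms.intro) (auto simp: case_prod_beta')
  then show thesis by (rule that)
qed

text \<open>
  The contraction condition for blocks of length \<open>n\<close> is stable: coupling \<open>\<nu>\<close> with \<open>\<mu>\<close> changes the mean by at most a power
  of the cost.
\<close>

lemma contraction_nearby:
  assumes "coupled_walk \<nu> \<mu> p C \<pi> W" and n: "1 \<le> n" and a: "0 < a" "7 * a \<le> p / 2" and \<kappa>: "0 \<le> \<kappa>"
    and contr: "\<And>v. norm v = 1 \<Longrightarrow> (\<integral>\<^sup>+\<omega>. ennreal (area_ratio a (cocycle n \<omega>) v) \<partial>iid \<mu>) \<le> ennreal \<kappa>"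
    and v: "norm v = 1"
  shows "(\<integral>\<^sup>+\<omega>. ennreal (area_ratio a (cocycle n \<omega>) v) \<partial>iid \<nu>) \<le>
    ennreal (\<kappa> + 4 * (2 + 6 * C ^ n) * (real n * C ^ n * W) powr (a / p))"
proof -
  interpret coupled_walk \<nu> \<mu> p C \<pi> W by fact
  interpret B: matrix_pair S "left n" "right n" p "C ^ n" "real n * C ^ n * W" by (rule block_pair[OF n])
  have "(\<integral>\<^sup>+\<omega>. ennreal (area_ratio a (cocycle n \<omega>) v) \<partial>iid \<nu>) = (\<integral>\<^sup>+\<omega>. ennreal (area_ratio a (left n \<omega>) v) \<partial>S)"
    using transfer_left(1)[of "\<lambda>g. ennreal (area_ratio a g v)" n] by simp
  also have "\<dots> \<le> (\<integral>\<^sup>+\<omega>. ennreal (area_ratio a (right n \<omega>) v) \<partial>S) + ennreal (4 * (2 + 6 * C ^ n) * (real n * C ^ n * W) powr (a / p))"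
    by (rule B.area_ratio_diff[OF v a])
  also have "(\<integral>\<^sup>+\<omega>. ennreal (area_ratio a (right n \<omega>) v) \<partial>S) \<le> ennreal \<kappa>"
    using transfer_right(1)[of "\<lambda>g. ennreal (area_ratio a g v)" n] contr[OF v] by simp
  finally show ?thesis using \<kappa> B.B by (simp add: add_right_mono)
qed

theorem theorem2p1:
  fixes p C :: real and \<mu> :: "(real ^ 'n ^ 'n) measure"
  assumes "0 < p" and "p \<le> 1" and "1 \<le> C"
    and "\<mu> \<in> moment_class p C"
    and "quasi_irreducible \<mu>"
    and "lyapunov1 \<mu> > lyapunov2 \<mu>"
  shows "\<exists>\<delta>::real. \<exists>K::real. \<exists>\<theta>::real. \<delta> > 0 \<and> \<theta> > 0 \<and>
    (\<forall>\<nu>\<in>moment_class p C. \<forall>\<nu>'\<in>moment_class p C.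
       wasserstein p \<nu> \<mu> < ennreal \<delta> \<longrightarrow> wasserstein p \<nu>' \<mu> < ennreal \<delta> \<longrightarrow>
       \<bar>lyapunov1 \<nu> - lyapunov1 \<nu>'\<bar> \<le> ereal (K * enn2real (wasserstein p \<nu> \<nu>') powr \<theta>))"
proof -
  have walk: "moment_walk \<nu> p C" if "\<nu> \<in> moment_class p C" for \<nu> :: "(real^'n^'n) measure"
    by (rule moment_walkI[OF assms(1-3) that])
  interpret M: moment_walk \<mu> p C by (rule walk[OF assms(4)])
  obtain n a \<kappa> where n: "1 \<le> n" and a: "0 < a" "a \<le> p / 14" and \<kappa>: "\<kappa> < 1" "0 \<le> \<kappa>"
    and contr: "\<And>v. norm v = 1 \<Longrightarrow> (\<integral>\<^sup>+\<omega>. ennreal (area_ratio a (cocycle n \<omega>) v) \<partial>iid \<mu>) \<le> ennreal \<kappa>"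
    using M.contracting_block[OF assms(5,6), of "p / 14"] assms(1) by auto
  define \<theta> where "\<theta> = a / p"
  have \<theta>: "0 < \<theta>" using a assms(1) by (simp add: \<theta>_def)
  define \<kappa>' where "\<kappa>' = (1 + \<kappa>) / 2"
  have \<kappa>': "0 \<le> \<kappa>'" "\<kappa>' < 1" using \<kappa> by (auto simp: \<kappa>'_def)
  define b where "b = 4 * (2 + 6 * C ^ n)"
  have b: "0 < b" using assms(3) by (simp add: b_def add_pos_nonneg)
  have Cn: "0 < real n * C ^ n" using n assms(3) by simp
  \<comment> \<open>Chosen so that the perturbation raises the contraction factor exactly from \<open>\<kappa>\<close> to \<open>\<kappa>'\<close>.\<close>
  define \<delta> where "\<delta> = ((1 - \<kappa>) / (2 * b)) powr (1 / \<theta>) / (real n * C ^ n)"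
  have \<delta>: "0 < \<delta>" using b \<kappa> Cn by (simp add: \<delta>_def)
  have "(real n * C ^ n * \<delta>) powr \<theta> = (1 - \<kappa>) / (2 * b)"
    using b \<kappa> \<theta> n assms(3) by (simp add: \<delta>_def powr_powr)
  then have \<delta>_small: "\<kappa> + b * (real n * C ^ n * \<delta>) powr \<theta> = \<kappa>'"
    using b by (simp add: \<kappa>'_def field_simps)
  define K where "K = real CARD('n) * (((4 + 4 * C ^ n) / a / (1 - \<kappa>') + 2 / a) * (2 + 6 * C ^ n) * (real n * C ^ n) powr (a / p))"
  have "\<bar>lyapunov1 \<nu> - lyapunov1 \<nu>'\<bar> \<le> ereal (K * enn2real (wasserstein p \<nu> \<nu>') powr \<theta>)"
    if \<nu>: "\<nu> \<in> moment_class p C" and \<nu>': "\<nu>' \<in> moment_class p C" and near: "wasserstein p \<nu> \<mu> < ennreal \<delta>" for \<nu> \<nu>'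
  proof -
    interpret N: moment_walk \<nu> p C by (rule walk[OF \<nu>])
    interpret N': moment_walk \<nu>' p C by (rule walk[OF \<nu>'])
    obtain L where L: "lyapunov1 \<nu> = ereal L" using N.furstenberg_kesten by blast
    obtain L' where L': "lyapunov1 \<nu>' = ereal L'" using N'.furstenberg_kesten by blast
    obtain \<pi>0 where \<pi>0: "coupled_walk \<nu> \<mu> p C \<pi>0 \<delta>" by (rule coupled_walk_exists[OF walk[OF \<nu>] walk[OF assms(4)] near])
    have contr': "(\<integral>\<^sup>+\<omega>. ennreal (area_ratio a (cocycle n \<omega>) v) \<partial>iid \<nu>) \<le> ennreal \<kappa>'" if "norm v = 1" for v
      using contraction_nearby[OF \<pi>0 n a(1) _ \<kappa>(2) contr that] a \<delta>_small by (simp add: b_def \<theta>_def)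
    define w where "w = enn2real (wasserstein p \<nu> \<nu>')"
    have w: "0 \<le> w" "wasserstein p \<nu> \<nu>' = ennreal w"
      using wasserstein_finite[OF assms(1) \<nu> \<nu>'] by (auto simp: w_def)
    \<comment> \<open>The infimum over couplings need not be attained, so the bound is proved for every larger cost \<open>W\<close>
      and \<open>W\<close> then tends to \<open>w\<close>.\<close>
    have bound: "\<bar>L - L'\<bar> \<le> K * W powr \<theta>" if W: "w < W" for W
    proof -
      have "wasserstein p \<nu> \<nu>' < ennreal W" using w W by (simp add: ennreal_lessI)
      then obtain \<pi> where "coupled_walk \<nu> \<nu>' p C \<pi> W" by (rule coupled_walk_exists[OF walk[OF \<nu>] walk[OF \<nu>']])
      then interpret CW: coupled_walk \<nu> \<nu>' p C \<pi> W .
      show ?thesis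
        using CW.lyapunov_close[OF n a(1) _ \<kappa>' contr' L L'] a assms(1) by (simp add: K_def \<theta>_def)
    qed
    have "(\<lambda>i. w + 1 / real (Suc i)) \<longlonglongrightarrow> w + 0"
      by (intro tendsto_add tendsto_const LIMSEQ_Suc lim_const_over_n)
    then have "(\<lambda>i. K * (w + 1 / real (Suc i)) powr \<theta>) \<longlonglongrightarrow> K * (w + 0) powr \<theta>"
      by (intro tendsto_mult tendsto_const tendsto_powr') (use w \<theta> in auto)
    then have "\<bar>L - L'\<bar> \<le> K * (w + 0) powr \<theta>"
      by (rule LIMSEQ_le_const) (use bound in auto)
    then show ?thesis by (simp add: L L' w_def)
  qed
  then show ?thesis using \<delta> \<theta> by blast
qed

end
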